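(* Let $d\ge2$ and let $\mathbb{P}$ satisfy Assumptions A1–A2 below, with $\epsilon,\lambda,\sigma$ as defined in the context. If $$\lambda>4d\sigma^2(1+9\epsilon),$$ then Kalikow's condition is satisfied in direction $e_1$. In particular, $X$ is ballistic in direction $e_1$, i.e. $\liminf_{n\to\infty}\frac{X_n\cdot e_1}{n}>0$ $P_0$-a.s.
   Context: Let $V=\{x\in\mathbb{Z}^d:|x|_1=1\}$, $\mathcal P$ the probability vectors on $V$, $\Omega=\mathcal P^{\mathbb{Z}^d}$; for $\omega\in\Omega$, $P_{x,\omega}$ is the law of the nearest-neighbour Markov chain $X$ from $x$ with $P_{x,\omega}(X_{n+1}=y+e\mid X_n=y)=\omega(y,e)$; $\mathbb{P}$ is a law on $\Omega$ and $P_x=\mathbb{P}\otimes P_{x,\omega}$ the annealed law. (A1) $\omega(x)$, $x\in\mathbb{Z}^d$, are i.i.d. with law $\mu$; (A2) $\epsilon:=4d\,\|\omega(0)-(\frac1{2d},\dots,\frac1{2d})\|_{L^\infty(\mu)}\in(0,1)$ (the essential sup over $e\in V$ of $|\omega(0,e)-\frac1{2d}|$, times $4d$). $\lambda:=\mathbb{E}(\omega(0,e_1)-\omega(0,-e_1))$, $\sigma:=\sqrt{\sum_{e\in V}\mathrm{Var}_\mu(\omega(0,e))}$. For $B\subsetneq\mathbb{Z}^d$ nonempty connected, $T_B=\inf\{n\ge0:X_n\notin B\}$ and $g_B(x,y,\omega)=E_{x,\omega}\big(\sum_{n=0}^{T_B}\mathbf 1_{\{X_n=y\}}\big)$. Kalikow's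 environment on $B$ from $x\in B$ is $\omega_B^x(y,e)=\mathbb{E}(g_B(x,y,\omega)\omega(y,e))/\mathbb{E}(g_B(x,y,\omega))$ for $y\in B$, and its drift is $\vec d_{B,x}(y)=\sum_{e\in V}\omega_B^x(y,e)e$. Kalikow's condition holds in direction $\ell\in S^{d-1}$ if $\varepsilon_K(\ell):=\inf\{\vec d_{B,0}(y)\cdot\ell: B\subsetneq\mathbb{Z}^d\text{ connected}, 0,y\in B\}>0$. *)

theory Defs
  imports "HOL-Probability.Probability"
begin

text \<open>Sites are elements of int ^ 'd; the dimension is d = CARD('d).\<close>

definition nbr :: "(int ^ 'd) set" where
  "nbr = {x. (\<Sum>i\<in>UNIV. \<bar>x $ i\<bar>) = 1}"

text \<open>Probability vectors on V, seen as functions on Z^d vanishing off V.\<close>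
definition probvecs :: "(int ^ 'd \<Rightarrow> real) set" where
  "probvecs = {p. (\<forall>e. 0 \<le> p e) \<and> (\<forall>e. e \<notin> nbr \<longrightarrow> p e = 0) \<and> (\<Sum>e\<in>nbr. p e) = 1}"

text \<open>Law of the environment: i.i.d. with marginal mu (Assumption A1).\<close>
definition env_law :: "(int ^ 'd \<Rightarrow> real) measure \<Rightarrow> (int ^ 'd \<Rightarrow> int ^ 'd \<Rightarrow> real) measure" where
  "env_law \<mu> = (\<Pi>\<^sub>M x\<in>UNIV. \<mu>)"

definition eps_of :: "(int ^ 'd \<Rightarrow> real) measure \<Rightarrow> real" where
  "eps_of \<mu> = 4 * real CARD('d) *
     real_of_ereal (esssup \<mu> (\<lambda>p. ereal (Max ((\<lambda>e. \<bar>p e - 1 / (2 * real CARD('d))\<bar>) ` (nbr :: (int ^ 'd) set)))))"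

definition lambda_of :: "(int ^ 'd \<Rightarrow> real) measure \<Rightarrow> 'd \<Rightarrow> real" where
  "lambda_of \<mu> i = (\<integral>p. p (axis i 1) - p (- axis i 1) \<partial>\<mu>)"

definition sigma_of :: "(int ^ 'd \<Rightarrow> real) measure \<Rightarrow> real" where
  "sigma_of \<mu> = sqrt (\<Sum>e\<in>(nbr :: (int ^ 'd) set). (\<integral>p. (p e - (\<integral>q. q e \<partial>\<mu>))\<^sup>2 \<partial>\<mu>))"

text \<open>Nearest-neighbour connectedness of a subset of Z^d.\<close>
definition nn_connected :: "(int ^ 'd) set \<Rightarrow> bool" where
  "nn_connected B \<longleftrightarrow> B \<noteq> {} \<and>
     (\<forall>x\<in>B. \<forall>y\<in>B. (x, y) \<in> {(a, b). a \<in> B \<and> b \<in> B \<and> b - a \<in> nbr}\<^sup>*)"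

text \<open>Green function g_B(x,y,omega) = E_{x,omega} sum_{n=0}^{T_B} 1{X_n = y}, written out as
  sum over n and over nearest-neighbour paths (lists of steps es) of length n from x to y
  whose first n positions X_0..X_{n-1} lie in B (i.e. n <= T_B), weighted by their quenched probability.\<close>
definition green :: "(int ^ 'd) set \<Rightarrow> int ^ 'd \<Rightarrow> int ^ 'd \<Rightarrow> (int ^ 'd \<Rightarrow> int ^ 'd \<Rightarrow> real) \<Rightarrow> ennreal" where
  "green B x y \<omega> = (\<Sum>n. ennreal (\<Sum>es\<in>{es. length es = n \<and> set es \<subseteq> nbr}.
      if (\<forall>k<n. x + sum_list (take k es) \<in> B) \<and> x + sum_list es = y
      then (\<Prod>k<n. \<omega> (x + sum_list (take k es)) (es ! k)) else 0))"

text \<open>Kalikow's environment on B from x, and its drift.\<close>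
definition kalikow_env :: "(int ^ 'd \<Rightarrow> int ^ 'd \<Rightarrow> real) measure \<Rightarrow> (int ^ 'd) set \<Rightarrow> int ^ 'd \<Rightarrow> int ^ 'd \<Rightarrow> int ^ 'd \<Rightarrow> real" where
  "kalikow_env P B x y e =
     enn2real ((\<integral>\<^sup>+\<omega>. green B x y \<omega> * ennreal (\<omega> y e) \<partial>P) / (\<integral>\<^sup>+\<omega>. green B x y \<omega> \<partial>P))"

definition kalikow_drift :: "(int ^ 'd \<Rightarrow> int ^ 'd \<Rightarrow> real) measure \<Rightarrow> (int ^ 'd) set \<Rightarrow> int ^ 'd \<Rightarrow> int ^ 'd \<Rightarrow> real ^ 'd" where
  "kalikow_drift P B x y = (\<Sum>e\<in>nbr. kalikow_env P B x y e *\<^sub>R (\<chi> j. real_of_int (e $ j)))"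

definition kalikow_const :: "(int ^ 'd \<Rightarrow> int ^ 'd \<Rightarrow> real) measure \<Rightarrow> real ^ 'd \<Rightarrow> real" where
  "kalikow_const P l = Inf {kalikow_drift P B 0 y \<bullet> l | B y. nn_connected B \<and> B \<noteq> UNIV \<and> 0 \<in> B \<and> y \<in> B}"

definition kalikow_condition :: "(int ^ 'd \<Rightarrow> int ^ 'd \<Rightarrow> real) measure \<Rightarrow> real ^ 'd \<Rightarrow> bool" where
  "kalikow_condition P l \<longleftrightarrow> kalikow_const P l > 0"

text \<open>Path space of the walk and the characterising property of the quenched law P_{0,omega}.\<close>
definition path_space :: "(nat \<Rightarrow> int ^ 'd) measure" where
  "path_space = (\<Pi>\<^sub>M n\<in>UNIV. count_space UNIV)"

definition is_quenched_law :: "(int ^ 'd \<Rightarrow> int ^ 'd \<Rightarrow> real) \<Rightarrow> int ^ 'd \<Rightarrow> (nat \<Rightarrow> int ^ 'd) measure \<Rightarrow> bool" where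
  "is_quenched_law \<omega> x Q \<longleftrightarrow> prob_space Q \<and> sets Q = sets path_space \<and>
     (\<forall>n zs. measure Q {X \<in> space Q. \<forall>k\<le>n. X k = zs k} =
        (if zs 0 = x then (\<Prod>k<n. \<omega> (zs k) (zs (Suc k) - zs k)) else 0))"

end

theory Submission
  imports Defs
begin

text \<open>With the environment frozen off a site \<open>y\<close>, the Green function at \<open>y\<close> is a constant times
  \<open>1 / (\<omega> y \<bullet> q)\<close>, where \<open>q e\<close> is the probability to leave \<open>B\<close> from \<open>y + e\<close> without visiting \<open>y\<close>.
  Expanding this quotient around the mean of \<open>\<omega> y\<close> bounds Kalikow's drift below by
  \<open>\<lambda> - 2\<sigma>\<^sup>2 / \<kappa>\<close>, uniformly in \<open>B\<close> and \<open>y\<close>, where \<open>\<kappa>\<close> is the ellipticity constant;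
  \<open>\<kappa> = (1 - \<epsilon> / 2) / (2d)\<close> gives Kalikow's condition under the hypothesis on \<open>\<lambda>\<close>.

  Kalikow's condition in turn makes the level of the walk a subsolution, and a decreasing exponential
  of the level a supersolution, of annealed exit problems. This gives an annealed mean hitting time
  of level \<open>L\<close> of order \<open>L\<close>, and a positive probability never to go below the starting level.
  On the latter event the walk after the hitting time of level \<open>k\<close> only sees fresh environment, so
  events for the recentred future intersected with \<open>k\<close> being such a regeneration level have
  probabilities not depending on \<open>k\<close>. This stationarity suffices for a maximal inequality,
  which bounds the hitting times linearly, and for bounding the gaps between regeneration levels;
  no independence between consecutive regenerations is needed.\<close>

section \<open>Nearest-neighbour steps\<close>

lemma nbr_iff: "e \<in> nbr \<longleftrightarrow> (\<exists>i. e = axis i 1 \<or> e = - axis i 1)"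
proof
  assume "e \<in> nbr"
  hence sum_1: "(\<Sum>i\<in>UNIV. \<bar>e $ i\<bar>) = 1" by (simp add: nbr_def)
  then obtain i where i: "e $ i \<noteq> 0" by (force intro: ccontr)
  have "(\<Sum>j\<in>UNIV. \<bar>e $ j\<bar>) = \<bar>e $ i\<bar> + (\<Sum>j\<in>UNIV-{i}. \<bar>e $ j\<bar>)"
    by (subst sum.remove[of _ i]) auto
  moreover have "(\<Sum>j\<in>UNIV-{i}. \<bar>e $ j\<bar>) \<ge> 0" by (intro sum_nonneg) auto
  ultimately have abs_1: "\<bar>e $ i\<bar> = 1" and "(\<Sum>j\<in>UNIV-{i}. \<bar>e $ j\<bar>) = 0"
    using sum_1 i by linarith+
  hence other_0: "e $ j = 0" if "j \<noteq> i" for j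
    using that by (subst (asm) sum_nonneg_eq_0_iff) auto
  from abs_1 have "e $ i = 1 \<or> e $ i = - 1" by linarith
  thus "\<exists>i. e = axis i 1 \<or> e = - axis i 1" using other_0
    by (intro exI[of _ i]) (auto simp: vec_eq_iff axis_def)
next
  assume "\<exists>i. e = axis i 1 \<or> e = - axis i 1"
  then obtain i where "e = axis i 1 \<or> e = - axis i 1" by blast
  hence "\<bar>e $ j\<bar> = (if j = i then 1 else 0)" for j by (auto simp: axis_def)
  thus "e \<in> nbr" by (simp add: nbr_def)
qed

lemma axis_in_nbr [simp]: "axis i 1 \<in> nbr" "- axis i 1 \<in> nbr"
  by (auto simp: nbr_iff)

lemma uminus_in_nbr_iff [simp]: "- e \<in> nbr \<longleftrightarrow> e \<in> nbr"
  by (simp add: nbr_def)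

lemma finite_nbr [simp, intro]: "finite (nbr :: (int ^ 'd) set)"
proof (rule finite_subset)
  show "nbr \<subseteq> range (\<lambda>i. axis i 1 :: int ^ 'd) \<union> range (\<lambda>i. - axis i 1)"
    by (auto simp: nbr_iff)
qed simp

lemma axis_neq_uminus_axis: "axis i (1::int) \<noteq> - axis j 1"
proof
  assume "axis i (1::int) = - axis j 1"
  hence "axis i (1::int) $ i = (- axis j 1) $ i" by simp
  thus False by (simp add: axis_def split: if_splits)
qed

lemma nbr_component:
  assumes "e \<in> nbr"
  shows "e $ i = (if e = axis i 1 then 1 else if e = - axis i 1 then -1 else 0)"
proof -
  obtain j where j: "e = axis j 1 \<or> e = - axis j 1" using assms by (auto simp: nbr_iff)
  show ?thesis
  proof (cases "i = j")
    case True
    thus ?thesis using j axis_neq_uminus_axis[of j j] by (auto simp: axis_def)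
  next
    case False
    hence "e $ i = 0" using j by (auto simp: axis_def)
    thus ?thesis by (auto simp: axis_def)
  qed
qed

lemma abs_nbr_component_le: "e \<in> nbr \<Longrightarrow> \<bar>e $ i\<bar> \<le> 1"
  by (simp add: nbr_component)

lemma sum_nbr_axis:
  fixes h :: "int ^ 'd \<Rightarrow> 'a :: comm_monoid_add"
  assumes "\<And>e. e \<in> nbr \<Longrightarrow> e $ i = 0 \<Longrightarrow> h e = 0"
  shows "(\<Sum>e\<in>nbr. h e) = h (axis i 1) + h (- axis i 1)"
proof -
  have "(\<Sum>e\<in>nbr. h e) = (\<Sum>e\<in>{axis i 1, - axis i 1}. h e)"
    using assms by (intro sum.mono_neutral_right) (auto simp: nbr_component)
  thus ?thesis using axis_neq_uminus_axis[of i i] by simp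
qed

lemma sum_nbr_component:
  fixes h :: "int ^ 'd \<Rightarrow> 'a :: comm_ring_1"
  shows "(\<Sum>e\<in>nbr. h e * of_int (e $ i)) = h (axis i 1) - h (- axis i 1)"
  by (subst sum_nbr_axis[of i]) (auto simp: axis_def)

abbreviation nn_edges :: "(int ^ 'd) set \<Rightarrow> ((int ^ 'd) \<times> (int ^ 'd)) set" where
  "nn_edges B \<equiv> {(a, b). a \<in> B \<and> b \<in> B \<and> b - a \<in> nbr}"

lemma sym_nn_edges: "sym (nn_edges B)"
proof (rule symI)
  fix a b assume "(a, b) \<in> nn_edges B"
  thus "(b, a) \<in> nn_edges B" using uminus_in_nbr_iff[of "b - a"] by simp
qed

lemma nn_connectedI:
  fixes B :: "(int ^ 'd) set"
  assumes zero: "0 \<in> B"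
    and toward_zero: "\<And>x i. x \<in> B \<Longrightarrow> x $ i \<noteq> 0 \<Longrightarrow> x - axis i (sgn (x $ i)) \<in> B"
  shows "nn_connected B"
proof -
  have from_zero: "x \<in> B \<Longrightarrow> (0, x) \<in> (nn_edges B)\<^sup>*" for x
  proof (induction "nat (\<Sum>i\<in>UNIV. \<bar>x $ i\<bar>)" arbitrary: x rule: less_induct)
    case (less x)
    show ?case
    proof (cases "x = 0")
      case False
      then obtain i where i: "x $ i \<noteq> 0" by (auto simp: vec_eq_iff)
      define e where "e = (axis i (sgn (x $ i)) :: int ^ 'd)"
      have e: "e \<in> nbr" using i by (auto simp: e_def sgn_if nbr_iff vec_eq_iff axis_def)
      have xe: "x - e \<in> B" unfolding e_def by (rule toward_zero) fact+
      have "(\<Sum>j\<in>UNIV. \<bar>(x - e) $ j\<bar>) < (\<Sum>j\<in>UNIV. \<bar>x $ j\<bar>)"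
        using i by (intro sum_strict_mono_ex1)
          (auto simp: e_def axis_def sgn_if intro!: exI[of _ i])
      moreover have "(\<Sum>j\<in>UNIV. \<bar>(x - e) $ j\<bar>) \<ge> 0" by (intro sum_nonneg) auto
      ultimately have "(0, x - e) \<in> (nn_edges B)\<^sup>*" using xe by (intro less) linarith+
      moreover have "(x - e, x) \<in> nn_edges B" using e xe less.prems by simp
      ultimately show ?thesis by (rule rtrancl_into_rtrancl)
    qed simp
  qed
  have to_zero: "x \<in> B \<Longrightarrow> (x, 0) \<in> (nn_edges B)\<^sup>*" for x
    using symD[OF sym_rtrancl[OF sym_nn_edges]] from_zero by blast
  show ?thesis
    using zero rtrancl_trans[OF to_zero from_zero] by (auto simp: nn_connected_def)
qed

definition cube :: "int \<Rightarrow> (int ^ 'd) set" where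
  "cube R = {x. \<forall>i. \<bar>x $ i\<bar> \<le> R}"

lemma zero_in_cube: "0 \<le> R \<Longrightarrow> 0 \<in> cube R"
  by (simp add: cube_def)

lemma finite_cube: "finite (cube R :: (int ^ 'd) set)"
proof (rule finite_subset)
  show "(cube R :: (int ^ 'd) set) \<subseteq> vec_lambda ` (\<Pi>\<^sub>E i\<in>UNIV. {-R..R})"
  proof
    fix x :: "int ^ 'd" assume "x \<in> cube R"
    hence "vec_nth x \<in> (\<Pi>\<^sub>E i\<in>UNIV. {-R..R})" by (auto simp: cube_def abs_le_iff minus_le_iff)
    moreover have "x = vec_lambda (vec_nth x)" by simp
    ultimately show "x \<in> vec_lambda ` (\<Pi>\<^sub>E i\<in>UNIV. {-R..R})" by blast
  qed
  show "finite (vec_lambda ` (\<Pi>\<^sub>E i\<in>(UNIV :: 'd set). {-R..R}) :: (int ^ 'd) set)"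
    by (intro finite_imageI finite_PiE) auto
qed

lemma nn_connected_cube_Int:
  assumes "0 \<le> R" "0 \<in> H" "\<And>x i. x \<in> H \<Longrightarrow> x $ i \<noteq> 0 \<Longrightarrow> x - axis i (sgn (x $ i)) \<in> H"
  shows "nn_connected (cube R \<inter> H)"
proof (rule nn_connectedI)
  fix x i assume x: "x \<in> cube R \<inter> H" "x $ i \<noteq> 0"
  have "\<bar>x $ j\<bar> \<le> R" for j using x by (simp add: cube_def)
  hence "\<bar>(x - axis i (sgn (x $ i))) $ j\<bar> \<le> R" for j
    by (rule order.trans[rotated]) (auto simp: axis_def sgn_if)
  thus "x - axis i (sgn (x $ i)) \<in> cube R \<inter> H" using x assms(3) by (auto simp: cube_def)
qed (use assms in \<open>auto simp: cube_def\<close>)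

section \<open>General facts from probability\<close>

lemma integrable_divide_bounded_below:
  fixes \<eta> D :: "'a \<Rightarrow> real"
  assumes "integrable M \<eta>" "D \<in> borel_measurable M" "0 < \<delta>" "AE x in M. \<delta> \<le> D x"
  shows "integrable M (\<lambda>x. \<eta> x / D x)"
proof (rule Bochner_Integration.integrable_bound)
  show "integrable M (\<lambda>x. \<eta> x * (1 / \<delta>))" by (intro integrable_mult_left assms)
  show "AE x in M. norm (\<eta> x / D x) \<le> norm (\<eta> x * (1 / \<delta>))" using assms(4)
  proof eventually_elim
    case (elim x)
    have "\<bar>\<eta> x\<bar> * (1 / D x) \<le> \<bar>\<eta> x\<bar> * (1 / \<delta>)"
      using elim assms(3) by (intro mult_left_mono frac_le) auto
    thus ?case using elim assms(3) by simp
  qed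
qed (use assms in measurable)

lemma (in prob_space) inverse_expectation_le:
  fixes D :: "'a \<Rightarrow> real"
  assumes D: "integrable M D" "0 < \<delta>" "AE x in M. \<delta> \<le> D x"
  shows "1 / expectation D \<le> expectation (\<lambda>x. 1 / D x)"
proof -
  have "inverse (expectation D) \<le> expectation (\<lambda>x. inverse (D x))"
  proof (rule jensens_inequality[of D "{0<..}" 0 1 inverse])
    show "AE x in M. D x \<in> {0<..}" using D(3) by eventually_elim (use D(2) in simp)
    show "convex_on {0<..} (inverse :: real \<Rightarrow> real)"
      by (rule convex_on_inverse) (simp_all add: convex_real_interval)
    show "integrable M (\<lambda>x. inverse (D x))"
      using integrable_divide_bounded_below[of M "\<lambda>_. 1" D \<delta>] D by (simp add: inverse_eq_divide)
  qed (use D in simp_all)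
  thus ?thesis by (simp add: inverse_eq_divide)
qed

lemma (in prob_space) centered_quotient_ge:
  fixes D \<eta> W :: "'a \<Rightarrow> real"
  assumes \<eta>: "integrable M \<eta>" "expectation \<eta> = 0"
    and D: "integrable M D" "0 < \<delta>" "AE x in M. \<delta> \<le> D x"
    and W: "integrable M W" "AE x in M. \<bar>\<eta> x * (D x - expectation D)\<bar> \<le> W x * D x"
  shows "- (expectation W * expectation (\<lambda>x. 1 / D x)) \<le> expectation (\<lambda>x. \<eta> x / D x)"
proof -
  have D_pos: "AE x in M. 0 < D x" using D(3) by eventually_elim (use D(2) in simp)
  have mean_pos: "0 < expectation D"
    using integral_ge_const[OF D(1,3)] D(2) by linarith
  have "AE x in M. 0 \<le> W x" using W(2) D_pos
  proof eventually_elim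
    case (elim x)
    hence "0 \<le> W x * D x" by linarith
    thus ?case using elim by (simp add: zero_le_mult_iff)
  qed
  hence W_nonneg: "0 \<le> expectation W" by (rule integral_nonneg_AE)
  have "- expectation W = expectation (\<lambda>x. \<eta> x - W x)"
    using \<eta> W(1) by simp
  also have "\<dots> \<le> expectation (\<lambda>x. expectation D * (\<eta> x / D x))"
  proof (intro integral_mono_AE)
    show "AE x in M. \<eta> x - W x \<le> expectation D * (\<eta> x / D x)"
      using W(2) D_pos
    proof eventually_elim
      case (elim x)
      have "\<eta> x * (D x - expectation D) / D x \<le> W x"
        using elim by (simp add: pos_divide_le_eq)
      moreover have "\<eta> x * (D x - expectation D) / D x = \<eta> x - expectation D * (\<eta> x / D x)"
        using elim by (simp add: field_simps)
      ultimately show ?case by linarith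
    qed
    show "integrable M (\<lambda>x. expectation D * (\<eta> x / D x))"
      using integrable_divide_bounded_below[OF \<eta>(1) _ D(2,3)] D(1)
      by (intro integrable_mult_right) auto
  qed (use \<eta> W in simp)
  also have "\<dots> = expectation D * expectation (\<lambda>x. \<eta> x / D x)"
    by (rule integral_mult_right_zero)
  finally have "- (expectation W * (1 / expectation D)) \<le> expectation (\<lambda>x. \<eta> x / D x)"
    using mean_pos by (simp add: field_simps)
  moreover have "expectation W * (1 / expectation D) \<le> expectation W * expectation (\<lambda>x. 1 / D x)"
    by (intro mult_left_mono inverse_expectation_le[OF D] W_nonneg)
  ultimately show ?thesis by linarith
qed

lemma (in prob_space) sum_prob_le_expectation:
  fixes f :: "'a \<Rightarrow> real"
  assumes "finite K" "\<And>k. k \<in> K \<Longrightarrow> E k \<in> events" "integrable M f"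
    and "AE x in M. real (card {k \<in> K. x \<in> E k}) \<le> f x"
  shows "(\<Sum>k\<in>K. prob (E k)) \<le> expectation f"
proof -
  have card_eq: "real (card {k \<in> K. x \<in> E k}) = (\<Sum>k\<in>K. indicator (E k) x)" for x
    using assms(1) by (simp add: indicator_def sum.If_cases Int_def)
  have "(\<Sum>k\<in>K. prob (E k)) = expectation (\<lambda>x. \<Sum>k\<in>K. indicator (E k) x)"
    using assms(1,2)
    by (subst Bochner_Integration.integral_sum) (auto intro!: sum.cong simp: emeasure_eq_measure)
  also have "\<dots> \<le> expectation f"
    using assms
    by (intro integral_mono_AE Bochner_Integration.integrable_sum)
      (auto simp: card_eq emeasure_eq_measure)
  finally show ?thesis .
qed

lemma (in prob_space) tendsto_prob_of_eventually_mem_iff: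
  assumes "\<And>k. E k \<in> events" "S \<in> events"
    and "AE x in M. \<forall>\<^sub>F k in sequentially. x \<in> E k \<longleftrightarrow> x \<in> S"
  shows "(\<lambda>k. prob (E k)) \<longlonglongrightarrow> prob S"
proof -
  have "(\<lambda>k. expectation (indicator (E k) :: 'a \<Rightarrow> real)) \<longlonglongrightarrow> expectation (indicator S)"
  proof (rule integral_dominated_convergence[where w = "\<lambda>_. 1"])
    show "AE x in M. (\<lambda>k. indicator (E k) x :: real) \<longlonglongrightarrow> indicator S x"
      using assms(3) by eventually_elim
        (auto intro!: tendsto_eventually elim!: eventually_mono simp: indicator_def)
  qed (use assms in \<open>auto simp: indicator_def\<close>)
  thus ?thesis using assms(1,2) by simp
qed

lemma emeasure_countable_valued_eq_mult:
  fixes Y :: "'a \<Rightarrow> 'c :: countable"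
  assumes Y: "Y \<in> measurable M (count_space UNIV)" "A \<in> sets M"
    and Z: "Z \<in> measurable N (count_space UNIV)" "B \<in> sets N"
    and eq: "\<And>w. w \<in> S \<Longrightarrow> emeasure M {x \<in> A. Y x = w} = c * emeasure N {x \<in> B. Z x = w}"
  shows "emeasure M {x \<in> A. Y x \<in> S} = c * emeasure N {x \<in> B. Z x \<in> S}"
proof -
  have UN: "emeasure L {x \<in> C. V x \<in> S} = (\<integral>\<^sup>+w. emeasure L {x \<in> C. V x = w} \<partial>count_space S)"
    if V: "V \<in> measurable L (count_space UNIV)" and C: "C \<in> sets L"
    for L :: "'e measure" and V :: "'e \<Rightarrow> 'c" and C
  proof -
    have "{x \<in> C. V x = w} = V -` {w} \<inter> space L \<inter> C" for w
      using sets.sets_into_space[OF C] by auto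
    hence "{x \<in> C. V x = w} \<in> sets L" for w
      using measurable_sets[OF V, of "{w}"] C by simp
    moreover have "{x \<in> C. V x \<in> S} = (\<Union>w\<in>S. {x \<in> C. V x = w})" by auto
    ultimately show ?thesis
      using emeasure_UN_countable[of S "\<lambda>w. {x \<in> C. V x = w}" L]
      by (auto simp: disjoint_family_on_def)
  qed
  show ?thesis
    by (simp add: UN[OF Y] UN[OF Z] eq nn_integral_cmult[symmetric] cong: nn_integral_cong_simp)
qed

section \<open>The single-site estimate\<close>

definition elliptic_vecs :: "real \<Rightarrow> (int ^ 'd \<Rightarrow> real) set" where
  "elliptic_vecs \<kappa> = {p \<in> probvecs. \<forall>e\<in>nbr. \<kappa> \<le> p e}"

lemma probvecsD:
  assumes "p \<in> probvecs"
  shows "0 \<le> p e" "e \<notin> nbr \<Longrightarrow> p e = 0" "(\<Sum>e\<in>nbr. p e) = 1"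
  using assms by (auto simp: probvecs_def)

lemma probvecs_le_1:
  assumes "p \<in> probvecs"
  shows "p e \<le> 1"
proof (cases "e \<in> nbr")
  case True
  hence "p e \<le> (\<Sum>e\<in>nbr. p e)" using probvecsD(1)[OF assms] by (intro member_le_sum) auto
  thus ?thesis using probvecsD(3)[OF assms] by simp
qed (simp add: probvecsD(2)[OF assms])

lemma elliptic_vecs_subset_probvecs: "elliptic_vecs \<kappa> \<subseteq> probvecs"
  by (auto simp: elliptic_vecs_def)

lemma elliptic_vecsD: "p \<in> elliptic_vecs \<kappa> \<Longrightarrow> e \<in> nbr \<Longrightarrow> \<kappa> \<le> p e"
  by (simp add: elliptic_vecs_def)

lemma AE_elliptic_of_eps:
  fixes \<mu> :: "(int ^ 'd \<Rightarrow> real) measure"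
  assumes "AE p in \<mu>. p \<in> probvecs" "0 < eps_of \<mu>"
  shows "AE p in \<mu>. p \<in> elliptic_vecs ((1 - eps_of \<mu> / 2) / (2 * real CARD('d)))"
proof -
  let ?dev = "\<lambda>p. Max ((\<lambda>e. \<bar>p e - 1 / (2 * real CARD('d))\<bar>) ` (nbr :: (int ^ 'd) set))"
  let ?s = "esssup \<mu> (\<lambda>p. ereal (?dev p))"
  have "\<bar>?s\<bar> \<noteq> \<infinity>" using assms(2) by (auto simp: eps_of_def)
  hence s_eq: "?s = ereal (eps_of \<mu> / (4 * real CARD('d)))"
    by (auto simp: eps_of_def field_simps)
  have "AE p in \<mu>. ereal (?dev p) \<le> ?s" by (rule esssup_AE)
  with assms(1) show ?thesis
  proof eventually_elim
    case (elim p)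
    have "(1 - eps_of \<mu> / 2) / (2 * real CARD('d)) \<le> p e" if e: "e \<in> nbr" for e
    proof -
      have "\<bar>p e - 1 / (2 * real CARD('d))\<bar> \<le> ?dev p"
        using e by (intro Max_ge) auto
      also have "\<dots> \<le> eps_of \<mu> / (4 * real CARD('d))" using elim(2) unfolding s_eq by simp
      finally have "1 / (2 * real CARD('d)) - eps_of \<mu> / (4 * real CARD('d)) \<le> p e" by linarith
      thus ?thesis by (simp add: diff_divide_distrib)
    qed
    thus ?case using elim(1) by (simp add: elliptic_vecs_def)
  qed
qed

lemma abs_diff_mult_abs_weighted_sum_le:
  fixes \<xi> q :: "'a \<Rightarrow> real"
  assumes "finite A" "a \<in> A" "b \<in> A" "\<And>e. e \<in> A \<Longrightarrow> 0 \<le> q e"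
  shows "\<bar>\<xi> a - \<xi> b\<bar> * \<bar>\<Sum>e\<in>A. \<xi> e * q e\<bar> \<le> 2 * (\<Sum>e\<in>A. (\<xi> e)\<^sup>2) * (\<Sum>e\<in>A. q e)"
proof -
  define V where "V = (\<Sum>e\<in>A. (\<xi> e)\<^sup>2)"
  have V_nonneg: "0 \<le> V" unfolding V_def by (intro sum_nonneg) auto
  have abs_le: "\<bar>\<xi> e\<bar> \<le> sqrt V" if "e \<in> A" for e
  proof -
    have "(\<xi> e)\<^sup>2 \<le> V" unfolding V_def using that assms(1) by (intro member_le_sum) auto
    thus ?thesis by (metis real_sqrt_abs real_sqrt_le_mono)
  qed
  have "\<bar>\<Sum>e\<in>A. \<xi> e * q e\<bar> \<le> (\<Sum>e\<in>A. sqrt V * q e)"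
    using abs_le assms(4)
    by (intro order.trans[OF sum_abs sum_mono]) (auto simp: abs_mult intro!: mult_right_mono)
  moreover have "\<bar>\<xi> a - \<xi> b\<bar> \<le> 2 * sqrt V"
    using abs_le[OF assms(2)] abs_le[OF assms(3)] by linarith
  ultimately have "\<bar>\<xi> a - \<xi> b\<bar> * \<bar>\<Sum>e\<in>A. \<xi> e * q e\<bar> \<le> (2 * sqrt V) * (sqrt V * (\<Sum>e\<in>A. q e))"
    by (intro mult_mono) (auto simp: sum_distrib_left V_nonneg)
  also have "\<dots> = 2 * V * (\<Sum>e\<in>A. q e)" using V_nonneg by simp
  finally show ?thesis by (simp only: V_def)
qed

locale rwre = mu: prob_space \<mu> for \<mu> :: "(int ^ 'd \<Rightarrow> real) measure" +
  assumes sets_mu: "sets \<mu> = sets (\<Pi>\<^sub>M e\<in>UNIV. (borel :: real measure))"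
    and AE_probvecs: "AE p in \<mu>. p \<in> probvecs"
begin

lemma measurable_component_mu [measurable]: "(\<lambda>p. p e) \<in> borel_measurable \<mu>"
  by (subst measurable_cong_sets[OF sets_mu refl]) simp

lemma integrable_bounded_on_probvecs:
  fixes f :: "_ \<Rightarrow> real"
  assumes "f \<in> borel_measurable \<mu>" "\<And>p. p \<in> probvecs \<Longrightarrow> \<bar>f p\<bar> \<le> K"
  shows "integrable \<mu> f"
  using assms AE_probvecs by (intro mu.integrable_const_bound[of _ K]) auto

lemma integrable_component [simp]: "integrable \<mu> (\<lambda>p. p e)"
  by (rule integrable_bounded_on_probvecs[of _ 1]) (auto simp: probvecsD(1) probvecs_le_1)

definition site_mean :: "int ^ 'd \<Rightarrow> real" where
  "site_mean e = (\<integral>p. p e \<partial>\<mu>)"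

lemma lambda_of_eq: "lambda_of \<mu> i = site_mean (axis i 1) - site_mean (- axis i 1)"
  by (simp add: lambda_of_def site_mean_def)

definition sq_deviation :: "(int ^ 'd \<Rightarrow> real) \<Rightarrow> real" where
  "sq_deviation p = (\<Sum>e\<in>nbr. (p e - site_mean e)\<^sup>2)"

lemma integrable_sq_component: "integrable \<mu> (\<lambda>p. (p e - site_mean e)\<^sup>2)"
proof (rule integrable_bounded_on_probvecs[of _ 1])
  have "0 \<le> site_mean e" "site_mean e \<le> 1"
    unfolding site_mean_def
    by (auto intro!: integral_nonneg_AE mu.integral_le_const eventually_mono[OF AE_probvecs]
        simp: probvecsD(1) probvecs_le_1)
  thus "\<bar>(p e - site_mean e)\<^sup>2\<bar> \<le> 1" if "p \<in> probvecs" for p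
    using probvecsD(1)[OF that, of e] probvecs_le_1[OF that, of e]
    by (auto simp: abs_square_le_1 abs_le_iff)
qed measurable

lemma integrable_sq_deviation: "integrable \<mu> sq_deviation"
  unfolding sq_deviation_def by (intro Bochner_Integration.integrable_sum integrable_sq_component)

lemma sigma_of_sq: "(sigma_of \<mu>)\<^sup>2 = (\<integral>p. sq_deviation p \<partial>\<mu>)"
proof -
  have "(sigma_of \<mu>)\<^sup>2 = (\<Sum>e\<in>nbr. (\<integral>p. (p e - site_mean e)\<^sup>2 \<partial>\<mu>))"
    unfolding sigma_of_def site_mean_def by (intro real_sqrt_pow2 sum_nonneg) auto
  also have "\<dots> = (\<integral>p. sq_deviation p \<partial>\<mu>)" unfolding sq_deviation_def
    by (rule Bochner_Integration.integral_sum[symmetric]) (rule integrable_sq_component)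
  finally show ?thesis .
qed

end

locale elliptic_rwre = rwre \<mu> for \<mu> :: "(int ^ 'd \<Rightarrow> real) measure" +
  fixes \<kappa> :: real
  assumes kappa_pos: "0 < \<kappa>"
    and AE_elliptic: "AE p in \<mu>. p \<in> elliptic_vecs \<kappa>"
begin

definition drift_bound :: "'d \<Rightarrow> real" where
  "drift_bound i = lambda_of \<mu> i - 2 / \<kappa> * (sigma_of \<mu>)\<^sup>2"

lemma elliptic_weighted_sum_ge:
  assumes "p \<in> elliptic_vecs \<kappa>" "\<And>e. e \<in> nbr \<Longrightarrow> 0 \<le> q e"
  shows "\<kappa> * (\<Sum>e\<in>nbr. q e) \<le> (\<Sum>e\<in>nbr. p e * q e)"
  unfolding sum_distrib_left
  using assms by (intro sum_mono mult_right_mono) (auto intro: elliptic_vecsD)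

lemma abs_deviation_product_le:
  assumes p: "p \<in> elliptic_vecs \<kappa>" and q: "\<And>e. e \<in> nbr \<Longrightarrow> 0 \<le> q e"
  shows "\<bar>(p (axis i 1) - p (- axis i 1) - lambda_of \<mu> i) * (\<Sum>e\<in>nbr. (p e - site_mean e) * q e)\<bar>
    \<le> 2 / \<kappa> * sq_deviation p * (\<Sum>e\<in>nbr. p e * q e)"
proof -
  have centered: "p (axis i 1) - p (- axis i 1) - lambda_of \<mu> i =
      (p (axis i 1) - site_mean (axis i 1)) - (p (- axis i 1) - site_mean (- axis i 1))"
    by (simp add: lambda_of_eq)
  have "\<bar>(p (axis i 1) - p (- axis i 1) - lambda_of \<mu> i) * (\<Sum>e\<in>nbr. (p e - site_mean e) * q e)\<bar>
      \<le> 2 * sq_deviation p * (\<Sum>e\<in>nbr. q e)"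
    unfolding centered abs_mult sq_deviation_def
    by (rule abs_diff_mult_abs_weighted_sum_le) (use q in auto)
  also have "\<dots> = 2 / \<kappa> * sq_deviation p * (\<kappa> * (\<Sum>e\<in>nbr. q e))" using kappa_pos by simp
  also have "\<dots> \<le> 2 / \<kappa> * sq_deviation p * (\<Sum>e\<in>nbr. p e * q e)"
    using elliptic_weighted_sum_ge[OF p q] kappa_pos
    by (intro mult_left_mono mult_nonneg_nonneg) (auto simp: sq_deviation_def sum_nonneg)
  finally show ?thesis .
qed

lemma single_site_estimate:
  fixes q :: "int ^ 'd \<Rightarrow> real"
  assumes q: "\<And>e. e \<in> nbr \<Longrightarrow> 0 \<le> q e" "0 < (\<Sum>e\<in>nbr. q e)"
  shows "0 \<le> (\<integral>p. (p (axis i 1) - p (- axis i 1) - drift_bound i) / (\<Sum>e\<in>nbr. p e * q e) \<partial>\<mu>)"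
proof -
  define D where "D p = (\<Sum>e\<in>nbr. p e * q e)" for p :: "int ^ 'd \<Rightarrow> real"
  define \<eta> where "\<eta> p = p (axis i 1) - p (- axis i 1) - lambda_of \<mu> i" for p :: "int ^ 'd \<Rightarrow> real"
  have D_pos: "0 < \<kappa> * (\<Sum>e\<in>nbr. q e)" using kappa_pos q by simp
  have D_ge: "AE p in \<mu>. \<kappa> * (\<Sum>e\<in>nbr. q e) \<le> D p"
    unfolding D_def using AE_elliptic
    by eventually_elim (rule elliptic_weighted_sum_ge[OF _ q(1)])
  have int_D: "integrable \<mu> D" unfolding D_def by (intro Bochner_Integration.integrable_sum) auto
  have D_diff: "D p - (\<integral>p. D p \<partial>\<mu>) = (\<Sum>e\<in>nbr. (p e - site_mean e) * q e)" for p
    unfolding D_def site_mean_def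
    by (subst Bochner_Integration.integral_sum) (auto simp: left_diff_distrib sum_subtractf)
  have int_\<eta>: "integrable \<mu> \<eta>" unfolding \<eta>_def by simp
  have mean_\<eta>: "(\<integral>p. \<eta> p \<partial>\<mu>) = 0"
    unfolding \<eta>_def lambda_of_eq by (simp add: site_mean_def mu.prob_space)
  note int_div =
    integrable_divide_bounded_below[OF _ borel_measurable_integrable[OF int_D] D_pos D_ge]
  have "AE p in \<mu>. \<bar>\<eta> p * (D p - (\<integral>p. D p \<partial>\<mu>))\<bar> \<le> 2 / \<kappa> * sq_deviation p * D p"
    unfolding D_diff using AE_elliptic
    by eventually_elim (unfold \<eta>_def D_def, rule abs_deviation_product_le[OF _ q(1)])
  from mu.centered_quotient_ge[OF int_\<eta> mean_\<eta> int_D D_pos D_ge _ this] integrable_sq_deviation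
  have "- (2 / \<kappa> * (sigma_of \<mu>)\<^sup>2 * (\<integral>p. 1 / D p \<partial>\<mu>)) \<le> (\<integral>p. \<eta> p / D p \<partial>\<mu>)"
    by (simp add: sigma_of_sq)
  hence "0 \<le> (\<integral>p. \<eta> p / D p \<partial>\<mu>) + (\<integral>p. 2 / \<kappa> * (sigma_of \<mu>)\<^sup>2 * (1 / D p) \<partial>\<mu>)"
    by (subst integral_mult_right_zero) linarith
  also have "\<dots> = (\<integral>p. \<eta> p / D p + 2 / \<kappa> * (sigma_of \<mu>)\<^sup>2 * (1 / D p) \<partial>\<mu>)"
    by (intro Bochner_Integration.integral_add[symmetric] integrable_mult_right int_div int_\<eta>) simp
  also have "\<dots> = (\<integral>p. (p (axis i 1) - p (- axis i 1) - drift_bound i) / D p \<partial>\<mu>)"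
    by (intro Bochner_Integration.integral_cong refl)
      (simp add: \<eta>_def drift_bound_def diff_divide_distrib add_divide_distrib)
  finally show ?thesis unfolding D_def .
qed

end

section \<open>The quenched Green function\<close>

primrec path_weight ::
  "(int ^ 'd \<Rightarrow> int ^ 'd \<Rightarrow> real) \<Rightarrow> (int ^ 'd) set \<Rightarrow> int ^ 'd \<Rightarrow> nat \<Rightarrow> int ^ 'd \<Rightarrow> real" where
  "path_weight \<omega> B y 0 x = (if x = y then 1 else 0)"
| "path_weight \<omega> B y (Suc n) x =
    (if x \<in> B then \<Sum>e\<in>nbr. \<omega> x e * path_weight \<omega> B y n (x + e) else 0)"

definition step_lists :: "nat \<Rightarrow> (int ^ 'd) list set" where
  "step_lists n = {es. length es = n \<and> set es \<subseteq> nbr}"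

lemma sum_step_lists_Suc:
  fixes f :: "(int ^ 'd) list \<Rightarrow> _"
  shows "(\<Sum>es\<in>step_lists (Suc n). f es) = (\<Sum>e\<in>nbr. \<Sum>es\<in>step_lists n. f (e # es))"
proof -
  have "(step_lists (Suc n) :: (int ^ 'd) list set) = (\<lambda>(e, es). e # es) ` (nbr \<times> step_lists n)"
    by (auto simp: step_lists_def length_Suc_conv image_iff)
  moreover have "inj_on (\<lambda>(e, es). e # es) (nbr \<times> (step_lists n :: (int ^ 'd) list set))"
    by (auto simp: inj_on_def)
  ultimately show ?thesis
    by (simp add: sum.reindex sum.cartesian_product case_prod_unfold)
qed

lemma path_weight_eq_sum_step_lists:
  fixes x :: "int ^ 'd"
  shows "path_weight \<omega> B y n x = (\<Sum>es\<in>step_lists n.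
      if (\<forall>k<n. x + sum_list (take k es) \<in> B) \<and> x + sum_list es = y
      then (\<Prod>k<n. \<omega> (x + sum_list (take k es)) (es ! k)) else 0)"
proof (induction n arbitrary: x)
  case 0
  have "step_lists 0 = {[] :: (int ^ 'd) list}" by (auto simp: step_lists_def)
  thus ?case by simp
next
  case (Suc n)
  have all_less_Suc: "(\<forall>k<Suc n. P k) \<longleftrightarrow> P 0 \<and> (\<forall>k<n. P (Suc k))" for P :: "nat \<Rightarrow> bool"
    using less_Suc_eq_0_disj by auto
  show ?case
    unfolding sum_step_lists_Suc path_weight.simps Suc all_less_Suc prod.lessThan_Suc_shift
    by (cases "x \<in> B")
      (simp_all add: sum_distrib_left add.assoc if_distrib[of "(*) _"] cong: if_cong)
qed

lemma green_eq_suminf: "green B x y \<omega> = (\<Sum>n. ennreal (path_weight \<omega> B y n x))"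
  unfolding green_def path_weight_eq_sum_step_lists step_lists_def ..

lemma path_weight_cong:
  "(\<And>x. x \<in> B \<Longrightarrow> \<omega> x = \<omega>' x) \<Longrightarrow> path_weight \<omega> B y n x = path_weight \<omega>' B y n x"
  by (induction n arbitrary: x) auto

lemma path_weight_nonneg:
  assumes "range \<omega> \<subseteq> probvecs"
  shows "0 \<le> path_weight \<omega> B y n x"
  using probvecsD(1) assms
  by (induction n arbitrary: x) (auto intro!: sum_nonneg mult_nonneg_nonneg simp: image_subset_iff)

lemma path_weight_first_hit:
  assumes "y \<in> B"
  shows "path_weight \<omega> B y n x =
    (\<Sum>j\<le>n. path_weight \<omega> (B - {y}) y j x * path_weight \<omega> B y (n - j) y)"
proof (induction n arbitrary: x)
  case (Suc n)
  let ?avoid = "path_weight \<omega> (B - {y}) y" and ?ret = "\<lambda>j. path_weight \<omega> B y (n - j) y"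
  have "(\<Sum>j\<le>n. ?avoid (Suc j) x * ?ret j) = (if x \<noteq> y then path_weight \<omega> B y (Suc n) x else 0)"
  proof (cases "x \<in> B - {y}")
    case True
    hence "(\<Sum>j\<le>n. ?avoid (Suc j) x * ?ret j) =
        (\<Sum>j\<le>n. \<Sum>e\<in>nbr. \<omega> x e * (?avoid j (x + e) * ?ret j))"
      by (simp add: sum_distrib_right mult.assoc)
    also have "\<dots> = (\<Sum>e\<in>nbr. \<omega> x e * (\<Sum>j\<le>n. ?avoid j (x + e) * ?ret j))"
      by (subst sum.swap) (simp add: sum_distrib_left)
    also have "\<dots> = path_weight \<omega> B y (Suc n) x" using True by (simp add: Suc)
    finally show ?thesis using True by simp
  qed (auto simp del: sum.atMost_Suc)
  thus ?case unfolding sum.atMost_Suc_shift by auto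
qed simp

text \<open>Removing \<open>y\<close> from \<open>B\<close> stops the walk at its first visit to \<open>y\<close>, so the sum is a
  probability, and it does not depend on \<open>\<omega> y\<close>.\<close>
definition hit_prob ::
  "(int ^ 'd) set \<Rightarrow> int ^ 'd \<Rightarrow> (int ^ 'd \<Rightarrow> int ^ 'd \<Rightarrow> real) \<Rightarrow> int ^ 'd \<Rightarrow> real" where
  "hit_prob B y \<omega> x = (\<Sum>n. path_weight \<omega> (B - {y}) y n x)"

definition escape_prob ::
  "(int ^ 'd) set \<Rightarrow> int ^ 'd \<Rightarrow> (int ^ 'd \<Rightarrow> int ^ 'd \<Rightarrow> real) \<Rightarrow> real" where
  "escape_prob B y \<omega> = (\<Sum>e\<in>nbr. \<omega> y e * (1 - hit_prob B y \<omega> (y + e)))"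

lemma hit_prob_fun_upd [simp]: "hit_prob B y (fun_upd \<omega> y p) x = hit_prob B y \<omega> x"
  unfolding hit_prob_def using path_weight_cong[of "B - {y}" "fun_upd \<omega> y p" \<omega>] by simp

context
  fixes \<omega> :: "int ^ 'd \<Rightarrow> int ^ 'd \<Rightarrow> real"
  assumes range_\<omega>: "range \<omega> \<subseteq> probvecs"
begin

lemma site_probvecs: "\<omega> x \<in> probvecs"
  using range_\<omega> by auto

lemma sum_path_weight_Suc:
  "(\<Sum>n<N. path_weight \<omega> B y (Suc n) x) =
    (if x \<in> B then \<Sum>e\<in>nbr. \<omega> x e * (\<Sum>n<N. path_weight \<omega> B y n (x + e)) else 0)"
proof (cases "x \<in> B")
  case True
  hence "(\<Sum>n<N. path_weight \<omega> B y (Suc n) x) =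
      (\<Sum>n<N. \<Sum>e\<in>nbr. \<omega> x e * path_weight \<omega> B y n (x + e))"
    by simp
  also have "\<dots> = (\<Sum>e\<in>nbr. \<omega> x e * (\<Sum>n<N. path_weight \<omega> B y n (x + e)))"
    by (subst sum.swap) (simp add: sum_distrib_left)
  finally show ?thesis using True by simp
qed simp

lemma sum_first_hit_weight_le_1: "(\<Sum>n<N. path_weight \<omega> (B - {y}) y n x) \<le> 1"
proof (induction N arbitrary: x)
  case (Suc N)
  have "(\<Sum>e\<in>nbr. \<omega> x e * (\<Sum>n<N. path_weight \<omega> (B - {y}) y n (x + e))) \<le> (\<Sum>e\<in>nbr. \<omega> x e * 1)"
    using Suc probvecsD(1)[OF site_probvecs] by (intro sum_mono mult_left_mono) auto
  thus ?case
    unfolding sum.lessThan_Suc_shift sum_path_weight_Suc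
    using probvecsD(3)[OF site_probvecs, of x] by simp
qed simp

lemma summable_first_hit_weight: "summable (\<lambda>n. path_weight \<omega> (B - {y}) y n x)"
  using path_weight_nonneg[OF range_\<omega>] sum_first_hit_weight_le_1
  by (intro summableI_nonneg_bounded) auto

lemma hit_prob_nonneg: "0 \<le> hit_prob B y \<omega> x"
  unfolding hit_prob_def using path_weight_nonneg[OF range_\<omega>]
  by (intro suminf_nonneg summable_first_hit_weight)

lemma hit_prob_le_1: "hit_prob B y \<omega> x \<le> 1"
  unfolding hit_prob_def
  by (intro suminf_le_const summable_first_hit_weight) (rule sum_first_hit_weight_le_1)

lemma hit_prob_step:
  assumes "x \<noteq> y"
  shows "hit_prob B y \<omega> x = (if x \<in> B then \<Sum>e\<in>nbr. \<omega> x e * hit_prob B y \<omega> (x + e) else 0)"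
proof -
  have "hit_prob B y \<omega> x =
      path_weight \<omega> (B - {y}) y 0 x + (\<Sum>n. path_weight \<omega> (B - {y}) y (Suc n) x)"
    unfolding hit_prob_def
    using suminf_split_head[OF summable_first_hit_weight[of B y x]] by linarith
  also have "\<dots> = (if x \<in> B then \<Sum>e\<in>nbr. \<omega> x e * hit_prob B y \<omega> (x + e) else 0)"
    using assms summable_first_hit_weight
    by (simp add: hit_prob_def suminf_sum suminf_mult summable_mult)
  finally show ?thesis .
qed

lemma hit_prob_outside: "x \<notin> B \<Longrightarrow> x \<noteq> y \<Longrightarrow> hit_prob B y \<omega> x = 0"
  by (simp add: hit_prob_step)

lemma escape_prob_eq: "escape_prob B y \<omega> = 1 - (\<Sum>e\<in>nbr. \<omega> y e * hit_prob B y \<omega> (y + e))"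
  by (simp add: escape_prob_def algebra_simps sum_subtractf probvecsD(3)[OF site_probvecs])

lemma sum_path_weight_le:
  assumes "y \<in> B"
  shows "(\<Sum>n<N. path_weight \<omega> B y n x) \<le> hit_prob B y \<omega> x * (\<Sum>n<N. path_weight \<omega> B y n y)"
proof -
  let ?F = "\<lambda>j. path_weight \<omega> (B - {y}) y j x" and ?p = "\<lambda>n. path_weight \<omega> B y n y"
  note nonneg = path_weight_nonneg[OF range_\<omega>]
  have "(\<Sum>n<N. path_weight \<omega> B y n x) = (\<Sum>n<N. \<Sum>j\<le>n. ?F j * ?p (n - j))"
    by (intro sum.cong refl path_weight_first_hit assms)
  also have "\<dots> = (\<Sum>(j, n)\<in>{(j, n). j + n < N}. ?F j * ?p n)"
    by (rule sum.triangle_reindex[symmetric])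
  also have "\<dots> \<le> (\<Sum>(j, n)\<in>{..<N} \<times> {..<N}. ?F j * ?p n)"
    using nonneg by (intro sum_mono2) auto
  also have "\<dots> = (\<Sum>j<N. ?F j) * (\<Sum>n<N. ?p n)"
    by (simp add: sum.cartesian_product[symmetric] sum_product)
  also have "\<dots> \<le> hit_prob B y \<omega> x * (\<Sum>n<N. ?p n)"
    unfolding hit_prob_def
    by (intro mult_right_mono sum_le_suminf sum_nonneg)
      (auto simp: summable_first_hit_weight nonneg)
  finally show ?thesis .
qed

lemma sum_path_weight_self_le:
  assumes "y \<in> B" "0 < escape_prob B y \<omega>"
  shows "(\<Sum>n<N. path_weight \<omega> B y n y) \<le> 1 / escape_prob B y \<omega>"
proof -
  let ?U = "\<Sum>n<N. path_weight \<omega> B y n y"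
  have "?U \<le> (\<Sum>n<Suc N. path_weight \<omega> B y n y)"
    using path_weight_nonneg[OF range_\<omega>] by simp
  also have "\<dots> = 1 + (\<Sum>e\<in>nbr. \<omega> y e * (\<Sum>n<N. path_weight \<omega> B y n (y + e)))"
    unfolding sum.lessThan_Suc_shift sum_path_weight_Suc using assms(1) by simp
  also have "\<dots> \<le> 1 + (\<Sum>e\<in>nbr. \<omega> y e * (hit_prob B y \<omega> (y + e) * ?U))"
    using sum_path_weight_le[OF assms(1)] probvecsD(1)[OF site_probvecs]
    by (intro add_left_mono sum_mono mult_left_mono) auto
  also have "\<dots> = 1 + (1 - escape_prob B y \<omega>) * ?U"
    by (simp add: escape_prob_eq sum_distrib_right mult.assoc)
  finally show ?thesis using assms(2) by (simp add: field_simps)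
qed

lemma path_weight_sums:
  assumes y: "y \<in> B" and escape: "0 < escape_prob B y \<omega>"
  shows "(\<lambda>n. path_weight \<omega> B y n x) sums (hit_prob B y \<omega> x / escape_prob B y \<omega>)"
proof -
  let ?p = "path_weight \<omega> B y" and ?U = "\<Sum>n. path_weight \<omega> B y n y"
  note nonneg = path_weight_nonneg[OF range_\<omega>]
  have summable_self: "summable (\<lambda>n. ?p n y)"
    using nonneg sum_path_weight_self_le[OF assms] by (intro summableI_nonneg_bounded) auto
  have sums: "(\<lambda>n. ?p n x) sums (hit_prob B y \<omega> x * ?U)" for x
    using Cauchy_product_sums[of "\<lambda>n. path_weight \<omega> (B - {y}) y n x" "\<lambda>n. ?p n y"]
      summable_first_hit_weight[of B y x] summable_self nonneg
    by (simp add: hit_prob_def path_weight_first_hit[OF y, symmetric])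
  have summable: "summable (\<lambda>n. ?p n x)" for x using sums by (rule sums_summable)
  have "?U = 1 + (\<Sum>n. ?p (Suc n) y)"
    using suminf_split_head[OF summable_self] by simp
  also have "(\<Sum>n. ?p (Suc n) y) = (\<Sum>e\<in>nbr. \<omega> y e * (\<Sum>n. ?p n (y + e)))"
    using y by (simp add: suminf_sum suminf_mult summable summable_mult)
  also have "\<dots> = (1 - escape_prob B y \<omega>) * ?U"
    unfolding sums_unique[OF sums[of "y + _"], symmetric]
    by (simp add: escape_prob_eq sum_distrib_right mult.assoc)
  finally have "?U = 1 / escape_prob B y \<omega>" using escape by (simp add: field_simps)
  thus ?thesis using sums[of x] by simp
qed

lemma green_eq_hit_div_escape:
  assumes "y \<in> B" "0 < escape_prob B y \<omega>"
  shows "green B x y \<omega> = ennreal (hit_prob B y \<omega> x / escape_prob B y \<omega>)"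
  using path_weight_sums[OF assms, of x] path_weight_nonneg[OF range_\<omega>]
  by (simp add: green_eq_suminf suminf_ennreal2 sums_iff)

end

lemma elliptic_env_ge: "range \<omega> \<subseteq> elliptic_vecs \<kappa> \<Longrightarrow> e \<in> nbr \<Longrightarrow> \<kappa> \<le> \<omega> x e"
  by (rule elliptic_vecsD) auto

lemma escape_step:
  assumes \<omega>: "range \<omega> \<subseteq> elliptic_vecs \<kappa>" and e: "e \<in> nbr"
  shows "\<kappa> * (1 - hit_prob B y \<omega> (x + e)) \<le> (\<Sum>e\<in>nbr. \<omega> x e * (1 - hit_prob B y \<omega> (x + e)))"
proof -
  have pv: "range \<omega> \<subseteq> probvecs" using \<omega> elliptic_vecs_subset_probvecs by blast
  note nonneg = probvecsD(1)[OF site_probvecs[OF pv]]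
  have "\<kappa> * (1 - hit_prob B y \<omega> (x + e)) \<le> \<omega> x e * (1 - hit_prob B y \<omega> (x + e))"
    using hit_prob_le_1[OF pv] elliptic_env_ge[OF \<omega> e] by (intro mult_right_mono) auto
  also have "\<dots> \<le> (\<Sum>e\<in>nbr. \<omega> x e * (1 - hit_prob B y \<omega> (x + e)))"
    using e hit_prob_le_1[OF pv] nonneg by (intro member_le_sum) auto
  finally show ?thesis .
qed

lemma one_minus_hit_prob_ge:
  assumes \<omega>: "range \<omega> \<subseteq> elliptic_vecs \<kappa>" and "x \<noteq> y" "e \<in> nbr"
  shows "\<kappa> * (1 - hit_prob B y \<omega> (x + e)) \<le> 1 - hit_prob B y \<omega> x"
proof -
  have pv: "range \<omega> \<subseteq> probvecs" using \<omega> elliptic_vecs_subset_probvecs by blast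
  note nonneg = probvecsD(1)[OF site_probvecs[OF pv]]
  have "(\<Sum>e\<in>nbr. \<omega> x e * (1 - hit_prob B y \<omega> (x + e))) =
      1 - (\<Sum>e\<in>nbr. \<omega> x e * hit_prob B y \<omega> (x + e))"
    by (simp add: algebra_simps sum_subtractf probvecsD(3)[OF site_probvecs[OF pv]])
  also have "\<dots> \<le> 1 - hit_prob B y \<omega> x"
    using hit_prob_step[OF pv assms(2), of B] hit_prob_nonneg[OF pv] nonneg
    by (auto intro!: sum_nonneg)
  finally show ?thesis using escape_step[OF \<omega> assms(3), of B y x] by linarith
qed

text \<open>Walking from a site outside \<open>B\<close> towards \<open>y\<close>, each step costs at most a factor \<open>\<kappa>\<close>
  until \<open>y\<close> is met for the first time.\<close>
lemma escape_prob_uniform: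
  fixes y :: "int ^ 'd"
  assumes "y \<in> B" "B \<noteq> UNIV" "0 < \<kappa>"
  obtains n where "\<And>\<omega>. range \<omega> \<subseteq> elliptic_vecs \<kappa> \<Longrightarrow> \<kappa> ^ n \<le> escape_prob B y \<omega>"
proof -
  define ell where "ell \<omega> \<longleftrightarrow> range \<omega> \<subseteq> elliptic_vecs \<kappa>" for \<omega> :: "int ^ 'd \<Rightarrow> int ^ 'd \<Rightarrow> real"
  let ?goal = "\<exists>n. \<forall>\<omega>. ell \<omega> \<longrightarrow> \<kappa> ^ n \<le> escape_prob B y \<omega>"
  let ?miss = "\<lambda>x. x \<noteq> y \<and> (\<exists>n. \<forall>\<omega>. ell \<omega> \<longrightarrow> \<kappa> ^ n \<le> 1 - hit_prob B y \<omega> x)"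
  obtain z where z: "z \<notin> B" using assms by auto
  have "nn_connected (UNIV :: (int ^ 'd) set)" by (rule nn_connectedI) auto
  hence "(z, x) \<in> (nn_edges UNIV)\<^sup>*" for x unfolding nn_connected_def by blast
  hence "?goal \<or> ?miss x" for x
  proof (induction rule: rtrancl_induct)
    case base
    have "z \<noteq> y" using z assms(1) by auto
    moreover have "hit_prob B y \<omega> z = 0" if "ell \<omega>" for \<omega>
      using that z \<open>z \<noteq> y\<close> elliptic_vecs_subset_probvecs
      by (intro hit_prob_outside) (auto simp: ell_def)
    ultimately show ?case by (auto intro!: exI[of _ 0])
  next
    case (step a b)
    show ?case
    proof (cases ?goal)
      case False
      with step.IH obtain n where n: "\<And>\<omega>. ell \<omega> \<Longrightarrow> \<kappa> ^ n \<le> 1 - hit_prob B y \<omega> a" by blast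
      have ab: "a - b \<in> nbr" using step.hyps(2) uminus_in_nbr_iff[of "b - a"] by simp
      have pow: "\<kappa> ^ Suc n \<le> \<kappa> * (1 - hit_prob B y \<omega> (b + (a - b)))" if "ell \<omega>" for \<omega>
        using n[OF that] assms(3) by (simp add: mult_left_mono)
      have "b \<noteq> y"
      proof
        assume "b = y"
        hence "\<kappa> ^ Suc n \<le> escape_prob B y \<omega>" if "ell \<omega>" for \<omega>
          using pow[OF that] escape_step[of \<omega> \<kappa> "a - b" B y b] ab that
          by (simp add: escape_prob_def ell_def)
        thus False using False by blast
      qed
      moreover have "\<kappa> ^ Suc n \<le> 1 - hit_prob B y \<omega> b" if "ell \<omega>" for \<omega>
        using pow[OF that] one_minus_hit_prob_ge[of \<omega> \<kappa> b y "a - b" B] ab that \<open>b \<noteq> y\<close>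
        by (simp add: ell_def)
      ultimately show ?thesis by blast
    qed simp
  qed
  from this[of y] show ?thesis using that by (auto simp: ell_def)
qed

lemma path_weight_uniform:
  fixes x y :: "int ^ 'd"
  assumes "(x, y) \<in> (nn_edges B)\<^sup>*" "0 < \<kappa>"
  obtains n where "\<And>\<omega>. range \<omega> \<subseteq> elliptic_vecs \<kappa> \<Longrightarrow> \<kappa> ^ n \<le> path_weight \<omega> B y n x"
proof -
  from assms(1)
  have "\<exists>n. \<forall>\<omega>. range \<omega> \<subseteq> elliptic_vecs \<kappa> \<longrightarrow> \<kappa> ^ n \<le> path_weight \<omega> B y n x"
  proof (induction rule: converse_rtrancl_induct)
    case base
    show ?case by (rule exI[of _ 0]) simp
  next
    case (step a b)
    then obtain n where
      n: "\<And>\<omega>. range \<omega> \<subseteq> elliptic_vecs \<kappa> \<Longrightarrow> \<kappa> ^ n \<le> path_weight \<omega> B y n b" by auto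
    have e: "b - a \<in> nbr" and a: "a \<in> B" using step by auto
    have "\<kappa> ^ Suc n \<le> path_weight \<omega> B y (Suc n) a" if \<omega>: "range \<omega> \<subseteq> elliptic_vecs \<kappa>" for \<omega>
    proof -
      have pv: "range \<omega> \<subseteq> probvecs" using \<omega> elliptic_vecs_subset_probvecs by blast
  note nonneg = probvecsD(1)[OF site_probvecs[OF pv]]
      have "\<kappa> ^ Suc n \<le> \<omega> a (b - a) * path_weight \<omega> B y n (a + (b - a))"
        using n[OF \<omega>] elliptic_env_ge[OF \<omega> e] nonneg assms(2)
        by (simp add: mult_mono)
      also have "\<dots> \<le> path_weight \<omega> B y (Suc n) a"
        unfolding path_weight.simps if_P[OF a]
        by (rule member_le_sum[of "b - a" nbr "\<lambda>e. \<omega> a e * path_weight \<omega> B y n (a + e)"])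
          (use e nonneg path_weight_nonneg[OF pv] in auto)
      finally show ?thesis .
    qed
    thus ?case by blast
  qed
  thus ?thesis using that by blast
qed

section \<open>The i.i.d. environment and Kalikow's condition\<close>

context rwre
begin

lemma space_mu [simp]: "space \<mu> = UNIV"
  using sets_eq_imp_space_eq[OF sets_mu] by (simp add: space_PiM)

abbreviation env :: "(int ^ 'd \<Rightarrow> int ^ 'd \<Rightarrow> real) measure" where
  "env \<equiv> env_law \<mu>"

lemma prob_space_env: "prob_space env"
  unfolding env_law_def by (intro prob_space_PiM mu.prob_space_axioms)

sublocale env: prob_space env
  by (rule prob_space_env)

lemma space_env [simp]: "space env = UNIV"
  by (simp add: env_law_def space_PiM)

lemma measurable_site [measurable]: "(\<lambda>\<omega>. \<omega> x) \<in> measurable env \<mu>"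
  unfolding env_law_def by (rule measurable_component_singleton) simp

lemma measurable_site_step [measurable]: "(\<lambda>\<omega>. \<omega> x e) \<in> borel_measurable env"
  by (rule measurable_compose[OF measurable_site measurable_component_mu])

lemma AE_env_range:
  assumes "AE p in \<mu>. p \<in> S"
  shows "AE \<omega> in env. range \<omega> \<subseteq> S"
proof -
  have "AE \<omega> in env. \<forall>x. \<omega> x \<in> S"
    unfolding AE_all_countable env_law_def
    using AE_PiM_component[of UNIV "\<lambda>_. \<mu>" _ "\<lambda>p. p \<in> S"] assms mu.prob_space_axioms by auto
  thus ?thesis by eventually_elim auto
qed

lemmas AE_env_probvecs = AE_env_range[OF AE_probvecs]

lemma measurable_path_weight [measurable]: "(\<lambda>\<omega>. path_weight \<omega> B y n x) \<in> borel_measurable env"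
  by (induction n arbitrary: x) auto

lemma measurable_green [measurable]: "(\<lambda>\<omega>. green B x y \<omega>) \<in> borel_measurable env"
  unfolding green_eq_suminf by measurable

lemma measurable_fun_upd_env:
  assumes "f \<in> measurable N env" "h \<in> measurable N \<mu>"
  shows "(\<lambda>z. fun_upd (f z) y (h z)) \<in> measurable N env"
  using assms unfolding env_law_def by (intro measurable_fun_upd[where J = UNIV]) auto

lemma integral_env_resample:
  fixes f :: "_ \<Rightarrow> real"
  assumes "integrable env f"
  shows "(\<integral>\<omega>. f \<omega> \<partial>env) = (\<integral>\<omega>. \<integral>p. f (fun_upd \<omega> y p) \<partial>\<mu> \<partial>env)"
proof -
  interpret pair_prob_space \<mu> env by unfold_locales
  let ?upd = "\<lambda>(p, \<omega>). fun_upd \<omega> y p"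
  have upd: "?upd \<in> measurable (\<mu> \<Otimes>\<^sub>M env) env"
    unfolding case_prod_unfold by (rule measurable_fun_upd_env) auto
  have env_eq: "distr (\<mu> \<Otimes>\<^sub>M env) env ?upd = env"
    using distr_pair_PiM_eq_PiM[of UNIV "\<lambda>_. \<mu>" y] mu.prob_space_axioms by (simp add: env_law_def)
  have "integrable (\<mu> \<Otimes>\<^sub>M env) (\<lambda>z. f (?upd z))"
    using assms by (intro integrable_distr[OF upd]) (simp only: env_eq)
  hence "(\<integral>\<omega>. \<integral>p. f (?upd (p, \<omega>)) \<partial>\<mu> \<partial>env) = (\<integral>z. f (?upd z) \<partial>(\<mu> \<Otimes>\<^sub>M env))"
    by (subst integral_snd) (auto simp: case_prod_unfold)
  also have "\<dots> = (\<integral>\<omega>. f \<omega> \<partial>distr (\<mu> \<Otimes>\<^sub>M env) env ?upd)"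
    using assms by (intro integral_distr[OF upd, symmetric]) auto
  finally show ?thesis by (simp add: env_eq)
qed

definition mean_green :: "(int ^ 'd) set \<Rightarrow> int ^ 'd \<Rightarrow> int ^ 'd \<Rightarrow> real" where
  "mean_green B x y = (\<integral>\<omega>. enn2real (green B x y \<omega>) \<partial>env)"

definition mean_crossings :: "(int ^ 'd) set \<Rightarrow> int ^ 'd \<Rightarrow> int ^ 'd \<Rightarrow> int ^ 'd \<Rightarrow> real" where
  "mean_crossings B x y e = (\<integral>\<omega>. enn2real (green B x y \<omega>) * \<omega> y e \<partial>env)"

lemma mean_crossings_nonneg: "0 \<le> mean_crossings B x y e"
  unfolding mean_crossings_def using AE_env_probvecs
  by (intro integral_nonneg_AE) (auto elim!: eventually_mono simp: probvecsD(1) image_subset_iff)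

end

context elliptic_rwre
begin

lemmas AE_env_elliptic = AE_env_range[OF AE_elliptic]

context
  fixes B :: "(int ^ 'd) set" and y :: "int ^ 'd"
  assumes y: "y \<in> B" and B: "B \<noteq> UNIV"
begin

lemma escape_prob_pos:
  assumes "range \<omega> \<subseteq> elliptic_vecs \<kappa>"
  shows "0 < escape_prob B y \<omega>"
proof -
  obtain n where "\<kappa> ^ n \<le> escape_prob B y \<omega>"
    using escape_prob_uniform[OF y B kappa_pos] assms by metis
  thus ?thesis using zero_less_power[OF kappa_pos, of n] by linarith
qed

lemma green_eq:
  assumes "range \<omega> \<subseteq> elliptic_vecs \<kappa>"
  shows "green B x y \<omega> = ennreal (hit_prob B y \<omega> x / escape_prob B y \<omega>)"
  using assms elliptic_vecs_subset_probvecs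
  by (intro green_eq_hit_div_escape y escape_prob_pos) auto

lemma green_bounded:
  obtains K where "\<And>\<omega>. range \<omega> \<subseteq> elliptic_vecs \<kappa> \<Longrightarrow> green B x y \<omega> \<le> ennreal K"
proof -
  obtain n where n: "\<And>\<omega>. range \<omega> \<subseteq> elliptic_vecs \<kappa> \<Longrightarrow> \<kappa> ^ n \<le> escape_prob B y \<omega>"
    using escape_prob_uniform[OF y B kappa_pos] by metis
  have "green B x y \<omega> \<le> ennreal (1 / \<kappa> ^ n)" if \<omega>: "range \<omega> \<subseteq> elliptic_vecs \<kappa>" for \<omega>
    unfolding green_eq[OF \<omega>]
    using n[OF \<omega>] kappa_pos hit_prob_le_1[of \<omega> B y x] \<omega> elliptic_vecs_subset_probvecs
    by (intro ennreal_leI frac_le) auto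
  thus ?thesis using that by blast
qed

lemma AE_green_finite: "AE \<omega> in env. green B x y \<omega> = ennreal (enn2real (green B x y \<omega>))"
  using AE_env_elliptic by eventually_elim (simp add: green_eq)

lemma integrable_green_mult:
  assumes h: "h \<in> borel_measurable env" "AE \<omega> in env. \<bar>h \<omega>\<bar> \<le> C"
  shows "integrable env (\<lambda>\<omega>. enn2real (green B x y \<omega>) * h \<omega>)"
proof -
  obtain K where K: "\<And>\<omega>. range \<omega> \<subseteq> elliptic_vecs \<kappa> \<Longrightarrow> green B x y \<omega> \<le> ennreal K"
    using green_bounded by metis
  show ?thesis
  proof (rule env.integrable_const_bound)
    show "AE \<omega> in env. norm (enn2real (green B x y \<omega>) * h \<omega>) \<le> enn2real (ennreal K) * C"
      using AE_env_elliptic h(2)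
    proof eventually_elim
      case (elim \<omega>)
      have "enn2real (green B x y \<omega>) \<le> enn2real (ennreal K)"
        by (rule enn2real_mono[OF K[OF elim(1)]]) simp
      thus ?case using elim(2) by (auto simp: abs_mult intro!: mult_mono)
    qed
  qed (use h in measurable)
qed

lemma integrable_green: "integrable env (\<lambda>\<omega>. enn2real (green B x y \<omega>))"
  using integrable_green_mult[of "\<lambda>_. 1" 1] by simp

lemma integrable_green_mult_step: "integrable env (\<lambda>\<omega>. enn2real (green B x y \<omega>) * \<omega> z e)"
  by (rule integrable_green_mult[of _ 1])
    (use AE_env_probvecs in
      \<open>auto elim!: eventually_mono simp: probvecsD(1) probvecs_le_1 image_subset_iff\<close>)

lemma nn_integral_green: "(\<integral>\<^sup>+\<omega>. green B x y \<omega> \<partial>env) = ennreal (mean_green B x y)"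
proof -
  have "(\<integral>\<^sup>+\<omega>. green B x y \<omega> \<partial>env) = (\<integral>\<^sup>+\<omega>. ennreal (enn2real (green B x y \<omega>)) \<partial>env)"
    by (intro nn_integral_cong_AE AE_green_finite)
  also have "\<dots> = ennreal (mean_green B x y)"
    unfolding mean_green_def by (intro nn_integral_eq_integral integrable_green) simp
  finally show ?thesis .
qed

lemma nn_integral_crossings:
  "(\<integral>\<^sup>+\<omega>. green B x y \<omega> * ennreal (\<omega> y e) \<partial>env) = ennreal (mean_crossings B x y e)"
proof -
  have "(\<integral>\<^sup>+\<omega>. green B x y \<omega> * ennreal (\<omega> y e) \<partial>env) =
      (\<integral>\<^sup>+\<omega>. ennreal (enn2real (green B x y \<omega>) * \<omega> y e) \<partial>env)"
    using AE_green_finite[of x]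
    by (intro nn_integral_cong_AE) (auto elim!: eventually_mono simp: ennreal_mult')
  also have "\<dots> = ennreal (mean_crossings B x y e)"
    unfolding mean_crossings_def using AE_env_probvecs
    by (intro nn_integral_eq_integral integrable_green_mult_step)
      (auto elim!: eventually_mono simp: probvecsD(1) image_subset_iff)
  finally show ?thesis .
qed

lemma sum_mean_crossings: "(\<Sum>e\<in>nbr. mean_crossings B x y e) = mean_green B x y"
proof -
  have "(\<Sum>e\<in>nbr. mean_crossings B x y e) =
      (\<integral>\<omega>. (\<Sum>e\<in>nbr. enn2real (green B x y \<omega>) * \<omega> y e) \<partial>env)"
    unfolding mean_crossings_def
    by (intro Bochner_Integration.integral_sum[symmetric] integrable_green_mult_step)
  also have "\<dots> = mean_green B x y"
    unfolding mean_green_def using AE_env_probvecs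
    by (intro integral_cong_AE)
      (auto elim!: eventually_mono simp: probvecsD(3) image_subset_iff sum_distrib_left[symmetric])
  finally show ?thesis .
qed

lemma mean_crossings_le: "e \<in> nbr \<Longrightarrow> mean_crossings B x y e \<le> mean_green B x y"
  unfolding sum_mean_crossings[symmetric]
  by (intro member_le_sum) (auto simp: mean_crossings_nonneg)

lemma kalikow_drift_axis:
  "kalikow_drift env B x y \<bullet> axis i 1 =
    (mean_crossings B x y (axis i 1) - mean_crossings B x y (- axis i 1)) / mean_green B x y"
proof -
  have "kalikow_env env B x y e = mean_crossings B x y e / mean_green B x y" if "e \<in> nbr" for e
  proof (cases "mean_green B x y = 0")
    case True
    thus ?thesis
      using mean_crossings_le[OF that, of x] mean_crossings_nonneg[of B x y e]
      unfolding kalikow_env_def nn_integral_green nn_integral_crossings by simp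
  next
    case False
    moreover have "0 \<le> mean_green B x y" unfolding mean_green_def by simp
    ultimately show ?thesis
      unfolding kalikow_env_def nn_integral_green nn_integral_crossings
      by (simp add: divide_ennreal mean_crossings_nonneg)
  qed
  hence "kalikow_drift env B x y \<bullet> axis i 1 =
      (\<Sum>e\<in>nbr. mean_crossings B x y e / mean_green B x y * of_int (e $ i))"
    by (simp add: kalikow_drift_def inner_axis)
  also have "\<dots> =
      (mean_crossings B x y (axis i 1) - mean_crossings B x y (- axis i 1)) / mean_green B x y"
    by (simp only: sum_nbr_component diff_divide_distrib)
  finally show ?thesis .
qed

lemma kalikow_drift_ge_minus_1: "- 1 \<le> kalikow_drift env B x y \<bullet> axis i 1"
proof -
  have "- mean_green B x y \<le> mean_crossings B x y (axis i 1) - mean_crossings B x y (- axis i 1)"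
    using mean_crossings_le[of "- axis i 1" x] mean_crossings_nonneg[of B x y "axis i 1"] by simp
  moreover have "0 \<le> mean_green B x y" unfolding mean_green_def by simp
  ultimately show ?thesis unfolding kalikow_drift_axis
    by (cases "mean_green B x y = 0") (auto simp: field_simps)
qed

lemma enn2real_green_fun_upd:
  assumes \<omega>: "range \<omega> \<subseteq> elliptic_vecs \<kappa>" and p: "p \<in> elliptic_vecs \<kappa>"
  shows "enn2real (green B x y (fun_upd \<omega> y p)) =
    hit_prob B y \<omega> x / (\<Sum>e\<in>nbr. p e * (1 - hit_prob B y \<omega> (y + e)))"
proof -
  have upd: "range (fun_upd \<omega> y p) \<subseteq> elliptic_vecs \<kappa>" using \<omega> p by auto
  have "0 \<le> hit_prob B y \<omega> x"
    using \<omega> elliptic_vecs_subset_probvecs by (intro hit_prob_nonneg) blast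
  thus ?thesis
    unfolding green_eq[OF upd] using escape_prob_pos[OF upd]
    by (simp add: escape_prob_def)
qed

lemma frozen_drift_nonneg:
  assumes \<omega>: "range \<omega> \<subseteq> elliptic_vecs \<kappa>"
  shows "0 \<le> (\<integral>p. enn2real (green B x y (fun_upd \<omega> y p)) *
    (p (axis i 1) - p (- axis i 1) - drift_bound i) \<partial>\<mu>)"
proof -
  let ?gain = "\<lambda>p. p (axis i 1) - p (- axis i 1) - drift_bound i"
  define q where "q e = 1 - hit_prob B y \<omega> (y + e)" for e
  have pv: "range \<omega> \<subseteq> probvecs" using \<omega> elliptic_vecs_subset_probvecs by blast
  have q_nonneg: "0 \<le> q e" for e using hit_prob_le_1[OF pv] by (simp add: q_def)
  have "0 < escape_prob B y \<omega>" by (rule escape_prob_pos[OF \<omega>])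
  also have "\<dots> \<le> (\<Sum>e\<in>nbr. 1 * q e)"
    unfolding escape_prob_def q_def[symmetric]
    by (intro sum_mono mult_right_mono probvecs_le_1 site_probvecs[OF pv] q_nonneg)
  finally have q_pos: "0 < (\<Sum>e\<in>nbr. q e)" by simp
  have [measurable]: "(\<lambda>p. green B x y (fun_upd \<omega> y p)) \<in> borel_measurable \<mu>"
    by (rule measurable_compose[OF measurable_fun_upd_env measurable_green]) auto
  have "(\<integral>p. enn2real (green B x y (fun_upd \<omega> y p)) * ?gain p \<partial>\<mu>)
    = (\<integral>p. hit_prob B y \<omega> x * (?gain p / (\<Sum>e\<in>nbr. p e * q e)) \<partial>\<mu>)"
    using AE_elliptic
    by (intro integral_cong_AE)
      (auto elim!: eventually_mono simp: enn2real_green_fun_upd[OF \<omega>] q_def)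
  also have "\<dots> = hit_prob B y \<omega> x * (\<integral>p. ?gain p / (\<Sum>e\<in>nbr. p e * q e) \<partial>\<mu>)"
    by (rule integral_mult_right_zero)
  also have "0 \<le> \<dots>"
    by (intro mult_nonneg_nonneg hit_prob_nonneg[OF pv] single_site_estimate q_nonneg q_pos)
  finally show ?thesis .
qed

lemma drift_bound_mean_green_le:
  "drift_bound i * mean_green B x y \<le>
    mean_crossings B x y (axis i 1) - mean_crossings B x y (- axis i 1)"
proof -
  let ?g = "\<lambda>\<omega>. enn2real (green B x y \<omega>)" and ?a = "axis i 1 :: int ^ 'd"
  have int: "integrable env (\<lambda>\<omega>. ?g \<omega> * \<omega> y ?a - ?g \<omega> * \<omega> y (- ?a) - ?g \<omega> * drift_bound i)"
    by (intro Bochner_Integration.integrable_diff integrable_green_mult_step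
        integrable_mult_left integrable_green)
  have "0 \<le> (\<integral>\<omega>. \<integral>p. ?g (fun_upd \<omega> y p) * (p ?a - p (- ?a) - drift_bound i) \<partial>\<mu> \<partial>env)"
    using AE_env_elliptic
    by (intro integral_nonneg_AE) (auto elim!: eventually_mono intro: frozen_drift_nonneg)
  also have "\<dots> = (\<integral>\<omega>. ?g \<omega> * \<omega> y ?a - ?g \<omega> * \<omega> y (- ?a) - ?g \<omega> * drift_bound i \<partial>env)"
    by (subst integral_env_resample[OF int, of y]) (simp add: algebra_simps)
  also have "\<dots> = mean_crossings B x y ?a - mean_crossings B x y (- ?a) - drift_bound i * mean_green B x y"
    unfolding mean_crossings_def mean_green_def
    by (simp add: integrable_green_mult_step integrable_green)
  finally show ?thesis by simp
qed

lemma mean_green_pos: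
  assumes "nn_connected B" "x \<in> B"
  shows "0 < mean_green B x y"
proof -
  have "(x, y) \<in> (nn_edges B)\<^sup>*" using assms y by (auto simp: nn_connected_def)
  then obtain n where n: "\<And>\<omega>. range \<omega> \<subseteq> elliptic_vecs \<kappa> \<Longrightarrow> \<kappa> ^ n \<le> path_weight \<omega> B y n x"
    by (rule path_weight_uniform[OF _ kappa_pos]) blast
  have "ennreal (\<kappa> ^ n) = (\<integral>\<^sup>+\<omega>. ennreal (\<kappa> ^ n) \<partial>env)" 
    using env.emeasure_space_1 by simp
  also have "\<dots> \<le> (\<integral>\<^sup>+\<omega>. green B x y \<omega> \<partial>env)"
  proof (intro nn_integral_mono_AE)
    show "AE \<omega> in env. ennreal (\<kappa> ^ n) \<le> green B x y \<omega>"
      using AE_env_elliptic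
    proof eventually_elim
      case (elim \<omega>)
      have "ennreal (\<kappa> ^ n) \<le> (\<Sum>n\<in>{n}. ennreal (path_weight \<omega> B y n x))"
        using n[OF elim] by (simp add: ennreal_leI)
      also have "\<dots> \<le> green B x y \<omega>" unfolding green_eq_suminf by (rule sum_le_suminf) auto
      finally show ?case .
    qed
  qed
  finally show ?thesis
    unfolding nn_integral_green using zero_less_power[OF kappa_pos, of n]
    by (simp add: ennreal_le_iff2)
qed

lemma drift_bound_le_kalikow_drift:
  assumes "nn_connected B" "x \<in> B"
  shows "drift_bound i \<le> kalikow_drift env B x y \<bullet> axis i 1"
  unfolding kalikow_drift_axis
  using drift_bound_mean_green_le[of i x] mean_green_pos[OF assms] by (simp add: field_simps)

end

lemma kalikow_condition_of_drift_bound_pos: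
  assumes "0 < drift_bound i"
  shows "kalikow_condition env (axis i 1)"
proof -
  have "nn_connected {0 :: int ^ 'd}" by (simp add: nn_connected_def)
  moreover have "{0 :: int ^ 'd} \<noteq> UNIV"
    using axis_eq_0_iff[of i "1::int"] by (metis UNIV_I singletonD zero_neq_one)
  ultimately have "drift_bound i \<le> kalikow_const env (axis i 1)"
    unfolding kalikow_const_def
    by (intro cInf_greatest) (auto intro: drift_bound_le_kalikow_drift)
  thus ?thesis using assms by (simp add: kalikow_condition_def)
qed

lemma kalikow_const_mean_green_le:
  assumes "nn_connected B" "B \<noteq> UNIV" "0 \<in> B" "y \<in> B"
  shows "kalikow_const env (axis i 1) * mean_green B 0 y \<le>
    mean_crossings B 0 y (axis i 1) - mean_crossings B 0 y (- axis i 1)"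
proof -
  have "kalikow_const env (axis i 1) \<le> kalikow_drift env B 0 y \<bullet> axis i 1"
    unfolding kalikow_const_def
  proof (rule cInf_lower)
    show "bdd_below {kalikow_drift env B 0 y \<bullet> axis i 1 | B y.
        nn_connected B \<and> B \<noteq> UNIV \<and> 0 \<in> B \<and> y \<in> B}"
      by (rule bdd_belowI[of _ "- 1"]) (auto intro: kalikow_drift_ge_minus_1)
  qed (use assms in blast)
  thus ?thesis
    using mean_green_pos[OF assms(4,2,1,3)]
    unfolding kalikow_drift_axis[OF assms(4,2)] by (simp add: field_simps)
qed

end

section \<open>Path space\<close>

definition nn_path :: "(nat \<Rightarrow> int ^ 'd) \<Rightarrow> bool" where
  "nn_path X \<longleftrightarrow> X 0 = 0 \<and> (\<forall>k. X (Suc k) - X k \<in> nbr)"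

lemma nn_path_component_Suc_le: "nn_path X \<Longrightarrow> X (Suc n) $ i \<le> X n $ i + 1"
  using abs_nbr_component_le[of "X (Suc n) - X n" i] by (simp add: nn_path_def abs_le_iff)

lemma nn_path_abs_component_le: "nn_path X \<Longrightarrow> \<bar>X n $ i\<bar> \<le> int n"
proof (induction n)
  case (Suc n)
  have "\<bar>(X (Suc n) - X n) $ i\<bar> \<le> 1"
    using Suc.prems by (intro abs_nbr_component_le) (simp add: nn_path_def)
  thus ?case using Suc by simp
qed (simp add: nn_path_def)

lemma nn_path_in_cube: "nn_path X \<Longrightarrow> k \<le> N \<Longrightarrow> X k \<in> cube (int N)"
  by (auto simp: cube_def intro: order.trans[OF nn_path_abs_component_le])

definition cyl :: "nat \<Rightarrow> (nat \<Rightarrow> 'a) \<Rightarrow> (nat \<Rightarrow> 'a) set" where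
  "cyl n zs = {X. \<forall>k\<le>n. X k = zs k}"

lemma cyl_fun_upd: "cyl (Suc n) (fun_upd zs (Suc n) x) = {X \<in> cyl n zs. X (Suc n) = x}"
  by (auto simp: cyl_def le_Suc_eq)

definition prefix_of :: "(nat \<Rightarrow> 'a) \<Rightarrow> nat \<Rightarrow> 'a list" where
  "prefix_of X n = map X [0..<Suc n]"

lemma length_prefix_of [simp]: "length (prefix_of X n) = Suc n"
  by (simp add: prefix_of_def)

lemma nth_prefix_of [simp]: "k \<le> n \<Longrightarrow> prefix_of X n ! k = X k"
  unfolding prefix_of_def by (subst nth_map) (auto simp del: upt_Suc)

lemma prefix_of_eq_iff: "prefix_of X n = w \<longleftrightarrow> length w = Suc n \<and> X \<in> cyl n (nth w)"
  by (auto simp: list_eq_iff_nth_eq cyl_def less_Suc_eq_le)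

lemma space_path_space [simp]: "space path_space = UNIV"
  by (simp add: path_space_def space_PiM)

lemma measurable_path_component [measurable]: "(\<lambda>X. X n) \<in> measurable path_space (count_space UNIV)"
  unfolding path_space_def by measurable

lemma cyl_in_sets [measurable]: "cyl n (zs :: nat \<Rightarrow> int ^ 'd) \<in> sets path_space"
proof -
  have "{X \<in> space path_space. \<forall>k\<in>{..n}. X k = zs k} \<in> sets path_space" by measurable
  thus ?thesis by (simp add: cyl_def Ball_def)
qed

lemma measurable_prefix_of [measurable]:
  "(\<lambda>X :: nat \<Rightarrow> int ^ 'd. prefix_of X n) \<in> measurable path_space (count_space UNIV)"
proof (subst measurable_count_space_eq_countable)
  have "(\<lambda>X. prefix_of X n) -` {w} = (if length w = Suc n then cyl n (nth w) else {})"
    for w :: "(int ^ 'd) list"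
    by (simp add: vimage_def prefix_of_eq_iff)
  thus "(\<lambda>X :: nat \<Rightarrow> int ^ 'd. prefix_of X n) \<in> space path_space \<rightarrow> UNIV \<and>
    (\<forall>w\<in>UNIV. (\<lambda>X :: nat \<Rightarrow> int ^ 'd. prefix_of X n) -` {w} \<inter> space path_space \<in> sets path_space)"
    by simp
qed simp

definition cyls :: "(nat \<Rightarrow> int ^ 'd) set set" where
  "cyls = insert {} {cyl n zs | n zs. True}"

lemma cyls_cases:
  assumes "A \<in> cyls"
  obtains "A = {}" | n zs where "A = cyl n zs"
  using assms by (auto simp: cyls_def)

lemma cyl_in_cyls: "cyl n zs \<in> cyls"
  by (auto simp: cyls_def)

lemma cyl_Int_cyl:
  assumes "n \<le> m"
  shows "cyl n zs \<inter> cyl m vs = (if vs \<in> cyl n zs then cyl m vs else {})"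
  using assms by (force simp: cyl_def)

lemma Int_stable_cyls: "Int_stable cyls"
proof (rule Int_stableI)
  fix a b :: "(nat \<Rightarrow> int ^ 'd) set" assume "a \<in> cyls" "b \<in> cyls"
  moreover have "cyl n zs \<inter> cyl m vs \<in> cyls" for n m and zs vs :: "nat \<Rightarrow> int ^ 'd"
    using cyl_Int_cyl[of n m zs vs] cyl_Int_cyl[of m n vs zs]
    by (cases "n \<le> m") (auto simp: cyls_def Int_commute)
  ultimately show "a \<inter> b \<in> cyls" by (elim cyls_cases) (auto simp: cyls_def)
qed

lemma sets_path_space_eq: "sets (path_space :: (nat \<Rightarrow> int ^ 'd) measure) = sigma_sets UNIV cyls"
proof -
  have "sets (path_space :: (nat \<Rightarrow> int ^ 'd) measure) = sigma_sets UNIV {{X. X n \<in> A} | n A. True}"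
    by (simp add: path_space_def sets_PiM_single)
  also have "\<dots> = sigma_sets UNIV cyls"
  proof (rule sigma_sets_eqI)
    fix E :: "(nat \<Rightarrow> int ^ 'd) set" assume "E \<in> {{X. X n \<in> A} | n A. True}"
    then obtain n A where "E = {X. X n \<in> A}" by blast
    hence "E = (\<Union>w\<in>{w. length w = Suc n \<and> w ! n \<in> A}. cyl n (nth w))"
      by (auto simp: cyl_def intro!: exI[of _ "prefix_of _ n"])
    moreover have "\<dots> \<in> sigma_sets UNIV cyls"
      by (intro sigma_sets_UNION) (auto intro: sigma_sets.Basic cyl_in_cyls)
    ultimately show "E \<in> sigma_sets UNIV cyls" by simp
  next
    fix E :: "(nat \<Rightarrow> int ^ 'd) set" assume "E \<in> cyls"
    hence "E \<in> sets path_space" by (elim cyls_cases) auto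
    thus "E \<in> sigma_sets UNIV {{X. X n \<in> A} | n A. True}"
      by (simp add: path_space_def sets_PiM_single)
  qed
  finally show ?thesis .
qed

section \<open>The annealed walk\<close>

definition traj_weight :: "(int ^ 'd \<Rightarrow> int ^ 'd \<Rightarrow> real) \<Rightarrow> (nat \<Rightarrow> int ^ 'd) \<Rightarrow> nat \<Rightarrow> real" where
  "traj_weight \<omega> zs n = (\<Prod>k<n. \<omega> (zs k) (zs (Suc k) - zs k))"

lemma traj_weight_fun_upd:
  "traj_weight \<omega> (fun_upd zs (Suc n) x) (Suc n) = traj_weight \<omega> zs n * \<omega> (zs n) (x - zs n)"
  by (simp add: traj_weight_def)

lemma traj_weight_nonneg: "range \<omega> \<subseteq> probvecs \<Longrightarrow> 0 \<le> traj_weight \<omega> zs n"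
  unfolding traj_weight_def by (intro prod_nonneg) (auto simp: probvecsD(1) site_probvecs)

lemma traj_weight_le_1: "range \<omega> \<subseteq> probvecs \<Longrightarrow> traj_weight \<omega> zs n \<le> 1"
  unfolding traj_weight_def
  by (intro prod_le_1) (auto simp: probvecsD(1) probvecs_le_1 site_probvecs)

context rwre
begin

definition annealed_weight :: "(nat \<Rightarrow> int ^ 'd) \<Rightarrow> nat \<Rightarrow> real" where
  "annealed_weight zs n = (\<integral>\<omega>. traj_weight \<omega> zs n \<partial>env)"

lemma measurable_traj_weight_PiM:
  assumes "\<And>k. k < n \<Longrightarrow> zs k \<in> J"
  shows "(\<lambda>\<omega>. traj_weight \<omega> zs n) \<in> borel_measurable (\<Pi>\<^sub>M x\<in>J. \<mu>)"
  unfolding traj_weight_def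
proof (intro borel_measurable_prod)
  fix k assume "k \<in> {..<n}"
  hence "(\<lambda>\<omega>. \<omega> (zs k)) \<in> measurable (\<Pi>\<^sub>M x\<in>J. \<mu>) \<mu>"
    using assms by (intro measurable_component_singleton) simp
  thus "(\<lambda>\<omega>. \<omega> (zs k) (zs (Suc k) - zs k)) \<in> borel_measurable (\<Pi>\<^sub>M x\<in>J. \<mu>)"
    by (rule measurable_compose) (rule measurable_component_mu)
qed

lemma measurable_traj_weight [measurable]: "(\<lambda>\<omega>. traj_weight \<omega> zs n) \<in> borel_measurable env"
  unfolding env_law_def by (rule measurable_traj_weight_PiM) simp

lemma integrable_traj_weight [simp]: "integrable env (\<lambda>\<omega>. traj_weight \<omega> zs n)"
  using AE_env_probvecs
  by (intro env.integrable_const_bound[of _ 1])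
    (auto elim!: eventually_mono simp: traj_weight_nonneg traj_weight_le_1)

lemma annealed_weight_nonneg: "0 \<le> annealed_weight zs n"
  unfolding annealed_weight_def using AE_env_probvecs
  by (intro integral_nonneg_AE) (auto elim!: eventually_mono intro: traj_weight_nonneg)

lemma nn_integral_traj_weight:
  "(\<integral>\<^sup>+\<omega>. ennreal (traj_weight \<omega> zs n) \<partial>env) = ennreal (annealed_weight zs n)"
  unfolding annealed_weight_def using AE_env_probvecs
  by (intro nn_integral_eq_integral) (auto elim!: eventually_mono intro: traj_weight_nonneg)

lemma annealed_weight_translate: "annealed_weight (\<lambda>k. a + zs k) n = annealed_weight zs n"
proof -
  let ?shift = "\<lambda>\<omega> x. \<omega> (a + x)"
  have meas: "?shift \<in> measurable env env" unfolding env_law_def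
    by (rule measurable_PiM_single') (auto simp: space_PiM)
  have env_eq: "distr env env ?shift = env"
    using distr_PiM_reindex[of UNIV "\<lambda>_. \<mu>" "\<lambda>x. a + x" UNIV] mu.prob_space_axioms
    by (simp add: env_law_def restrict_def)
  have "annealed_weight (\<lambda>k. a + zs k) n = (\<integral>\<omega>. traj_weight (?shift \<omega>) zs n \<partial>env)"
    by (simp add: annealed_weight_def traj_weight_def)
  also have "\<dots> = (\<integral>\<omega>. traj_weight \<omega> zs n \<partial>distr env env ?shift)"
    by (rule integral_distr[OF meas, symmetric]) simp
  finally show ?thesis by (simp add: env_eq annealed_weight_def)
qed

lemma indep_vars_env: "env.indep_vars (\<lambda>_. \<mu>) (\<lambda>x \<omega>. \<omega> x) UNIV"
proof -
  have "distr env (\<Pi>\<^sub>M x\<in>UNIV. \<mu>) (\<lambda>\<omega>. \<lambda>x\<in>UNIV. \<omega> x) = distr env env (\<lambda>\<omega>. \<omega>)"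
    by (simp add: env_law_def restrict_def)
  also have "\<dots> = (\<Pi>\<^sub>M x\<in>UNIV. distr env \<mu> (\<lambda>\<omega>. \<omega> x))"
    unfolding env_law_def by (subst distr_PiM_component) (auto intro: mu.prob_space_axioms)
  finally show ?thesis by (subst env.indep_vars_iff_distr_eq_PiM) auto
qed

lemma integral_traj_weight_mult_disjoint:
  assumes "\<And>j k. j < n \<Longrightarrow> k < m \<Longrightarrow> zs j \<noteq> vs k"
  shows "(\<integral>\<omega>. traj_weight \<omega> zs n * traj_weight \<omega> vs m \<partial>env) =
    annealed_weight zs n * annealed_weight vs m"
proof -
  let ?J = "zs ` {..<n}" and ?K = "vs ` {..<m}"
  have "?J \<inter> ?K = {}" using assms by auto
  from env.indep_var_restrict[OF indep_vars_env this subset_UNIV subset_UNIV]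
  have "env.indep_var (\<Pi>\<^sub>M x\<in>?J. \<mu>) (\<lambda>\<omega>. restrict \<omega> ?J) (\<Pi>\<^sub>M x\<in>?K. \<mu>) (\<lambda>\<omega>. restrict \<omega> ?K)" .
  from env.indep_var_compose[OF this measurable_traj_weight_PiM[of n zs]
      measurable_traj_weight_PiM[of m vs]]
  have "env.indep_var borel (\<lambda>\<omega>. traj_weight (restrict \<omega> ?J) zs n)
      borel (\<lambda>\<omega>. traj_weight (restrict \<omega> ?K) vs m)"
    by (simp add: comp_def)
  moreover have "traj_weight (restrict \<omega> ?J) zs n = traj_weight \<omega> zs n"
    "traj_weight (restrict \<omega> ?K) vs m = traj_weight \<omega> vs m" for \<omega>
    unfolding traj_weight_def by (auto intro!: prod.cong)
  ultimately have "env.indep_var borel (\<lambda>\<omega>. traj_weight \<omega> zs n) borel (\<lambda>\<omega>. traj_weight \<omega> vs m)"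
    by simp
  from env.indep_var_lebesgue_integral[OF this integrable_traj_weight integrable_traj_weight]
  show ?thesis unfolding annealed_weight_def .
qed

end

locale annealed_walk = rwre \<mu> + prob_space P
  for \<mu> :: "(int ^ 'd \<Rightarrow> real) measure" and P :: "(nat \<Rightarrow> int ^ 'd) measure" +
  assumes sets_P [measurable_cong]: "sets P = sets path_space"
    and prob_cyl: "prob (cyl n zs) = (if zs 0 = 0 then annealed_weight zs n else 0)"
begin

lemma space_P [simp]: "space P = UNIV"
  using sets_eq_imp_space_eq[OF sets_P] by simp

lemma prob_UNIV [simp]: "prob UNIV = 1"
  using prob_space by simp

lemma events_Collect [measurable (raw)]: "Measurable.pred P Q \<Longrightarrow> {X. Q X} \<in> events"
  by (simp add: pred_def)

lemma pred_at_time: "Measurable.pred P (\<lambda>X. Q (X n))"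
  by (rule measurable_compose[of _ _ "count_space UNIV"]) measurable

lemma pred_level [measurable]:
  "Measurable.pred P (\<lambda>X. X n $ i < c)" "Measurable.pred P (\<lambda>X. c \<le> X n $ i)"
  "Measurable.pred P (\<lambda>X. X n \<in> B)"
  by (rule pred_at_time)+

lemma emeasure_cyl:
  "zs 0 = 0 \<Longrightarrow> emeasure P (cyl n zs) = (\<integral>\<^sup>+\<omega>. ennreal (traj_weight \<omega> zs n) \<partial>env)"
  by (simp add: emeasure_eq_measure prob_cyl nn_integral_traj_weight)

lemma AE_nn_path: "AE X in P. nn_path X"
proof -
  have null: "AE X in P. prefix_of X (Suc n) \<noteq> w"
    if w: "w ! 0 \<noteq> 0 \<or> w ! Suc n - w ! n \<notin> nbr" for n and w :: "(int ^ 'd) list"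
  proof -
    have "annealed_weight (nth w) (Suc n) = (\<integral>\<omega>. 0 \<partial>env)" if "w ! Suc n - w ! n \<notin> nbr"
      unfolding annealed_weight_def using AE_env_probvecs that
      by (intro integral_cong_AE)
        (auto elim!: eventually_mono simp: traj_weight_def probvecsD(2) site_probvecs)
    hence "prob (cyl (Suc n) (nth w)) = 0" using w by (auto simp: prob_cyl)
    hence "AE X in P. X \<notin> cyl (Suc n) (nth w)"
      by (intro AE_not_in) (auto simp: null_sets_def emeasure_eq_measure sets_P)
    thus ?thesis by eventually_elim (simp add: prefix_of_eq_iff)
  qed
  have "AE X in P. \<forall>n w. w ! 0 \<noteq> 0 \<or> w ! Suc n - w ! n \<notin> nbr \<longrightarrow> prefix_of X (Suc n) \<noteq> w"
    unfolding AE_all_countable using null by auto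
  thus ?thesis
  proof eventually_elim
    case (elim X)
    have "prefix_of X (Suc n) ! 0 = 0 \<and>
        prefix_of X (Suc n) ! Suc n - prefix_of X (Suc n) ! n \<in> nbr" for n
      using elim by blast
    thus ?case by (simp add: nn_path_def)
  qed
qed

lemma emeasure_cyl_step:
  assumes A [measurable]: "A \<in> events"
  shows "emeasure P (cyl m zs \<inter> A) =
    (\<Sum>e\<in>nbr. emeasure P (cyl (Suc m) (fun_upd zs (Suc m) (zs m + e)) \<inter> A))"
proof -
  let ?C = "\<lambda>e. cyl (Suc m) (fun_upd zs (Suc m) (zs m + e)) \<inter> A"
  have "AE X in P. X \<in> cyl m zs \<inter> A \<longleftrightarrow> X \<in> (\<Union>e\<in>nbr. ?C e)"
    using AE_nn_path
  proof eventually_elim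
    case (elim X)
    hence "X (Suc m) - X m \<in> nbr" by (simp add: nn_path_def)
    moreover have "X \<in> cyl m zs \<Longrightarrow> zs m = X m" by (simp add: cyl_def)
    ultimately show ?case by (auto simp: cyl_fun_upd intro!: bexI[of _ "X (Suc m) - X m"])
  qed
  hence "emeasure P (cyl m zs \<inter> A) = emeasure P (\<Union>e\<in>nbr. ?C e)"
    by (intro emeasure_eq_AE) auto
  also have "\<dots> = (\<Sum>e\<in>nbr. emeasure P (?C e))"
    by (intro sum_emeasure[symmetric]) (auto simp: disjoint_family_on_def cyl_fun_upd)
  finally show ?thesis .
qed

end

section \<open>Crossings and stopped paths\<close>

definition crossing ::
  "(int ^ 'd) set \<Rightarrow> nat \<Rightarrow> int ^ 'd \<Rightarrow> int ^ 'd \<Rightarrow> (nat \<Rightarrow> int ^ 'd) set" where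
  "crossing B n y e = {X. (\<forall>k<n. X k \<in> B) \<and> X n = y \<and> X (Suc n) = y + e}"

lemma crossing_shift_Suc:
  "(\<lambda>k. X (m + k)) \<in> crossing B (Suc n) y e \<longleftrightarrow> X m \<in> B \<and> (\<lambda>k. X (Suc m + k)) \<in> crossing B n y e"
  by (auto simp: crossing_def less_Suc_eq_0_disj)

primrec stopped :: "'a set \<Rightarrow> (nat \<Rightarrow> 'a) \<Rightarrow> nat \<Rightarrow> 'a" where
  "stopped B X 0 = X 0"
| "stopped B X (Suc n) = (if stopped B X n \<in> B then X (Suc n) else stopped B X n)"

lemma stopped_cases:
  obtains m where "m \<le> n" "stopped B X n = X m" "\<And>k. k < m \<Longrightarrow> X k \<in> B" "m < n \<Longrightarrow> X m \<notin> B"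
proof -
  have "\<exists>m\<le>n. stopped B X n = X m \<and> (\<forall>k<m. X k \<in> B) \<and> (m < n \<longrightarrow> X m \<notin> B)"
  proof (induction n)
    case (Suc n)
    then obtain m where m: "m \<le> n" "stopped B X n = X m" "\<forall>k<m. X k \<in> B" "m < n \<longrightarrow> X m \<notin> B"
      by blast
    show ?case
    proof (cases "X m \<in> B")
      case True
      hence "m = n" using m by auto
      thus ?thesis using True m by (intro exI[of _ "Suc n"]) (auto simp: less_Suc_eq)
    next
      case False
      thus ?thesis using m by (intro exI[of _ m]) auto
    qed
  qed simp
  thus ?thesis using that by blast
qed

lemma stopped_in_iff: "stopped B X n \<in> B \<longleftrightarrow> (\<forall>k\<le>n. X k \<in> B)"
proof (rule stopped_cases[of n B X])
  fix m assume "m \<le> n" "stopped B X n = X m" "\<And>k. k < m \<Longrightarrow> X k \<in> B" "m < n \<Longrightarrow> X m \<notin> B"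
  thus ?thesis by (cases "m = n") (auto simp: le_less)
qed

lemma sum_indicator_crossing:
  fixes g :: "int ^ 'd \<Rightarrow> int ^ 'd \<Rightarrow> real"
  assumes "finite B" "nn_path X"
  shows "(\<Sum>y\<in>B. \<Sum>e\<in>nbr. indicator (crossing B n y e) X * g y e) =
    (if \<forall>k\<le>n. X k \<in> B then g (X n) (X (Suc n) - X n) else 0)"
proof (cases "\<forall>k\<le>n. X k \<in> B")
  case True
  let ?z = "(X n, X (Suc n) - X n)"
  have "indicator (crossing B n y e) X * g y e = (if ?z = (y, e) then g y e else 0)" for y e
    using True by (auto simp: crossing_def indicator_def)
  hence "(\<Sum>y\<in>B. \<Sum>e\<in>nbr. indicator (crossing B n y e) X * g y e) =
      (\<Sum>z\<in>B \<times> nbr. if ?z = z then g (fst z) (snd z) else 0)"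
    by (simp add: sum.cartesian_product case_prod_unfold prod_eq_iff)
  also have "\<dots> = g (X n) (X (Suc n) - X n)"
    using assms True by (subst sum.delta') (auto simp: nn_path_def)
  finally show ?thesis using True by simp
next
  case False
  hence "indicator (crossing B n y e) X = (0::real)" if "y \<in> B" for y e
    using that by (auto simp: crossing_def indicator_def le_less)
  thus ?thesis using False by auto
qed

lemma stopped_eq_sum_crossing:
  fixes f :: "int ^ 'd \<Rightarrow> real"
  assumes "finite B" "nn_path X"
  shows "f (stopped B X N) =
    f 0 + (\<Sum>n<N. \<Sum>y\<in>B. \<Sum>e\<in>nbr. indicator (crossing B n y e) X * (f (y + e) - f y))"
proof (induction N)
  case (Suc N)
  have "stopped B X N = X N" if "stopped B X N \<in> B"
    using that stopped_cases[of N B X] by (metis order_le_less)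
  hence "f (stopped B X (Suc N)) = f (stopped B X N) +
      (if \<forall>k\<le>N. X k \<in> B then f (X N + (X (Suc N) - X N)) - f (X N) else 0)"
    by (simp flip: stopped_in_iff)
  thus ?case
    by (simp only: Suc sum.lessThan_Suc sum_indicator_crossing[OF assms] add.assoc)
qed (use assms in \<open>simp add: nn_path_def\<close>)

context annealed_walk
begin

lemma measurable_shift_crossing [measurable]:
  "Measurable.pred P (\<lambda>X. (\<lambda>k. X (m + k)) \<in> crossing B n y e)"
proof -
  have "Measurable.pred P (\<lambda>X. (\<forall>k\<in>{..<n}. X (m + k) \<in> B) \<and> X (m + n) = y \<and> X (m + Suc n) = y + e)"
    by measurable
  thus ?thesis by (simp add: crossing_def Ball_def)
qed

lemma crossing_events [measurable]: "crossing B n y e \<in> events"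
  using events_Collect[OF measurable_shift_crossing[of 0 B n y e]] by simp

lemma measurable_stopped [measurable]: "(\<lambda>X. stopped B X n) \<in> measurable P (count_space UNIV)"
proof (induction n)
  case (Suc n)
  note Suc [measurable]
  show ?case unfolding stopped.simps by measurable
qed simp

lemma emeasure_cyl_crossing_0:
  assumes "zs 0 = 0"
  shows "emeasure P (cyl m zs \<inter> {X. (\<lambda>k. X (m + k)) \<in> crossing B 0 y e}) =
    (if zs m = y then (\<integral>\<^sup>+\<omega>. ennreal (traj_weight \<omega> zs m * \<omega> y e) \<partial>env) else 0)"
proof (cases "zs m = y")
  case True
  hence "cyl m zs \<inter> {X. (\<lambda>k. X (m + k)) \<in> crossing B 0 y e} =
      cyl (Suc m) (fun_upd zs (Suc m) (y + e))"
    by (auto simp: cyl_fun_upd crossing_def cyl_def)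
  thus ?thesis using True assms by (simp add: emeasure_cyl traj_weight_fun_upd)
next
  case False
  hence "cyl m zs \<inter> {X. (\<lambda>k. X (m + k)) \<in> crossing B 0 y e} = {}"
    by (auto simp: crossing_def cyl_def)
  thus ?thesis using False by (simp only: emeasure_empty if_False)
qed

lemma emeasure_cyl_crossing_Suc:
  "emeasure P (cyl m zs \<inter> {X. (\<lambda>k. X (m + k)) \<in> crossing B (Suc n) y e}) =
    (if zs m \<in> B then \<Sum>e'\<in>nbr. emeasure P (cyl (Suc m) (fun_upd zs (Suc m) (zs m + e')) \<inter>
       {X. (\<lambda>k. X (Suc m + k)) \<in> crossing B n y e}) else 0)"
proof -
  have "cyl m zs \<inter> {X. (\<lambda>k. X (m + k)) \<in> crossing B (Suc n) y e} =
      (if zs m \<in> B then cyl m zs \<inter> {X. (\<lambda>k. X (Suc m + k)) \<in> crossing B n y e} else {})"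
    unfolding crossing_shift_Suc by (auto simp: cyl_def)
  thus ?thesis
    by (simp only: emeasure_cyl_step[OF events_Collect[OF measurable_shift_crossing], of m zs]
        emeasure_empty split: if_split) simp
qed

lemma emeasure_cyl_crossing:
  assumes "zs 0 = 0"
  shows "emeasure P (cyl m zs \<inter> {X. (\<lambda>k. X (m + k)) \<in> crossing B n y e}) =
    (\<integral>\<^sup>+\<omega>. ennreal (traj_weight \<omega> zs m * path_weight \<omega> B y n (zs m) * \<omega> y e) \<partial>env)"
  using assms
proof (induction n arbitrary: m zs)
  case 0
  thus ?case by (simp add: emeasure_cyl_crossing_0)
next
  case (Suc n)
  show ?case
  proof (cases "zs m \<in> B")
    case True
    hence "emeasure P (cyl m zs \<inter> {X. (\<lambda>k. X (m + k)) \<in> crossing B (Suc n) y e})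
        = (\<Sum>e'\<in>nbr. \<integral>\<^sup>+\<omega>. ennreal (traj_weight \<omega> zs m * \<omega> (zs m) e' *
            path_weight \<omega> B y n (zs m + e') * \<omega> y e) \<partial>env)"
      unfolding emeasure_cyl_crossing_Suc if_P[OF True] using Suc.prems
      by (intro sum.cong refl) (subst Suc.IH, auto simp: traj_weight_fun_upd)
    also have "\<dots> = (\<integral>\<^sup>+\<omega>. (\<Sum>e'\<in>nbr. ennreal (traj_weight \<omega> zs m * \<omega> (zs m) e' *
        path_weight \<omega> B y n (zs m + e') * \<omega> y e)) \<partial>env)"
      by (rule nn_integral_sum[symmetric]) measurable
    also have "\<dots> = (\<integral>\<^sup>+\<omega>. ennreal (traj_weight \<omega> zs m *
        path_weight \<omega> B y (Suc n) (zs m) * \<omega> y e) \<partial>env)"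
    proof (intro nn_integral_cong_AE, use AE_env_probvecs in eventually_elim)
      case (elim \<omega>)
      thus ?case
        using True by (subst sum_ennreal)
          (auto simp: traj_weight_nonneg path_weight_nonneg probvecsD(1) site_probvecs
            sum_distrib_left sum_distrib_right mult.assoc)
    qed
    finally show ?thesis .
  qed (simp add: emeasure_cyl_crossing_Suc del: add_Suc)
qed

lemma emeasure_crossing:
  "emeasure P (crossing B n y e) = (\<integral>\<^sup>+\<omega>. ennreal (path_weight \<omega> B y n 0) * ennreal (\<omega> y e) \<partial>env)"
proof -
  have "emeasure P (crossing B n y e) =
      emeasure P (cyl 0 (\<lambda>_. 0) \<inter> {X. (\<lambda>k. X (0 + k)) \<in> crossing B n y e})"
    using AE_nn_path
    by (intro emeasure_eq_AE) (auto elim!: eventually_mono simp: nn_path_def cyl_def)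
  also have "\<dots> = (\<integral>\<^sup>+\<omega>. ennreal (path_weight \<omega> B y n 0 * \<omega> y e) \<partial>env)"
    by (subst emeasure_cyl_crossing) (simp_all add: traj_weight_def)
  also have "\<dots> = (\<integral>\<^sup>+\<omega>. ennreal (path_weight \<omega> B y n 0) * ennreal (\<omega> y e) \<partial>env)"
    using AE_env_probvecs
    by (intro nn_integral_cong_AE)
      (auto elim!: eventually_mono simp: ennreal_mult' path_weight_nonneg)
  finally show ?thesis .
qed

lemma expectation_stopped:
  fixes f :: "int ^ 'd \<Rightarrow> real"
  assumes "finite B"
  shows "integrable P (\<lambda>X. f (stopped B X N))"
    and "expectation (\<lambda>X. f (stopped B X N)) =
      f 0 + (\<Sum>y\<in>B. \<Sum>e\<in>nbr. (\<Sum>n<N. prob (crossing B n y e)) * (f (y + e) - f y))"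
proof -
  define g where "g n y e X = indicator (crossing B n y e) X * (f (y + e) - f y)" for n y e X
  let ?S = "\<lambda>X. f 0 + (\<Sum>n<N. \<Sum>y\<in>B. \<Sum>e\<in>nbr. g n y e X)"
  have eq: "AE X in P. f (stopped B X N) = ?S X"
    unfolding g_def using AE_nn_path by eventually_elim (rule stopped_eq_sum_crossing[OF assms])
  have [measurable]: "(\<lambda>X. f (stopped B X N)) \<in> borel_measurable P"
    by (rule measurable_compose[OF measurable_stopped]) simp
  have int_g: "integrable P (g n y e)" for n y e
    unfolding g_def
    by (intro integrable_mult_left integrable_real_indicator) (auto simp: emeasure_eq_measure)
  have mean_g: "expectation (g n y e) = prob (crossing B n y e) * (f (y + e) - f y)" for n y e
    unfolding g_def by simp
  have int_S: "integrable P ?S"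
    by (intro Bochner_Integration.integrable_add Bochner_Integration.integrable_sum int_g) simp
  thus "integrable P (\<lambda>X. f (stopped B X N))"
    using eq by (subst integrable_cong_AE[where g = ?S]) auto
  have "expectation (\<lambda>X. f (stopped B X N)) = expectation ?S"
    using eq int_S by (intro integral_cong_AE) auto
  also have "\<dots> = f 0 + (\<Sum>n<N. \<Sum>y\<in>B. \<Sum>e\<in>nbr. prob (crossing B n y e) * (f (y + e) - f y))"
    by (simp add: Bochner_Integration.integral_add Bochner_Integration.integral_sum
        Bochner_Integration.integrable_sum int_g mean_g)
  also have "(\<Sum>n<N. \<Sum>y\<in>B. \<Sum>e\<in>nbr. prob (crossing B n y e) * (f (y + e) - f y))
     = (\<Sum>y\<in>B. \<Sum>e\<in>nbr. (\<Sum>n<N. prob (crossing B n y e)) * (f (y + e) - f y))"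
    by (subst sum.swap, intro sum.cong refl, subst sum.swap) (simp add: sum_distrib_right)
  finally show "expectation (\<lambda>X. f (stopped B X N)) =
      f 0 + (\<Sum>y\<in>B. \<Sum>e\<in>nbr. (\<Sum>n<N. prob (crossing B n y e)) * (f (y + e) - f y))" .
qed

lemma prob_stay_eq:
  assumes "finite B"
  shows "prob {X. \<forall>k\<le>n. X k \<in> B} = (\<Sum>y\<in>B. \<Sum>e\<in>nbr. prob (crossing B n y e))"
proof -
  have [measurable]: "{X. \<forall>k\<le>n. X k \<in> B} \<in> events"
    using events_Collect[of "\<lambda>X. \<forall>k\<in>{..n}. X k \<in> B"] by (simp add: Ball_def)
  have stay: "AE X in P. indicator {X. \<forall>k\<le>n. X k \<in> B} X =
      (\<Sum>y\<in>B. \<Sum>e\<in>nbr. indicator (crossing B n y e) X * (1 :: real))"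
    using AE_nn_path
    by eventually_elim (simp only: sum_indicator_crossing[OF assms], simp add: indicator_def)
  have "prob {X. \<forall>k\<le>n. X k \<in> B} = expectation (indicator {X. \<forall>k\<le>n. X k \<in> B})" by simp
  also have "\<dots> = expectation (\<lambda>X. \<Sum>y\<in>B. \<Sum>e\<in>nbr. indicator (crossing B n y e) X * 1)"
    using stay by (intro integral_cong_AE) measurable
  also have "\<dots> = (\<Sum>y\<in>B. \<Sum>e\<in>nbr. prob (crossing B n y e))"
    by (simp add: Bochner_Integration.integral_sum Bochner_Integration.integrable_sum
        emeasure_eq_measure del: sum_indicator_mult)
  finally show ?thesis .
qed

end

locale elliptic_walk = elliptic_rwre \<mu> \<kappa> + annealed_walk \<mu> P
  for \<mu> :: "(int ^ 'd \<Rightarrow> real) measure" and \<kappa> and P :: "(nat \<Rightarrow> int ^ 'd) measure"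
begin

lemma crossing_sums:
  assumes "y \<in> B" "B \<noteq> UNIV"
  shows "(\<lambda>n. prob (crossing B n y e)) sums mean_crossings B 0 y e"
proof -
  have "(\<Sum>n. ennreal (prob (crossing B n y e)))
      = (\<integral>\<^sup>+\<omega>. (\<Sum>n. ennreal (path_weight \<omega> B y n 0) * ennreal (\<omega> y e)) \<partial>env)"
    unfolding emeasure_eq_measure[symmetric] emeasure_crossing
    by (rule nn_integral_suminf[symmetric]) measurable
  also have "\<dots> = ennreal (mean_crossings B 0 y e)"
    by (simp add: nn_integral_crossings[OF assms] flip: green_eq_suminf)
  finally show ?thesis
    using summable_sums[of "\<lambda>n. ennreal (prob (crossing B n y e))"]
    by (simp add: sums_ennreal mean_crossings_nonneg)
qed

lemma expectation_stopped_tendsto: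
  fixes f :: "int ^ 'd \<Rightarrow> real"
  assumes "finite B" "B \<noteq> UNIV"
  shows "(\<lambda>N. expectation (\<lambda>X. f (stopped B X N)))
    \<longlonglongrightarrow> f 0 + (\<Sum>y\<in>B. \<Sum>e\<in>nbr. mean_crossings B 0 y e * (f (y + e) - f y))"
  unfolding expectation_stopped(2)[OF assms(1)]
  by (intro tendsto_intros) (use crossing_sums assms in \<open>simp add: sums_def\<close>)

lemma sum_prob_stay_le:
  assumes "finite B" "B \<noteq> UNIV"
  shows "(\<Sum>n<N. prob {X. \<forall>k\<le>n. X k \<in> B}) \<le> (\<Sum>y\<in>B. mean_green B 0 y)"
proof -
  have "(\<Sum>n<N. prob {X. \<forall>k\<le>n. X k \<in> B}) = (\<Sum>n<N. \<Sum>y\<in>B. \<Sum>e\<in>nbr. prob (crossing B n y e))"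
    by (simp only: prob_stay_eq[OF assms(1)])
  also have "\<dots> = (\<Sum>y\<in>B. \<Sum>e\<in>nbr. \<Sum>n<N. prob (crossing B n y e))"
    by (subst sum.swap, intro sum.cong refl, subst sum.swap) simp
  also have "\<dots> \<le> (\<Sum>y\<in>B. \<Sum>e\<in>nbr. mean_crossings B 0 y e)"
  proof (intro sum_mono)
    fix y e :: "int ^ 'd" assume "y \<in> B"
    from crossing_sums[OF this assms(2), of e]
    show "(\<Sum>n<N. prob (crossing B n y e)) \<le> mean_crossings B 0 y e"
      using sum_le_suminf[of "\<lambda>n. prob (crossing B n y e)" "{..<N}"] by (simp add: sums_iff)
  qed
  also have "\<dots> = (\<Sum>y\<in>B. mean_green B 0 y)"
    using assms(2) by (simp add: sum_mean_crossings)
  finally show ?thesis .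
qed

end

section \<open>Exit estimates from Kalikow's condition\<close>

lemma level_stopped_le:
  assumes "nn_path X" "\<And>x. x \<in> B \<Longrightarrow> x $ i < L" "0 \<le> L"
  shows "stopped B X N $ i \<le> L"
proof (rule stopped_cases[of N B X])
  fix m assume m: "stopped B X N = X m" "\<And>k. k < m \<Longrightarrow> X k \<in> B"
  show ?thesis
  proof (cases m)
    case 0
    thus ?thesis using assms m by (simp add: nn_path_def)
  next
    case (Suc k)
    hence "X k $ i < L" using m assms(2) by simp
    thus ?thesis using nn_path_component_Suc_le[OF assms(1), of k i] m Suc by simp
  qed
qed

definition half_cube :: "'d \<Rightarrow> nat \<Rightarrow> (int ^ 'd) set" where
  "half_cube i n = cube (int n) \<inter> {x. 0 \<le> x $ i}"

lemma finite_half_cube: "finite (half_cube i n)"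
  by (simp add: half_cube_def finite_cube)

lemma zero_in_half_cube: "0 \<in> half_cube i n"
  by (simp add: half_cube_def zero_in_cube)

lemma nn_connected_half_cube: "nn_connected (half_cube i n)"
  unfolding half_cube_def by (intro nn_connected_cube_Int) (auto simp: axis_def sgn_if)

lemma half_cube_neq_UNIV: "half_cube i n \<noteq> UNIV"
proof -
  have "- axis i 1 \<notin> half_cube i n" by (simp add: half_cube_def axis_def)
  thus ?thesis by auto
qed

lemma level_stopped_half_cube_neg:
  assumes "nn_path X" "k \<le> n" "X k $ i < 0" "n < N"
  shows "stopped (half_cube i n) X N $ i < 0"
proof (rule stopped_cases[of N "half_cube i n" X])
  fix m assume m: "stopped (half_cube i n) X N = X m"
    "\<And>k. k < m \<Longrightarrow> X k \<in> half_cube i n" "m < N \<Longrightarrow> X m \<notin> half_cube i n"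
  have "m \<le> k" using m(2)[of k] assms(3) by (force simp: half_cube_def)
  thus ?thesis
    using m(1,3) nn_path_in_cube[OF assms(1), of m n] assms by (auto simp: half_cube_def)
qed

lemma exponential_supersolution:
  fixes J :: "int ^ 'd \<Rightarrow> real" and i :: 'd
  assumes \<delta>: "0 < \<delta>" and J: "\<And>e. e \<in> nbr \<Longrightarrow> 0 \<le> J e"
    and drift: "\<delta> * (\<Sum>e\<in>nbr. J e) \<le> J (axis i 1) - J (- axis i 1)"
  shows "(\<Sum>e\<in>nbr. J e * ((1 / (1 + \<delta>)) powi ((y + e) $ i) - (1 / (1 + \<delta>)) powi (y $ i))) \<le> 0"
proof -
  define r where "r = 1 / (1 + \<delta>)"
  let ?a = "axis i 1 :: int ^ 'd"
  have r: "0 < r" "r < 1" using \<delta> by (auto simp: r_def)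
  have "J ?a + J (- ?a) \<le> (\<Sum>e\<in>nbr. J e)"
    using sum_mono2[of nbr "{?a, - ?a}" J] J axis_neq_uminus_axis[of i i] by simp
  hence "\<delta> * (J ?a + J (- ?a)) \<le> J ?a - J (- ?a)"
    using drift \<delta> by (meson mult_left_mono less_imp_le order.trans)
  moreover have "0 \<le> \<delta> * J ?a" using \<delta> J by simp
  ultimately have "(1 + \<delta>) * J (- ?a) \<le> J ?a" by (simp add: algebra_simps)
  hence "J (- ?a) / r \<le> J ?a" by (simp add: r_def mult.commute)
  have powi: "r powi ((y + ?a) $ i) = r powi (y $ i) * r"
    "r powi ((y + - ?a) $ i) = r powi (y $ i) / r"
    using r by (simp_all add: axis_def power_int_add power_int_diff)
  have "(\<Sum>e\<in>nbr. J e * (r powi ((y + e) $ i) - r powi (y $ i)))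
      = J ?a * (r powi ((y + ?a) $ i) - r powi (y $ i))
        + J (- ?a) * (r powi ((y + - ?a) $ i) - r powi (y $ i))"
    by (rule sum_nbr_axis) simp
  also have "\<dots> = r powi (y $ i) * (1 - r) * (J (- ?a) / r - J ?a)"
    unfolding powi using r by (simp add: field_simps)
  also have "\<dots> \<le> 0"
    using r \<open>J (- ?a) / r \<le> J ?a\<close> by (intro mult_nonneg_nonpos) auto
  finally show ?thesis by (simp only: r_def)
qed

definition nonneg_paths :: "'d \<Rightarrow> (nat \<Rightarrow> int ^ 'd) set" where
  "nonneg_paths i = {X. \<forall>n. 0 \<le> X n $ i}"

lemma (in annealed_walk) nonneg_paths_events [measurable]: "nonneg_paths i \<in> events"
  unfolding nonneg_paths_def by measurable

locale kalikow_walk = elliptic_walk \<mu> \<kappa> P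
  for \<mu> :: "(int ^ 'd \<Rightarrow> real) measure" and \<kappa> and P :: "(nat \<Rightarrow> int ^ 'd) measure" +
  fixes i :: 'd
  assumes kalikow: "kalikow_condition env (axis i 1)"
begin

abbreviation \<delta> :: real where
  "\<delta> \<equiv> kalikow_const env (axis i 1)"

lemma delta_pos: "0 < \<delta>"
  using kalikow by (simp add: kalikow_condition_def)

lemma sum_prob_stay_bound:
  assumes B: "finite B" "nn_connected B" "0 \<in> B" "\<And>x. x \<in> B \<Longrightarrow> x $ i < int L"
  shows "\<delta> * (\<Sum>n<N. prob {X. \<forall>k\<le>n. X k \<in> B}) \<le> real L"
proof -
  let ?J = "mean_crossings B 0" and ?f = "\<lambda>x :: int ^ 'd. real_of_int (x $ i)"
  have "axis i (int L) \<notin> B" using B(4)[of "axis i (int L)"] by (auto simp: axis_def)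
  hence B_UNIV: "B \<noteq> UNIV" by auto
  have "\<delta> * (\<Sum>n<N. prob {X. \<forall>k\<le>n. X k \<in> B}) \<le> \<delta> * (\<Sum>y\<in>B. mean_green B 0 y)"
    using delta_pos by (intro mult_left_mono sum_prob_stay_le B B_UNIV) simp
  also have "\<dots> \<le> (\<Sum>y\<in>B. ?J y (axis i 1) - ?J y (- axis i 1))"
    unfolding sum_distrib_left by (intro sum_mono kalikow_const_mean_green_le B B_UNIV)
  also have "\<dots> = ?f 0 + (\<Sum>y\<in>B. \<Sum>e\<in>nbr. ?J y e * (?f (y + e) - ?f y))"
    by (simp add: sum_nbr_component)
  also have "\<dots> \<le> real L"
  proof (rule LIMSEQ_le_const2[OF expectation_stopped_tendsto[OF B(1) B_UNIV]],
      intro exI allI impI)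
    fix N
    show "expectation (\<lambda>X. ?f (stopped B X N)) \<le> real L"
    proof (rule integral_le_const[OF expectation_stopped(1)[OF B(1)]])
      show "AE X in P. ?f (stopped B X N) \<le> real L"
        using AE_nn_path
      proof eventually_elim
        case (elim X)
        have "stopped B X N $ i \<le> int L" by (rule level_stopped_le[OF elim B(4)]) simp_all
        thus ?case by linarith
      qed
    qed
  qed
  finally show ?thesis .
qed

lemma sum_prob_below_le: "(\<Sum>n<N. prob {X. \<forall>k\<le>n. X k $ i < int L}) \<le> real L / \<delta>"
proof (cases "L = 0")
  case True
  have "prob {X. \<forall>k\<le>n. X k $ i < int L} = prob {}" for n
    using AE_nn_path
    by (intro measure_eq_AE events_Collect) (auto elim!: eventually_mono simp: True nn_path_def)
  thus ?thesis using delta_pos by simp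
next
  case False
  define B where "B = cube (int N) \<inter> {x :: int ^ 'd. x $ i < int L}"
  have conn: "nn_connected B"
    unfolding B_def using False by (intro nn_connected_cube_Int) (auto simp: axis_def sgn_if)
  have "(\<Sum>n<N. prob {X. \<forall>k\<le>n. X k $ i < int L}) = (\<Sum>n<N. prob {X. \<forall>k\<le>n. X k \<in> B})"
  proof (intro sum.cong refl measure_eq_AE events_Collect)
    fix n assume "n \<in> {..<N}"
    thus "AE X in P. (X \<in> {X. \<forall>k\<le>n. X k $ i < int L}) = (X \<in> {X. \<forall>k\<le>n. X k \<in> B})"
      using AE_nn_path by (auto elim!: eventually_mono simp: B_def intro!: nn_path_in_cube)
  qed measurable
  moreover have "\<delta> * (\<Sum>n<N. prob {X. \<forall>k\<le>n. X k \<in> B}) \<le> real L"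
    using False by (intro sum_prob_stay_bound conn) (auto simp: B_def finite_cube zero_in_cube)
  ultimately show ?thesis using delta_pos by (simp add: field_simps)
qed

lemma prob_dip_le_expectation:
  assumes r: "0 < r" "r < 1" and N: "n < N"
  shows "prob {X. \<exists>k\<le>n. X k $ i < 0} / r \<le>
    expectation (\<lambda>X. r powi (stopped (half_cube i n) X N $ i))"
proof -
  let ?dip = "{X. \<exists>k\<le>n. X k $ i < 0}" and ?f = "\<lambda>x :: int ^ 'd. r powi (x $ i)"
  have [measurable]: "?dip \<in> events" by measurable
  have "prob ?dip / r = expectation (\<lambda>X. indicator ?dip X / r)" by simp
  also have "\<dots> \<le> expectation (\<lambda>X. ?f (stopped (half_cube i n) X N))"
  proof (rule integral_mono_AE[OF _ expectation_stopped(1)[OF finite_half_cube]])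
    show "AE X in P. indicator ?dip X / r \<le> ?f (stopped (half_cube i n) X N)"
      using AE_nn_path
    proof eventually_elim
      case (elim X)
      show ?case
      proof (cases "X \<in> ?dip")
        case True
        hence "stopped (half_cube i n) X N $ i \<le> - 1"
          using level_stopped_half_cube_neg[OF elim _ _ N] by force
        hence "r powi (- 1) \<le> ?f (stopped (half_cube i n) X N)"
          using r by (intro power_int_decreasing) auto
        thus ?thesis using True by (simp add: power_int_minus inverse_eq_divide)
      qed (use r in simp)
    qed
  qed (simp add: emeasure_eq_measure)
  finally show ?thesis .
qed

lemma prob_dip_le: "prob {X. \<exists>k\<le>n. X k $ i < 0} \<le> 1 / (1 + \<delta>)"
proof -
  let ?B = "half_cube i n" and ?dip = "{X. \<exists>k\<le>n. X k $ i < 0}"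
  define r where "r = 1 / (1 + \<delta>)"
  let ?J = "mean_crossings ?B 0" and ?f = "\<lambda>x :: int ^ 'd. r powi (x $ i)"
  have r: "0 < r" "r < 1" using delta_pos by (auto simp: r_def)
  have "prob ?dip / r \<le> ?f 0 + (\<Sum>y\<in>?B. \<Sum>e\<in>nbr. ?J y e * (?f (y + e) - ?f y))"
    using prob_dip_le_expectation[OF r]
    by (intro LIMSEQ_le_const
        [OF expectation_stopped_tendsto[OF finite_half_cube half_cube_neq_UNIV]] exI[of _ "Suc n"]) auto
  also have "\<dots> \<le> 1"
  proof -
    have "(\<Sum>e\<in>nbr. ?J y e * (?f (y + e) - ?f y)) \<le> 0" if "y \<in> ?B" for y
      unfolding r_def
      using kalikow_const_mean_green_le
        [OF nn_connected_half_cube half_cube_neq_UNIV zero_in_half_cube that, of i]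
      by (intro exponential_supersolution delta_pos mean_crossings_nonneg)
        (simp add: sum_mean_crossings[OF that half_cube_neq_UNIV])
    thus ?thesis by (simp add: sum_nonpos)
  qed
  finally show ?thesis using r by (simp add: field_simps flip: r_def)
qed

lemma prob_nonneg_paths_pos: "0 < prob (nonneg_paths i)"
proof -
  have "(\<lambda>n. prob {X. \<exists>k\<le>n. X k $ i < 0}) \<longlonglongrightarrow> prob (\<Union>n. {X. \<exists>k\<le>n. X k $ i < 0})"
    by (intro finite_Lim_measure_incseq) (auto simp: incseq_def intro: order.trans)
  hence "prob (\<Union>n. {X. \<exists>k\<le>n. X k $ i < 0}) \<le> 1 / (1 + \<delta>)"
    by (rule LIMSEQ_le_const2) (use prob_dip_le in auto)
  moreover have "(\<Union>n. {X. \<exists>k\<le>n. X k $ i < 0}) = space P - nonneg_paths i"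
    by (simp add: nonneg_paths_def set_eq_iff) (metis not_le order_refl)
  ultimately have "1 - prob (nonneg_paths i) \<le> 1 / (1 + \<delta>)"
    using prob_compl[OF nonneg_paths_events] by simp
  moreover have "1 / (1 + \<delta>) < 1" using delta_pos by simp
  ultimately show ?thesis by linarith
qed

end

section \<open>Independence of the future at a record level\<close>

definition path_shift :: "nat \<Rightarrow> (nat \<Rightarrow> int ^ 'd) \<Rightarrow> nat \<Rightarrow> int ^ 'd" where
  "path_shift n X = (\<lambda>j. X (n + j) - X n)"

definition path_concat :: "nat \<Rightarrow> (nat \<Rightarrow> int ^ 'd) \<Rightarrow> (nat \<Rightarrow> int ^ 'd) \<Rightarrow> nat \<Rightarrow> int ^ 'd" where
  "path_concat n zs vs = (\<lambda>k. if k \<le> n then zs k else zs n + vs (k - n))"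

lemma path_concat_0 [simp]: "path_concat n zs vs 0 = zs 0"
  by (simp add: path_concat_def)

lemma path_concat_add: "vs 0 = 0 \<Longrightarrow> path_concat n zs vs (n + j) = zs n + vs j"
  by (cases "j = 0") (auto simp: path_concat_def)

lemma mem_cyl_path_concat_iff:
  assumes "vs 0 = 0"
  shows "X \<in> cyl (n + m) (path_concat n zs vs) \<longleftrightarrow> X \<in> cyl n zs \<and> path_shift n X \<in> cyl m vs"
proof -
  have "(\<forall>k\<le>n+m. Q k) \<longleftrightarrow> (\<forall>k\<le>n. Q k) \<and> (\<forall>j\<le>m. Q (n + j))" for Q
    by (metis add_le_cancel_left le_add1 le_add_diff_inverse nat_le_linear order.trans)
  moreover have "X n = zs n \<Longrightarrow> X (n + j) = zs n + vs j \<longleftrightarrow> path_shift n X j = vs j" for j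
    by (auto simp: path_shift_def algebra_simps)
  ultimately show ?thesis
    unfolding cyl_def mem_Collect_eq
    by (simp add: path_concat_add[of vs n zs, OF assms] cong: conj_cong)
      (auto simp: path_concat_def)
qed

lemma traj_weight_path_concat:
  assumes "vs 0 = 0"
  shows "traj_weight \<omega> (path_concat n zs vs) (n + m)
    = traj_weight \<omega> zs n * traj_weight \<omega> (\<lambda>k. zs n + vs k) m"
proof (induction m)
  case 0
  show ?case by (simp add: traj_weight_def path_concat_def)
next
  case (Suc m)
  thus ?case
    using path_concat_add[of vs n zs m, OF assms] path_concat_add[of vs n zs "Suc m", OF assms]
    by (simp add: traj_weight_def)
qed

lemma measurable_path_shift [measurable]: "path_shift n \<in> measurable path_space path_space"
proof -
  have "(\<lambda>X. path_shift n X) \<in> measurable path_space (\<Pi>\<^sub>M n\<in>UNIV. count_space UNIV)"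
  proof (rule measurable_PiM_single')
    fix j :: nat
    have "(\<lambda>X. (\<lambda>w. w ! (n + j) - w ! n) (prefix_of X (n + j)))
        \<in> measurable path_space (count_space UNIV)"
      by (rule measurable_compose[OF measurable_prefix_of]) simp
    thus "(\<lambda>X :: nat \<Rightarrow> int ^ 'd. path_shift n X j) \<in> measurable path_space (count_space UNIV)"
      by (simp add: path_shift_def)
  qed simp
  thus ?thesis by (simp add: path_space_def)
qed

context annealed_walk
begin

text \<open>Before the record level of \<open>zs\<close> is reached, only the environment below it is used;
  a path \<open>vs\<close> started there that never goes below it uses only the rest.\<close>
lemma prob_cyl_shift_cyl:
  assumes zs: "\<And>k. k < n \<Longrightarrow> zs k $ i < zs n $ i" and vs: "\<And>j. j < m \<Longrightarrow> 0 \<le> vs j $ i"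
  shows "prob {X \<in> cyl n zs. path_shift n X \<in> cyl m vs} = prob (cyl n zs) * prob (cyl m vs)"
proof (cases "vs 0 = 0 \<and> zs 0 = 0")
  case True
  hence "{X \<in> cyl n zs. path_shift n X \<in> cyl m vs} = cyl (n + m) (path_concat n zs vs)"
    using mem_cyl_path_concat_iff[of vs _ n m zs] by blast
  hence "prob {X \<in> cyl n zs. path_shift n X \<in> cyl m vs}
      = (\<integral>\<omega>. traj_weight \<omega> zs n * traj_weight \<omega> (\<lambda>k. zs n + vs k) m \<partial>env)"
    using True by (simp add: prob_cyl annealed_weight_def traj_weight_path_concat)
  also have "\<dots> = annealed_weight zs n * annealed_weight (\<lambda>k. zs n + vs k) m"
  proof (rule integral_traj_weight_mult_disjoint)
    fix j k assume "j < n" "k < m"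
    hence "zs j $ i < (zs n + vs k) $ i" using zs[of j] vs[of k] by simp
    thus "zs j \<noteq> zs n + vs k" by auto
  qed
  finally show ?thesis using True by (simp add: prob_cyl annealed_weight_translate)
next
  case False
  have empty: "{X \<in> cyl n zs. path_shift n X \<in> cyl m vs} = {}" if "vs 0 \<noteq> 0"
    using that by (auto simp: cyl_def path_shift_def)
  have le: "prob {X \<in> cyl n zs. path_shift n X \<in> cyl m vs} \<le> prob (cyl n zs)"
    by (intro finite_measure_mono) (auto simp: sets_P)
  show ?thesis
  proof (cases "zs 0 = 0")
    case True
    hence vs_0: "vs 0 \<noteq> 0" using False by simp
    show ?thesis unfolding empty[OF vs_0] using vs_0 by (simp add: prob_cyl)
  qed (use le in \<open>simp add: prob_cyl measure_le_0_iff\<close>)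
qed

lemma measurable_prefix_path_shift [measurable]:
  "(\<lambda>X. prefix_of (path_shift n X) t) \<in> measurable P (count_space UNIV)"
  by (rule measurable_compose[OF _ measurable_prefix_of]) measurable

lemma emeasure_cyl_shift_prefix:
  assumes zs: "\<And>k. k < n \<Longrightarrow> zs k $ i < zs n $ i"
    and S: "\<And>w j. w \<in> S \<Longrightarrow> j < t \<Longrightarrow> 0 \<le> w ! j $ i"
  shows "emeasure P {X \<in> cyl n zs. prefix_of (path_shift n X) t \<in> S}
     = emeasure P (cyl n zs) * emeasure P {X. prefix_of X t \<in> S}"
proof -
  have "emeasure P {X \<in> cyl n zs. prefix_of (path_shift n X) t \<in> S}
      = emeasure P (cyl n zs) * emeasure P {X \<in> UNIV. prefix_of X t \<in> S}"
  proof (rule emeasure_countable_valued_eq_mult)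
    fix w assume w: "w \<in> S"
    show "emeasure P {X \<in> cyl n zs. prefix_of (path_shift n X) t = w}
        = emeasure P (cyl n zs) * emeasure P {X \<in> UNIV. prefix_of X t = w}"
    proof (cases "length w = Suc t")
      case True
      have "prob {X \<in> cyl n zs. path_shift n X \<in> cyl t (nth w)} =
          prob (cyl n zs) * prob (cyl t (nth w))"
        by (rule prob_cyl_shift_cyl) (use zs S w in auto)
      thus ?thesis
        using True by (simp add: prefix_of_eq_iff emeasure_eq_measure ennreal_mult)
    qed (simp add: prefix_of_eq_iff)
  qed (use sets.top[of P] in \<open>auto simp: sets_P\<close>)
  thus ?thesis by simp
qed

lemma emeasure_cyl_shift_cyl_nonneg:
  assumes zs: "\<And>k. k < n \<Longrightarrow> zs k $ i < zs n $ i"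
  shows "emeasure P {X \<in> cyl n zs. path_shift n X \<in> cyl m vs \<inter> nonneg_paths i}
     = emeasure P (cyl n zs) * emeasure P (cyl m vs \<inter> nonneg_paths i)"
proof -
  define S where "S t = {w. (\<forall>j\<le>m. w ! j = vs j) \<and> (\<forall>j\<le>m+t. 0 \<le> w ! j $ i)}" for t
  define E where "E t = {X. prefix_of X (m + t) \<in> S t}" for t
  define F where "F t = {X \<in> cyl n zs. prefix_of (path_shift n X) (m + t) \<in> S t}" for t
  have E_eq: "E t = {X \<in> cyl m vs. \<forall>j\<le>m+t. 0 \<le> X j $ i}" for t
    by (auto simp: E_def S_def cyl_def)
  have F_eq: "F t = {X \<in> cyl n zs. path_shift n X \<in> E t}" for t by (simp add: F_def E_def)
  have "(\<forall>t. \<forall>j\<le>m+t. Q j) \<longleftrightarrow> (\<forall>j. Q j)" for Q :: "nat \<Rightarrow> bool" by (meson le_add2)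
  hence Inter_E: "(\<Inter>t. E t) = cyl m vs \<inter> nonneg_paths i"
    by (simp add: E_eq nonneg_paths_def set_eq_iff all_conj_distrib)
  have Inter_F: "(\<Inter>t. F t) = {X \<in> cyl n zs. path_shift n X \<in> cyl m vs \<inter> nonneg_paths i}"
    unfolding Inter_E[symmetric] by (auto simp: F_eq)
  have E_events: "E t \<in> events" for t
    unfolding E_def
    by (rule events_Collect) (rule measurable_compose[of _ _ "count_space UNIV"], measurable)
  have F_events: "F t \<in> events" for t
    unfolding F_def using measurable_compose[OF measurable_prefix_path_shift, of "\<lambda>w. w \<in> S t"]
    by measurable
  have "(\<lambda>t. emeasure P (F t)) \<longlonglongrightarrow> emeasure P (\<Inter>t. F t)"
    by (rule Lim_emeasure_decseq)
      (use F_events in \<open>auto simp: decseq_def F_eq E_eq emeasure_eq_measure\<close>)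
  moreover have "emeasure P (F t) = emeasure P (cyl n zs) * emeasure P (E t)" for t
    unfolding F_def E_def by (rule emeasure_cyl_shift_prefix[where i = i]) (auto simp: S_def zs)
  moreover have "(\<lambda>t. emeasure P (cyl n zs) * emeasure P (E t))
      \<longlonglongrightarrow> emeasure P (cyl n zs) * emeasure P (\<Inter>t. E t)"
    by (intro ennreal_tendsto_cmult Lim_emeasure_decseq)
      (use E_events in \<open>auto simp: decseq_def E_eq emeasure_eq_measure\<close>)
  ultimately have "emeasure P (\<Inter>t. F t) = emeasure P (cyl n zs) * emeasure P (\<Inter>t. E t)"
    by (simp add: LIMSEQ_unique)
  thus ?thesis unfolding Inter_E Inter_F .
qed

lemma emeasure_cyl_shift_nonneg:
  assumes zs: "\<And>k. k < n \<Longrightarrow> zs k $ i < zs n $ i" and G: "G \<in> events"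
  shows "emeasure P {X \<in> cyl n zs. path_shift n X \<in> G \<inter> nonneg_paths i}
     = emeasure P (cyl n zs) * emeasure P (G \<inter> nonneg_paths i)"
proof -
  define Z where "Z = {X \<in> cyl n zs. path_shift n X \<in> nonneg_paths i}"
  have Z [measurable]: "Z \<in> events" unfolding Z_def by measurable
  define M where "M = distr (density P (indicator Z)) path_space (path_shift n)"
  define N where
    "N = scale_measure (emeasure P (cyl n zs)) (density P (indicator (nonneg_paths i)))"
  have M: "emeasure M A = emeasure P {X \<in> cyl n zs. path_shift n X \<in> A \<inter> nonneg_paths i}"
    if [measurable]: "A \<in> events" for A
  proof -
    have "emeasure M A = emeasure P (Z \<inter> path_shift n -` A)"
      using measurable_sets[OF measurable_path_shift, of A n] that
      by (simp add: M_def emeasure_distr sets_P emeasure_density indicator_inter_arith[symmetric])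
    thus ?thesis by (auto simp: Z_def intro!: arg_cong[where f = "emeasure P"])
  qed
  have N: "emeasure N A = emeasure P (cyl n zs) * emeasure P (A \<inter> nonneg_paths i)"
    if "A \<in> events" for A
    using that by (simp add: N_def emeasure_density indicator_inter_arith[symmetric] Int_commute)
  have "M = N"
  proof (rule measure_eqI_generator_eq_countable
      [where E = cyls and \<Omega> = UNIV and A = "range (\<lambda>x. cyl 0 (\<lambda>_. x))"])
    show "emeasure M A = emeasure N A" if "A \<in> cyls" for A
      using that
      by (elim cyls_cases)
        (simp_all add: M N sets_P emeasure_cyl_shift_cyl_nonneg[of n zs i, OF zs] del: Int_iff)
    show "\<Union> (range (\<lambda>x :: int ^ 'd. cyl 0 (\<lambda>_. x))) = UNIV" by (auto simp: cyl_def)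
    show "emeasure M A \<noteq> \<infinity>" if "A \<in> range (\<lambda>x. cyl 0 (\<lambda>_. x))" for A
      using that by (auto simp: M sets_P emeasure_eq_measure)
  qed (auto simp: Int_stable_cyls M_def N_def sets_P sets_path_space_eq cyl_in_cyls)
  thus ?thesis using M[OF G] N[OF G] by simp
qed

end

section \<open>Regeneration levels\<close>

definition hit_time :: "'d \<Rightarrow> nat \<Rightarrow> (nat \<Rightarrow> int ^ 'd) \<Rightarrow> nat" where
  "hit_time i k X = (LEAST n. int k \<le> X n $ i)"

definition climbing :: "'d \<Rightarrow> (nat \<Rightarrow> int ^ 'd) \<Rightarrow> bool" where
  "climbing i X \<longleftrightarrow> nn_path X \<and> (\<forall>k. \<exists>n. int k \<le> X n $ i)"

definition after :: "'d \<Rightarrow> nat \<Rightarrow> (nat \<Rightarrow> int ^ 'd) \<Rightarrow> nat \<Rightarrow> int ^ 'd" where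
  "after i k X = path_shift (hit_time i k X) X"

definition regenerates :: "'d \<Rightarrow> nat \<Rightarrow> (nat \<Rightarrow> int ^ 'd) \<Rightarrow> bool" where
  "regenerates i k X \<longleftrightarrow> after i k X \<in> nonneg_paths i"

lemma hit_timeI:
  assumes "int k \<le> X n $ i" "\<And>m. m < n \<Longrightarrow> X m $ i < int k"
  shows "hit_time i k X = n"
  unfolding hit_time_def using assms
  by (intro Least_equality) (auto simp: not_less[symmetric] intro: leI)

lemma less_hit_time: "n < hit_time i k X \<Longrightarrow> X n $ i < int k"
  unfolding hit_time_def by (drule not_less_Least) simp

lemma hit_time_le: "int k \<le> X n $ i \<Longrightarrow> hit_time i k X \<le> n"
  unfolding hit_time_def by (rule Least_le)

context
  fixes i :: "'d :: finite" and X :: "nat \<Rightarrow> int ^ 'd"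
  assumes climbing: "climbing i X"
begin

lemma level_hit_time: "X (hit_time i k X) $ i = int k"
proof (rule antisym)
  show "int k \<le> X (hit_time i k X) $ i"
    unfolding hit_time_def by (rule LeastI_ex) (use climbing in \<open>simp add: climbing_def\<close>)
  show "X (hit_time i k X) $ i \<le> int k"
  proof (cases "hit_time i k X")
    case 0
    thus ?thesis using climbing by (simp add: climbing_def nn_path_def)
  next
    case (Suc n)
    have "X n $ i < int k" using Suc by (intro less_hit_time) simp
    thus ?thesis
      using climbing nn_path_component_Suc_le[of X n i] Suc by (simp add: climbing_def)
  qed
qed

lemma hit_time_mono: "j \<le> k \<Longrightarrow> hit_time i j X \<le> hit_time i k X"
  by (rule hit_time_le) (simp add: level_hit_time)

lemma hit_time_strict_mono:
  assumes "j < k"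
  shows "hit_time i j X < hit_time i k X"
proof -
  have "hit_time i j X \<noteq> hit_time i k X"
    using level_hit_time[of j] level_hit_time[of k] assms by auto
  thus ?thesis using hit_time_mono[of j k] assms by simp
qed

lemma le_hit_time: "k \<le> hit_time i k X"
proof (induction k)
  case (Suc k)
  thus ?case using hit_time_strict_mono[of k "Suc k"] by simp
qed simp

lemma hit_time_add: "hit_time i (k + j) X = hit_time i k X + hit_time i j (after i k X)"
proof -
  let ?T = "hit_time i k X" and ?S = "hit_time i (k + j) X"
  have le: "?T \<le> ?S" by (rule hit_time_mono) simp
  have "hit_time i j (after i k X) = ?S - ?T"
  proof (rule hit_timeI)
    show "int j \<le> after i k X (?S - ?T) $ i"
      using le by (simp add: after_def path_shift_def level_hit_time)
    fix m assume "m < ?S - ?T"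
    hence "X (?T + m) $ i < int (k + j)" by (intro less_hit_time) simp
    thus "after i k X m $ i < int j" by (simp add: after_def path_shift_def level_hit_time)
  qed
  thus ?thesis using le by simp
qed

lemma after_after: "after i j (after i k X) = after i (k + j) X"
  unfolding after_def[of i "k + j"] hit_time_add
  by (auto simp: after_def path_shift_def add.assoc)

lemma regenerates_after_iff: "regenerates i j (after i k X) \<longleftrightarrow> regenerates i (k + j) X"
  by (simp add: regenerates_def after_after)

lemma regenerates_iff: "regenerates i k X \<longleftrightarrow> (\<forall>n\<ge>hit_time i k X. int k \<le> X n $ i)"
  using level_hit_time[of k]
  by (auto simp: regenerates_def nonneg_paths_def after_def path_shift_def nat_le_iff_add)

end

definition first_passage_word :: "'d \<Rightarrow> nat \<Rightarrow> (int ^ 'd) list \<Rightarrow> bool" where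
  "first_passage_word i k w \<longleftrightarrow> w \<noteq> [] \<and> (\<forall>j<length w - 1. w ! j $ i < int k) \<and> int k \<le> last w $ i"

lemma prefix_hit_time_eq_iff:
  assumes "climbing i X"
  shows "prefix_of X (hit_time i k X) = w \<longleftrightarrow>
    first_passage_word i k w \<and> X \<in> cyl (length w - 1) (nth w)"
proof
  assume "prefix_of X (hit_time i k X) = w"
  hence w: "length w = Suc (hit_time i k X)" "X \<in> cyl (hit_time i k X) (nth w)"
    by (auto simp only: prefix_of_eq_iff)
  hence "w ! j = X j" if "j \<le> hit_time i k X" for j using that by (simp add: cyl_def)
  moreover have "last w = w ! hit_time i k X" using w(1) by (subst last_conv_nth) auto
  ultimately show "first_passage_word i k w \<and> X \<in> cyl (length w - 1) (nth w)"
    using w level_hit_time[OF assms, of k] less_hit_time[of _ i k X]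
    by (auto simp: first_passage_word_def)
next
  assume w: "first_passage_word i k w \<and> X \<in> cyl (length w - 1) (nth w)"
  have "hit_time i k X = length w - 1"
    using w by (intro hit_timeI) (auto simp: first_passage_word_def cyl_def last_conv_nth)
  thus "prefix_of X (hit_time i k X) = w"
    using w by (auto simp: prefix_of_eq_iff first_passage_word_def)
qed

context annealed_walk
begin

lemma measurable_hit_time [measurable]: "hit_time i k \<in> measurable P (count_space UNIV)"
  unfolding hit_time_def by measurable

lemma measurable_after [measurable]: "after i k \<in> measurable P path_space"
proof -
  have "path_shift n \<in> measurable P path_space" for n by measurable
  thus ?thesis unfolding after_def
    by (rule measurable_compose_countable[OF _ measurable_hit_time])
qed

lemma measurable_prefix_hit_time [measurable]:
  "(\<lambda>X. prefix_of X (hit_time i k X)) \<in> measurable P (count_space UNIV)"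
proof (rule measurable_compose_countable[OF _ measurable_hit_time])
  show "(\<lambda>X. prefix_of X n) \<in> measurable P (count_space UNIV)" for n by measurable
qed

lemma after_events: "G \<in> events \<Longrightarrow> {X. after i k X \<in> G} \<in> events"
  using measurable_sets[OF measurable_after, of G] by (simp add: sets_P vimage_def)

lemma after_nonneg_events [measurable]:
  "G \<in> events \<Longrightarrow> {X. after i k X \<in> G \<inter> nonneg_paths i} \<in> events"
  by (intro after_events sets.Int nonneg_paths_events)

lemma pred_regenerates [measurable]: "Measurable.pred P (regenerates i k)"
  unfolding regenerates_def
  using after_events[OF nonneg_paths_events, of i k i] by (simp add: pred_def)

end

context kalikow_walk
begin

lemma AE_climbing: "AE X in P. climbing i X"
proof -
  have "AE X in P. \<exists>n. int L \<le> X n $ i" for L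
  proof -
    let ?N = "{X. \<forall>k. X k $ i < int L}"
    have "real N * prob ?N \<le> real L / \<delta>" for N
    proof -
      have "real N * prob ?N = (\<Sum>n<N. prob ?N)" by simp
      also have "\<dots> \<le> (\<Sum>n<N. prob {X. \<forall>k\<le>n. X k $ i < int L})"
        by (intro sum_mono finite_measure_mono) auto
      finally show ?thesis using sum_prob_below_le[where N = N and L = L] by linarith
    qed
    hence "prob ?N = 0"
      using delta_pos by (intro real_archimedian_rdiv_eq_0[of _ "real L / \<delta>"]) auto
    hence "AE X in P. X \<notin> ?N" by (intro AE_not_in) (simp add: null_sets_def emeasure_eq_measure)
    thus ?thesis by eventually_elim (auto simp: not_less)
  qed
  hence "AE X in P. \<forall>L. \<exists>n. int L \<le> X n $ i" by (simp add: AE_all_countable)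
  with AE_nn_path show ?thesis by eventually_elim (auto simp: climbing_def)
qed

lemma nn_integral_hit_time_le:
  "(\<integral>\<^sup>+X. ennreal (real (hit_time i L X)) \<partial>P) \<le> ennreal (real L / \<delta>)"
proof -
  have "(\<integral>\<^sup>+X. ennreal (real (hit_time i L X)) \<partial>P) =
      (\<Sum>n. emeasure P {X \<in> space P. n < hit_time i L X})"
    unfolding ennreal_of_nat_eq_real_of_nat[symmetric]
    by (rule nn_integral_nat_function) measurable
  also have "\<dots> \<le> (\<Sum>n. ennreal (prob {X. \<forall>k\<le>n. X k $ i < int L}))"
    unfolding emeasure_eq_measure
    by (intro suminf_le ennreal_leI finite_measure_mono) (auto intro!: less_hit_time)
  also have "\<dots> \<le> ennreal (real L / \<delta>)"
    unfolding suminf_eq_SUP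
    by (intro SUP_least, subst sum_ennreal) (auto intro!: ennreal_leI sum_prob_below_le)
  finally show ?thesis .
qed

lemma integrable_hit_time: "integrable P (\<lambda>X. real (hit_time i L X))"
  using nn_integral_hit_time_le[of L]
  by (intro integrableI_nonneg) (auto intro: order.strict_trans1[OF _ ennreal_less_top])

lemma expectation_hit_time_le: "expectation (\<lambda>X. real (hit_time i L X)) \<le> real L / \<delta>"
proof -
  have "ennreal (expectation (\<lambda>X. real (hit_time i L X))) \<le> ennreal (real L / \<delta>)"
    using nn_integral_hit_time_le[of L] nn_integral_eq_integral[OF integrable_hit_time[of L]]
    by simp
  thus ?thesis using delta_pos by (simp add: ennreal_le_iff)
qed

lemma emeasure_after_prefix_eq:
  assumes G: "G \<in> events"
  shows "emeasure P {X \<in> {X. after i k X \<in> G \<inter> nonneg_paths i}. prefix_of X (hit_time i k X) = w}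
    = emeasure P (G \<inter> nonneg_paths i) * emeasure P {X \<in> UNIV. prefix_of X (hit_time i k X) = w}"
    (is "emeasure P ?joint = _ * emeasure P ?past")
proof -
  let ?n = "length w - 1" and ?fpw = "first_passage_word i k w"
  let ?C = "{X \<in> cyl ?n (nth w). ?fpw}"
  let ?C_future = "{X \<in> cyl ?n (nth w). path_shift ?n X \<in> G \<inter> nonneg_paths i \<and> ?fpw}"
  note G [measurable]
  have joint: "emeasure P ?joint = emeasure P ?C_future"
  proof (rule emeasure_eq_AE)
    show "AE X in P. X \<in> ?joint \<longleftrightarrow> X \<in> ?C_future"
      using AE_climbing
    proof eventually_elim
      case (elim X)
      have "hit_time i k X = ?n" if "prefix_of X (hit_time i k X) = w" using that by auto
      thus ?case using prefix_hit_time_eq_iff[OF elim, of k w] by (auto simp: after_def)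
    qed
  qed measurable
  have past: "emeasure P ?past = emeasure P ?C"
  proof (rule emeasure_eq_AE)
    show "AE X in P. X \<in> ?past \<longleftrightarrow> X \<in> ?C"
      using AE_climbing by eventually_elim (simp add: prefix_hit_time_eq_iff conj_commute)
  qed measurable
  show ?thesis
  proof (cases ?fpw)
    case True
    hence "w ! j $ i < w ! ?n $ i" if "j < ?n" for j
      using that
      by (auto simp: first_passage_word_def last_conv_nth intro: order.strict_trans2)
    from emeasure_cyl_shift_nonneg[of ?n "nth w" i, OF this G] show ?thesis
      unfolding joint past using True by (simp add: mult.commute)
  next
    case False
    thus ?thesis unfolding joint past by simp
  qed
qed

lemma fresh_start:
  assumes G: "G \<in> events"
  shows "prob {X. Q (prefix_of X (hit_time i k X)) \<and> after i k X \<in> G \<inter> nonneg_paths i}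
     = prob {X. Q (prefix_of X (hit_time i k X))} * prob (G \<inter> nonneg_paths i)"
proof -
  let ?prefix = "\<lambda>X. prefix_of X (hit_time i k X)"
  have "emeasure P {X \<in> {X. after i k X \<in> G \<inter> nonneg_paths i}. ?prefix X \<in> Collect Q}
    = emeasure P (G \<inter> nonneg_paths i) * emeasure P {X \<in> UNIV. ?prefix X \<in> Collect Q}"
    using sets.top[of P]
    by (intro emeasure_countable_valued_eq_mult emeasure_after_prefix_eq G
        measurable_prefix_hit_time after_nonneg_events) auto
  hence "ennreal (prob {X. Q (prefix_of X (hit_time i k X)) \<and> after i k X \<in> G \<inter> nonneg_paths i})
     = ennreal (prob {X. Q (prefix_of X (hit_time i k X))} * prob (G \<inter> nonneg_paths i))"
    by (simp add: emeasure_eq_measure ennreal_mult' conj_commute mult.commute)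
  thus ?thesis by (simp only: ennreal_inj measure_nonneg mult_nonneg_nonneg)
qed

lemma prob_after:
  "G \<in> events \<Longrightarrow> prob {X. after i k X \<in> G \<inter> nonneg_paths i} = prob (G \<inter> nonneg_paths i)"
  using fresh_start[of G "\<lambda>_. True" k] by simp

end

section \<open>Linear hitting times after a regeneration\<close>

text \<open>Disjoint intervals on which \<open>T\<close> grows faster than \<open>a\<close> are chosen greedily from the left.\<close>
lemma card_fast_growth_le:
  fixes T :: "nat \<Rightarrow> nat"
  assumes mono: "\<And>i j. i \<le> j \<Longrightarrow> T i \<le> T j"
  shows "a * card {k \<in> {..<M}. \<exists>n\<in>{1..N}. T k + a * n < T (k + n)} \<le> T (M + N)"
proof -
  define Z where "Z k = {i \<in> {k..<M}. \<exists>n\<in>{1..N}. T i + a * n < T (i + n)}" for k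
  have "a * card (Z k) + T k \<le> T (M + N)" if "k \<le> M + N" for k
    using that
  proof (induction "M + N - k" arbitrary: k rule: less_induct)
    case less
    consider (past_end) "M \<le> k" | (slow) "k < M" "k \<notin> Z k"
      | (fast) n where "k < M" "1 \<le> n" "n \<le> N" "T k + a * n < T (k + n)"
      by (force simp: Z_def not_less)
    thus ?case
    proof cases
      case past_end
      thus ?thesis using less.prems mono[of k "M + N"] by (simp add: Z_def)
    next
      case slow
      hence "Z k = Z (Suc k)" by (auto simp: Z_def Suc_le_eq le_less)
      moreover have "a * card (Z (Suc k)) + T (Suc k) \<le> T (M + N)"
        using slow less.prems by (intro less.hyps) auto
      ultimately show ?thesis using mono[of k "Suc k"] by simp
    next
      case (fast n)
      have "Z k \<subseteq> {k..<k+n} \<union> Z (k + n)" by (auto simp: Z_def)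
      hence "card (Z k) \<le> card ({k..<k+n} \<union> Z (k + n))" by (intro card_mono) (auto simp: Z_def)
      also have "\<dots> \<le> n + card (Z (k + n))" using card_Un_le[of "{k..<k+n}" "Z (k + n)"] by simp
      finally have "a * card (Z k) \<le> a * n + a * card (Z (k + n))"
        by (metis add_mult_distrib2 mult_le_mono2)
      moreover have "a * card (Z (k + n)) + T (k + n) \<le> T (M + N)"
        using fast less.prems by (intro less.hyps) auto
      ultimately show ?thesis using fast by linarith
    qed
  qed
  from this[of 0] show ?thesis by (simp add: Z_def lessThan_atLeast0)
qed

definition linearly_climbing :: "'d \<Rightarrow> (nat \<Rightarrow> int ^ 'd) set" where
  "linearly_climbing i = {X. \<exists>a. \<forall>n\<ge>1. hit_time i n X \<le> a * n}"

context kalikow_walk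
begin

lemma linearly_climbing_events [measurable]: "linearly_climbing i \<in> events"
proof -
  have "{X. \<exists>a. \<forall>n. 1 \<le> n \<longrightarrow> hit_time i n X \<le> a * n} \<in> events" by measurable
  thus ?thesis by (simp add: linearly_climbing_def)
qed

definition slow :: "nat \<Rightarrow> nat \<Rightarrow> (nat \<Rightarrow> int ^ 'd) set" where
  "slow a N = {X. \<exists>n\<in>{1..N}. a * n < hit_time i n X}"

lemma slow_events [measurable]: "slow a N \<in> events"
  unfolding slow_def by measurable

lemma prob_slow_le:
  assumes a: "0 < a"
  shows "prob (slow a N \<inter> nonneg_paths i) \<le> 1 / (real a * \<delta>)"
proof (rule ccontr)
  let ?p = "prob (slow a N \<inter> nonneg_paths i)"
  assume "\<not> ?p \<le> 1 / (real a * \<delta>)"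
  hence pos: "0 < ?p * real a * \<delta> - 1" using a delta_pos by (simp add: field_simps)
  have "real M * (?p * real a * \<delta> - 1) \<le> real N" for M
  proof -
    define E where "E k = {X. after i k X \<in> slow a N \<inter> nonneg_paths i}" for k
    have "AE X in P. real (card {k \<in> {..<M}. X \<in> E k}) \<le> real (hit_time i (M + N) X) / real a"
      using AE_climbing
    proof eventually_elim
      case (elim X)
      have "a * card {k \<in> {..<M}. X \<in> E k}
          \<le> a * card {k \<in> {..<M}. \<exists>n\<in>{1..N}. hit_time i k X + a * n < hit_time i (k + n) X}"
        by (intro mult_le_mono2 card_mono) (auto simp: E_def slow_def hit_time_add[OF elim])
      also have "\<dots> \<le> hit_time i (M + N) X"
        by (rule card_fast_growth_le) (rule hit_time_mono[OF elim])
      finally have "real (a * card {k \<in> {..<M}. X \<in> E k}) \<le> real (hit_time i (M + N) X)"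
        by (simp only: of_nat_le_iff)
      thus ?case using a by (simp add: field_simps)
    qed
    hence "(\<Sum>k<M. prob (E k)) \<le> expectation (\<lambda>X. real (hit_time i (M + N) X) / real a)"
      unfolding E_def
      by (intro sum_prob_le_expectation integrable_divide integrable_hit_time
          after_nonneg_events slow_events) simp_all
    also have "\<dots> \<le> real (M + N) / \<delta> / real a"
      unfolding integral_divide_zero by (intro divide_right_mono expectation_hit_time_le) simp
    also have "(\<Sum>k<M. prob (E k)) = real M * ?p" by (simp add: E_def prob_after del: Int_iff)
    finally show ?thesis using a delta_pos by (simp add: field_simps)
  qed
  hence "?p * real a * \<delta> - 1 = 0"
    using pos by (intro real_archimedian_rdiv_eq_0[of _ "real N"]) auto
  thus False using pos by simp
qed

lemma prob_not_linearly_climbing: "prob (- linearly_climbing i \<inter> nonneg_paths i) = 0"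
proof -
  let ?bad = "- linearly_climbing i \<inter> nonneg_paths i"
  have "real a * prob ?bad \<le> 1 / \<delta>" if a: "0 < a" for a
  proof -
    have "(\<lambda>N. prob (slow a N \<inter> nonneg_paths i)) \<longlonglongrightarrow> prob (\<Union>N. slow a N \<inter> nonneg_paths i)"
      by (rule finite_Lim_measure_incseq) (auto, force simp: incseq_def slow_def)
    hence "prob (\<Union>N. slow a N \<inter> nonneg_paths i) \<le> 1 / (real a * \<delta>)"
      by (rule LIMSEQ_le_const2) (use prob_slow_le[OF a] in auto)
    moreover have "?bad \<subseteq> (\<Union>N. slow a N \<inter> nonneg_paths i)"
    proof
      fix X assume X: "X \<in> ?bad"
      then obtain n where "n \<ge> 1" "a * n < hit_time i n X"
        by (auto simp: linearly_climbing_def not_le)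
      hence "X \<in> slow a n" by (auto simp: slow_def)
      thus "X \<in> (\<Union>N. slow a N \<inter> nonneg_paths i)" using X by auto
    qed
    hence "prob ?bad \<le> prob (\<Union>N. slow a N \<inter> nonneg_paths i)"
      by (rule finite_measure_mono) measurable
    ultimately have "prob ?bad \<le> 1 / (real a * \<delta>)" by linarith
    thus ?thesis using a delta_pos by (simp add: field_simps)
  qed
  thus ?thesis
    using delta_pos by (intro real_archimedian_rdiv_eq_0[of _ "1 / \<delta>"]) auto
qed

lemma AE_regenerates_linearly_climbing:
  "AE X in P. \<forall>k. regenerates i k X \<longrightarrow> after i k X \<in> linearly_climbing i"
  unfolding AE_all_countable
proof
  fix k
  let ?bad = "{X. after i k X \<in> - linearly_climbing i \<inter> nonneg_paths i}"
  have bad: "- linearly_climbing i \<in> events"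
    using sets.compl_sets[OF linearly_climbing_events] by (simp add: Compl_eq_Diff_UNIV)
  have "prob ?bad = 0" using prob_after[OF bad] prob_not_linearly_climbing by simp
  hence "AE X in P. X \<notin> ?bad"
    using after_nonneg_events[OF bad]
    by (intro AE_not_in) (simp only: null_sets_def emeasure_eq_measure mem_Collect_eq ennreal_0)
  thus "AE X in P. regenerates i k X \<longrightarrow> after i k X \<in> linearly_climbing i"
    by eventually_elim (auto simp: regenerates_def)
qed

end

section \<open>Frequency of regenerations\<close>

definition no_regeneration_upto :: "'d \<Rightarrow> nat \<Rightarrow> (nat \<Rightarrow> int ^ 'd) set" where
  "no_regeneration_upto i t = {X. \<forall>j\<in>{1..t}. \<not> regenerates i j X}"

lemma after_mem_no_regeneration_iff:
  assumes "climbing i X"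
  shows "after i k X \<in> no_regeneration_upto i t \<longleftrightarrow> (\<forall>j\<in>{k<..k+t}. \<not> regenerates i j X)"
proof -
  have shift: "{k<..k+t} = (\<lambda>j. k + j) ` {1..t}"
    by (auto simp: image_iff intro!: bexI[of _ "_ - k"])
  show ?thesis
    unfolding no_regeneration_upto_def mem_Collect_eq regenerates_after_iff[OF assms] shift
    by blast
qed

definition word_dips :: "'d \<Rightarrow> nat \<Rightarrow> (int ^ 'd) list \<Rightarrow> bool" where
  "word_dips i j w \<longleftrightarrow> (\<exists>a b. a \<le> b \<and> b < length w \<and> int j \<le> w ! a $ i \<and> w ! b $ i < int j)"

lemma word_dips_prefix_iff:
  "word_dips i j (prefix_of X n) \<longleftrightarrow> (\<exists>a b. a \<le> b \<and> b \<le> n \<and> int j \<le> X a $ i \<and> X b $ i < int j)"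
  unfolding word_dips_def by (intro ex_cong1 conj_cong refl) (auto simp: less_Suc_eq_le)

lemma eventually_word_dips_iff:
  assumes X: "climbing i X" and "finite J"
  shows "\<forall>\<^sub>F k in sequentially. (\<forall>j\<in>J. word_dips i j (prefix_of X (hit_time i k X)))
    \<longleftrightarrow> (\<forall>j\<in>J. \<not> regenerates i j X)"
proof -
  let ?dips = "\<lambda>j k. word_dips i j (prefix_of X (hit_time i k X))"
  have "\<forall>\<^sub>F k in sequentially. ?dips j k \<longleftrightarrow> \<not> regenerates i j X" for j
  proof (cases "regenerates i j X")
    case True
    have "\<not> word_dips i j (prefix_of X n)" for n
    proof
      assume "word_dips i j (prefix_of X n)"
      then obtain a b where ab: "a \<le> b" "int j \<le> X a $ i" "X b $ i < int j"
        unfolding word_dips_prefix_iff by blast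
      hence "hit_time i j X \<le> b" using hit_time_le[of j X a i] by simp
      thus False using True ab by (auto simp: regenerates_iff[OF X])
    qed
    thus ?thesis using True by simp
  next
    case False
    then obtain b where b: "hit_time i j X \<le> b" "X b $ i < int j"
      by (auto simp: regenerates_iff[OF X] not_le)
    have "?dips j k" if "b \<le> k" for k
      unfolding word_dips_prefix_iff
      using b le_hit_time[OF X, of k] that level_hit_time[OF X, of j]
      by (intro exI[of _ "hit_time i j X"] exI[of _ b]) auto
    thus ?thesis using False by (auto simp: eventually_sequentially)
  qed
  hence "\<forall>\<^sub>F k in sequentially. \<forall>j\<in>J. ?dips j k \<longleftrightarrow> \<not> regenerates i j X"
    using assms(2) by (intro eventually_ball_finite) auto
  thus ?thesis by eventually_elim auto
qed

context kalikow_walk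
begin

lemma no_regeneration_upto_events [measurable]: "no_regeneration_upto i t \<in> events"
  unfolding no_regeneration_upto_def by measurable

text \<open>The events that \<open>k\<close> is the last regeneration level up to \<open>M\<close> are disjoint, and their
  probabilities only depend on \<open>M - k\<close>.\<close>
lemma sum_prob_no_regeneration_le_1:
  "(\<Sum>t\<le>M. prob (no_regeneration_upto i t \<inter> nonneg_paths i)) \<le> 1"
proof -
  define E where "E k = {X. after i k X \<in> no_regeneration_upto i (M - k) \<inter> nonneg_paths i}" for k
  have "AE X in P. real (card {k \<in> {..M}. X \<in> E k}) \<le> 1"
    using AE_climbing
  proof eventually_elim
    case (elim X)
    have E_iff: "X \<in> E k \<longleftrightarrow> regenerates i k X \<and> (\<forall>j\<in>{k<..M}. \<not> regenerates i j X)"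
      if "k \<le> M" for k
      using that
      by (auto simp: E_def regenerates_def[symmetric] after_mem_no_regeneration_iff[OF elim])
    have "k = k'" if "k \<in> {k \<in> {..M}. X \<in> E k}" "k' \<in> {k \<in> {..M}. X \<in> E k}" for k k'
      using that by (cases k k' rule: linorder_cases) (auto simp: E_iff)
    hence "card {k \<in> {..M}. X \<in> E k} \<le> 1"
      by (subst One_nat_def, subst card_le_Suc0_iff_eq) auto
    thus ?case by simp
  qed
  hence "(\<Sum>k\<le>M. prob (E k)) \<le> expectation (\<lambda>_. 1)"
    unfolding E_def
    by (intro sum_prob_le_expectation after_nonneg_events no_regeneration_upto_events) simp_all
  also have "(\<Sum>k\<le>M. prob (E k)) = (\<Sum>k\<le>M. prob (no_regeneration_upto i (M - k) \<inter> nonneg_paths i))"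
    by (simp add: E_def prob_after del: Int_iff)
  also have "\<dots> = (\<Sum>t\<le>M. prob (no_regeneration_upto i t \<inter> nonneg_paths i))"
    by (rule sum.reindex_bij_witness[of _ "\<lambda>k. M - k" "\<lambda>k. M - k"]) auto
  finally show ?thesis by simp
qed

lemma AE_next_regeneration_within_double:
  "AE X in P. \<forall>\<^sub>F k in sequentially. regenerates i k X \<longrightarrow> (\<exists>j\<in>{k<..2*k}. regenerates i j X)"
proof -
  define E where "E k = {X. after i k X \<in> no_regeneration_upto i k \<inter> nonneg_paths i}" for k
  have "summable (\<lambda>t. prob (no_regeneration_upto i t \<inter> nonneg_paths i))"
    using sum_prob_no_regeneration_le_1
    by (intro bounded_imp_summable[of _ 1]) auto
  hence "summable (\<lambda>k. prob (E k))" by (simp add: E_def prob_after del: Int_iff)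
  hence "AE X in P. \<forall>\<^sub>F k in sequentially. X \<in> space P - E k"
    unfolding E_def
    by (intro borel_cantelli_AE1 after_nonneg_events no_regeneration_upto_events)
      (simp_all add: emeasure_eq_measure)
  with AE_climbing show ?thesis
  proof eventually_elim
    case (elim X)
    from elim(2) show ?case
    proof eventually_elim
      case (elim k)
      thus ?case
        using after_mem_no_regeneration_iff[OF \<open>climbing i X\<close>, of k k]
        by (auto simp: E_def regenerates_def[symmetric] mult_2)
    qed
  qed
qed

text \<open>Failures of the levels in \<open>J\<close> to regenerate are witnessed before the hitting time of a high
  level \<open>k\<close>, at which a new independent attempt is made.\<close>
lemma prob_never_regenerates_le:
  assumes "finite J" "J \<subseteq> {m0..}"
  shows "prob {X. \<forall>k\<ge>m0. \<not> regenerates i k X}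
    \<le> (1 - prob (nonneg_paths i)) * prob {X. \<forall>j\<in>J. \<not> regenerates i j X}"
proof -
  let ?\<rho> = "prob (nonneg_paths i)"
  define A where "A = {X. \<forall>k\<ge>m0. \<not> regenerates i k X}"
  define S where "S = {X. \<forall>j\<in>J. \<not> regenerates i j X}"
  define E where "E k = {X. \<forall>j\<in>J. word_dips i j (prefix_of X (hit_time i k X))}" for k
  have [measurable]: "A \<in> events" "S \<in> events" using assms(1) unfolding A_def S_def by measurable
  have [measurable]: "E k \<in> events" for k
    unfolding E_def by (intro events_Collect measurable_compose[OF measurable_prefix_hit_time]) simp
  have E_S: "AE X in P. \<forall>\<^sub>F k in sequentially. X \<in> E k \<longleftrightarrow> X \<in> S"
    using AE_climbing unfolding E_def S_def mem_Collect_eq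
    by eventually_elim (rule eventually_word_dips_iff[OF _ assms(1)])
  have "prob (A \<inter> E k) \<le> (1 - ?\<rho>) * prob (E k)" if "m0 \<le> k" for k
  proof -
    have "prob (A \<inter> E k) \<le> prob (E k - {X. regenerates i k X} \<inter> E k)"
      using that by (intro finite_measure_mono) (auto simp: A_def)
    also have "\<dots> = prob (E k) - prob (E k \<inter> {X. regenerates i k X})"
      by (subst finite_measure_Diff) (auto simp: Int_commute)
    also have "prob (E k \<inter> {X. regenerates i k X}) = prob (E k) * ?\<rho>"
      using fresh_start[of UNIV "\<lambda>w. \<forall>j\<in>J. word_dips i j w" k] sets.top[of P]
      by (simp add: E_def regenerates_def Int_def)
    finally show ?thesis by (simp add: algebra_simps)
  qed
  hence "\<forall>\<^sub>F k in sequentially. prob (A \<inter> E k) \<le> (1 - ?\<rho>) * prob (E k)"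
    using eventually_sequentially by blast
  moreover have "(\<lambda>k. prob (A \<inter> E k)) \<longlonglongrightarrow> prob (A \<inter> S)"
    using E_S by (intro tendsto_prob_of_eventually_mem_iff) (auto elim!: eventually_mono)
  moreover have "(\<lambda>k. (1 - ?\<rho>) * prob (E k)) \<longlonglongrightarrow> (1 - ?\<rho>) * prob S"
    using E_S by (intro tendsto_mult_left tendsto_prob_of_eventually_mem_iff) auto
  ultimately have "prob (A \<inter> S) \<le> (1 - ?\<rho>) * prob S"
    by (intro tendsto_le[OF sequentially_bot])
  moreover have "A \<inter> S = A" using assms(2) by (auto simp: A_def S_def)
  ultimately show ?thesis by (simp add: A_def S_def)
qed

lemma AE_infinitely_many_regenerations: "AE X in P. \<forall>m0. \<exists>k\<ge>m0. regenerates i k X"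
  unfolding AE_all_countable
proof
  fix m0
  let ?\<rho> = "prob (nonneg_paths i)"
  define A where "A = {X. \<forall>k\<ge>m0. \<not> regenerates i k X}"
  define S where "S m = {X. \<forall>j\<in>{m0..m}. \<not> regenerates i j X}" for m
  have [measurable]: "A \<in> events" "S m \<in> events" for m unfolding A_def S_def by measurable
  have "(\<lambda>m. prob (S m)) \<longlonglongrightarrow> prob (\<Inter>m. S m)"
    by (intro finite_Lim_measure_decseq) (auto simp: decseq_def S_def)
  moreover have "(\<Inter>m. S m) = A"
    by (auto simp: S_def A_def) (metis atLeastAtMost_iff order_refl)
  ultimately have "(\<lambda>m. (1 - ?\<rho>) * prob (S m)) \<longlonglongrightarrow> (1 - ?\<rho>) * prob A"
    by (intro tendsto_mult_left) simp
  moreover have "prob A \<le> (1 - ?\<rho>) * prob (S m)" for m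
    unfolding A_def S_def by (rule prob_never_regenerates_le) auto
  ultimately have "prob A \<le> (1 - ?\<rho>) * prob A"
    by (intro LIMSEQ_le_const) auto
  hence "?\<rho> * prob A \<le> 0" by (simp add: algebra_simps)
  hence "prob A = 0" using prob_nonneg_paths_pos by (simp add: mult_le_0_iff measure_le_0_iff)
  hence "AE X in P. X \<notin> A" by (intro AE_not_in) (simp add: null_sets_def emeasure_eq_measure)
  thus "AE X in P. \<exists>k\<ge>m0. regenerates i k X"
    by eventually_elim (auto simp: A_def)
qed

end

section \<open>Positive speed\<close>

lemma obtain_last_between:
  fixes a m :: nat
  assumes "Q a" "a \<le> m"
  obtains j where "a \<le> j" "j \<le> m" "Q j" "\<And>k. j < k \<Longrightarrow> k \<le> m \<Longrightarrow> \<not> Q k"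
proof -
  let ?J = "{j \<in> {a..m}. Q j}"
  have Max_in: "Max ?J \<in> ?J" using assms by (intro Max_in) auto
  have Max_ge: "k \<le> Max ?J" if "k \<in> ?J" for k using that by (intro Max_ge) auto
  show ?thesis
  proof (rule that[of "Max ?J"])
    fix k assume k: "Max ?J < k" "k \<le> m"
    hence "k \<notin> ?J" using Max_ge[of k] by linarith
    moreover have "a \<le> k" using k(1) Max_in by simp
    ultimately show "\<not> Q k" using k(2) by simp
  qed (use Max_in in auto)
qed

lemma liminf_pos_of_linear_lower_bound:
  fixes f :: "nat \<Rightarrow> real"
  assumes "0 < c" "\<And>n. n0 \<le> n \<Longrightarrow> c * real n \<le> f n"
  shows "0 < liminf (\<lambda>n. ereal (f n / real n))"
proof -
  have "0 < ereal c" using assms(1) by simp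
  also have "\<dots> \<le> liminf (\<lambda>n. ereal (f n / real n))"
  proof (rule Liminf_bounded)
    show "\<forall>\<^sub>F n in sequentially. ereal c \<le> ereal (f n / real n)"
      using eventually_ge_at_top[of n0] eventually_gt_at_top[of 0]
      by eventually_elim (simp add: assms(2) pos_le_divide_eq)
  qed
  finally show ?thesis .
qed

lemma regeneration_linear_lower_bound:
  assumes X: "climbing i X" and k0: "regenerates i k0 X"
    and next_regeneration: "\<And>k. k0 \<le> k \<Longrightarrow> regenerates i k X \<Longrightarrow> \<exists>j\<in>{k<..2*k}. regenerates i j X"
    and linear: "\<And>n. 1 \<le> n \<Longrightarrow> hit_time i n (after i k0 X) \<le> b * n"
    and n: "2 * hit_time i k0 X \<le> n"
  shows "1 / (4 * (real b + 1)) * real n \<le> real_of_int (X n $ i)"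
proof -
  have "hit_time i k0 X \<le> n" "k0 \<le> n" using n le_hit_time[OF X, of k0] by auto
  then obtain m where m: "k0 \<le> m" "m \<le> n" "hit_time i m X \<le> n"
    and m_last: "\<And>k. m < k \<Longrightarrow> k \<le> n \<Longrightarrow> \<not> hit_time i k X \<le> n"
    by (rule obtain_last_between[where Q = "\<lambda>k. hit_time i k X \<le> n"]) blast
  obtain j where j: "k0 \<le> j" "j \<le> m" "regenerates i j X"
    and j_last: "\<And>k. j < k \<Longrightarrow> k \<le> m \<Longrightarrow> \<not> regenerates i k X"
    by (rule obtain_last_between[where Q = "\<lambda>k. regenerates i k X", OF k0 m(1)]) blast
  obtain j' where "j < j'" "j' \<le> 2 * j" "regenerates i j' X"
    using next_regeneration[OF j(1,3)] by auto
  hence m_less: "Suc m \<le> 2 * j" using j_last[of j'] by (cases "j' \<le> m") auto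
  have "n < hit_time i (Suc m) X"
    using m_last[of "Suc m"] le_hit_time[OF X, of "Suc m"] by (cases "Suc m \<le> n") auto
  also have "\<dots> = hit_time i k0 X + hit_time i (Suc m - k0) (after i k0 X)"
    using hit_time_add[OF X, of k0 "Suc m - k0"] m(1) by simp
  also have "hit_time i (Suc m - k0) (after i k0 X) \<le> b * (Suc m - k0)"
    using m(1) by (intro linear) simp
  also have "\<dots> \<le> (b + 1) * (2 * j)" using m_less by (intro mult_le_mono) auto
  finally have "n \<le> 4 * (b + 1) * j" using n by linarith
  hence "real n \<le> real (4 * (b + 1) * j)" by (simp only: of_nat_le_iff)
  hence "1 / (4 * (real b + 1)) * real n \<le> real j" by (simp add: field_simps)
  moreover have "hit_time i j X \<le> n" using hit_time_mono[OF X j(2)] m(3) by simp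
  hence "int j \<le> X n $ i" using j(3) regenerates_iff[OF X] by simp
  ultimately show ?thesis by linarith
qed

lemma (in kalikow_walk) AE_positive_speed:
  "AE X in P. 0 < liminf (\<lambda>n. ereal (real_of_int (X n $ i) / real n))"
  using AE_climbing AE_regenerates_linearly_climbing AE_next_regeneration_within_double
    AE_infinitely_many_regenerations
proof eventually_elim
  case (elim X)
  obtain k1 where k1: "\<And>k. k1 \<le> k \<Longrightarrow> regenerates i k X \<Longrightarrow> \<exists>j\<in>{k<..2*k}. regenerates i j X"
    using elim(3) by (auto simp: eventually_sequentially)
  obtain k0 where k0: "k1 \<le> k0" "regenerates i k0 X" using elim(4) by blast
  then obtain b where "\<And>n. 1 \<le> n \<Longrightarrow> hit_time i n (after i k0 X) \<le> b * n"
    using elim(2) by (auto simp: linearly_climbing_def)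
  hence lower: "1 / (4 * (real b + 1)) * real n \<le> real_of_int (X n $ i)"
    if "2 * hit_time i k0 X \<le> n" for n
    using that k0 k1 by (intro regeneration_linear_lower_bound[OF elim(1)]) auto
  have "0 < 1 / (4 * (real b + 1))" by (intro divide_pos_pos mult_pos_pos) linarith+
  thus ?case using lower by (rule liminf_pos_of_linear_lower_bound)
qed

section \<open>From quenched to annealed laws\<close>

lemma emeasure_quenched_cyl:
  assumes "is_quenched_law \<omega> 0 Q"
  shows "emeasure Q (cyl n zs) = ennreal (if zs 0 = 0 then traj_weight \<omega> zs n else 0)"
proof -
  interpret Q: prob_space Q using assms by (simp add: is_quenched_law_def)
  have "space Q = UNIV"
    using assms sets_eq_imp_space_eq[of Q path_space] by (simp add: is_quenched_law_def)
  hence "measure Q (cyl n zs) = (if zs 0 = 0 then traj_weight \<omega> zs n else 0)"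
    using assms by (simp add: is_quenched_law_def cyl_def traj_weight_def)
  thus ?thesis by (simp only: Q.emeasure_eq_measure)
qed

context rwre
begin

lemma measurable_quenched_kernel:
  assumes \<rho>: "\<rho> \<in> measurable env env" and K: "\<And>\<omega>. is_quenched_law (\<rho> \<omega>) 0 (K \<omega>)"
  shows "K \<in> measurable env (prob_algebra path_space)"
proof (rule measurable_prob_algebra_generated[OF sets_path_space_eq Int_stable_cyls])
  show "(\<lambda>\<omega>. emeasure (K \<omega>) A) \<in> borel_measurable env" if "A \<in> cyls" for A
    using that
  proof (cases rule: cyls_cases)
    case (2 n zs)
    have "(\<lambda>\<omega>. traj_weight (\<rho> \<omega>) zs n) \<in> borel_measurable env"
      by (rule measurable_compose[OF \<rho> measurable_traj_weight])
    thus ?thesis using 2 by (cases "zs 0 = 0") (simp_all add: emeasure_quenched_cyl[OF K])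
  qed simp
qed (use K in \<open>auto simp: is_quenched_law_def\<close>)

lemma annealed_walk_bind:
  assumes K: "K \<in> measurable env (prob_algebra path_space)"
    and law: "AE \<omega> in env. is_quenched_law \<omega> 0 (K \<omega>)"
  shows "annealed_walk \<mu> (env \<bind> K)"
proof (intro annealed_walk.intro annealed_walk_axioms.intro)
  note K_subprob = measurable_prob_algebraD[OF K]
  show "rwre \<mu>" by (rule rwre_axioms)
  show prob: "prob_space (env \<bind> K)"
    using measurable_space[OF K]
    by (intro env.prob_space_bind[OF _ K_subprob] AE_I2) (simp add: space_prob_algebra)
  show "sets (env \<bind> K) = sets path_space"
    by (rule sets_bind[OF sets_kernel[OF K_subprob] env.not_empty])
  fix n and zs :: "nat \<Rightarrow> int ^ 'd"
  interpret bind: prob_space "env \<bind> K" by (rule prob)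
  have "ennreal (measure (env \<bind> K) (cyl n zs)) = (\<integral>\<^sup>+\<omega>. emeasure (K \<omega>) (cyl n zs) \<partial>env)"
    unfolding bind.emeasure_eq_measure[symmetric]
    by (rule emeasure_bind[OF env.not_empty K_subprob cyl_in_sets])
  also have "\<dots> = (\<integral>\<^sup>+\<omega>. ennreal (if zs 0 = 0 then traj_weight \<omega> zs n else 0) \<partial>env)"
    using law
    by (intro nn_integral_cong_AE) (auto elim!: eventually_mono simp: emeasure_quenched_cyl)
  also have "\<dots> = ennreal (if zs 0 = 0 then annealed_weight zs n else 0)"
    by (simp add: nn_integral_traj_weight)
  finally show "measure (env \<bind> K) (cyl n zs) = (if zs 0 = 0 then annealed_weight zs n else 0)"
    by (subst (asm) ennreal_inj) (auto simp: annealed_weight_nonneg)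
qed

lemma pred_probvecs [measurable]: "Measurable.pred env (\<lambda>\<omega>. \<forall>y. \<omega> y \<in> probvecs)"
proof -
  have "Measurable.pred \<mu> (\<lambda>p. p \<in> probvecs)" unfolding probvecs_def mem_Collect_eq by measurable
  hence "Measurable.pred env (\<lambda>\<omega>. \<omega> y \<in> probvecs)" for y
    by (rule measurable_compose[OF measurable_site])
  thus ?thesis by measurable
qed

text \<open>The quenched laws are only prescribed for environments in \<open>probvecs\<close>; elsewhere they are
  replaced by a fixed one, which makes them a measurable kernel.\<close>
lemma annealed_walk_exists:
  fixes Pq :: "(int ^ 'd \<Rightarrow> int ^ 'd \<Rightarrow> real) \<Rightarrow> (nat \<Rightarrow> int ^ 'd) measure"
  assumes quenched: "\<And>\<omega>. (\<forall>y. \<omega> y \<in> probvecs) \<Longrightarrow> is_quenched_law \<omega> 0 (Pq \<omega>)"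
  obtains P where "annealed_walk \<mu> P"
    "\<And>Q. Measurable.pred path_space Q \<Longrightarrow> AE X in P. Q X \<Longrightarrow> AE \<omega> in env. AE X in Pq \<omega>. Q X"
proof -
  let ?ok = "\<lambda>\<omega> :: int ^ 'd \<Rightarrow> int ^ 'd \<Rightarrow> real. \<forall>y. \<omega> y \<in> probvecs"
  have AE_ok: "AE \<omega> in env. ?ok \<omega>" using AE_env_probvecs by eventually_elim auto
  have "\<not> (AE \<omega> in env. False)" using env.AE_False by blast
  then obtain \<omega>0 where \<omega>0: "?ok \<omega>0" using AE_ok by (metis (mono_tags, lifting) eventually_mono)
  define \<rho> where "\<rho> \<omega> = (if ?ok \<omega> then \<omega> else \<omega>0)" for \<omega>
  define K where "K \<omega> = Pq (\<rho> \<omega>)" for \<omega>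
  have "\<rho> \<in> measurable env env" 
    unfolding \<rho>_def by (intro measurable_If predE pred_probvecs) auto
  moreover have law: "is_quenched_law (\<rho> \<omega>) 0 (K \<omega>)" for \<omega>
    unfolding K_def by (rule quenched) (use \<omega>0 in \<open>auto simp: \<rho>_def\<close>)
  ultimately have K: "K \<in> measurable env (prob_algebra path_space)"
    by (rule measurable_quenched_kernel)
  show ?thesis
  proof (rule that[of "env \<bind> K"])
    show "annealed_walk \<mu> (env \<bind> K)"
    proof (rule annealed_walk_bind[OF K])
      show "AE \<omega> in env. is_quenched_law \<omega> 0 (K \<omega>)"
        using AE_ok
      proof eventually_elim
        case (elim \<omega>)
        thus ?case using law[of \<omega>] by (simp add: \<rho>_def)
      qed
    qed
    fix Q assume "Measurable.pred path_space Q" "AE X in env \<bind> K. Q X"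
    hence "AE \<omega> in env. AE X in K \<omega>. Q X"
      using AE_bind[OF measurable_prob_algebraD[OF K]] by simp
    with AE_ok show "AE \<omega> in env. AE X in Pq \<omega>. Q X"
    proof eventually_elim
      case (elim \<omega>)
      hence "K \<omega> = Pq \<omega>" by (simp add: K_def \<rho>_def)
      with elim(2) show ?case by (simp only:)
    qed
  qed
qed

end

theorem (in elliptic_rwre) kalikow_condition_imp_ballistic:
  fixes Pq :: "(int ^ 'd \<Rightarrow> int ^ 'd \<Rightarrow> real) \<Rightarrow> (nat \<Rightarrow> int ^ 'd) measure"
  assumes kalikow: "kalikow_condition env (axis i 1)"
    and quenched: "\<And>\<omega>. (\<forall>y. \<omega> y \<in> probvecs) \<Longrightarrow> is_quenched_law \<omega> 0 (Pq \<omega>)"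
  shows "AE \<omega> in env. AE X in Pq \<omega>. 0 < liminf (\<lambda>n. ereal (real_of_int (X n $ i) / real n))"
proof -
  obtain P where P: "annealed_walk \<mu> P"
    "\<And>Q. Measurable.pred path_space Q \<Longrightarrow> AE X in P. Q X \<Longrightarrow> AE \<omega> in env. AE X in Pq \<omega>. Q X"
    using annealed_walk_exists[OF quenched] by metis
  interpret annealed_walk \<mu> P by (rule P(1))
  interpret kalikow_walk \<mu> \<kappa> P i by unfold_locales (rule kalikow)
  have "(\<lambda>X :: nat \<Rightarrow> int ^ 'd. ereal (real_of_int (X n $ i) / real n))
      \<in> borel_measurable path_space" for n
    by (rule measurable_compose[OF measurable_path_component[of n]]) simp
  hence "Measurable.pred path_space
      (\<lambda>X :: nat \<Rightarrow> int ^ 'd. 0 < liminf (\<lambda>n. ereal (real_of_int (X n $ i) / real n)))"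
    by measurable
  thus ?thesis by (rule P(2)) (rule AE_positive_speed)
qed

lemma ellipticity_constant_le:
  fixes \<epsilon> d :: real
  assumes "0 < \<epsilon>" "\<epsilon> < 1" "0 < d"
  shows "2 / ((1 - \<epsilon> / 2) / (2 * d)) \<le> 4 * d * (1 + 9 * \<epsilon>)"
proof -
  have "\<epsilon> * \<epsilon> \<le> \<epsilon>" using assms by (simp add: mult_le_cancel_right1)
  hence "1 \<le> (1 + 9 * \<epsilon>) * (1 - \<epsilon> / 2)" using assms by (simp add: algebra_simps)
  hence "4 * d * (1 / (1 - \<epsilon> / 2)) \<le> 4 * d * (1 + 9 * \<epsilon>)"
    using assms by (intro mult_left_mono) (auto simp: divide_le_eq)
  thus ?thesis by simp
qed

theorem theorem1p2:
  fixes \<mu> :: "(int ^ 'd \<Rightarrow> real) measure"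
    and i1 :: 'd
    and Pq :: "(int ^ 'd \<Rightarrow> int ^ 'd \<Rightarrow> real) \<Rightarrow> (nat \<Rightarrow> int ^ 'd) measure"
  assumes dim: "CARD('d) \<ge> 2"
    and mu_prob: "prob_space \<mu>"
    and mu_sets: "sets \<mu> = sets (\<Pi>\<^sub>M e\<in>UNIV. (borel :: real measure))"
    and mu_supp: "AE p in \<mu>. p \<in> probvecs"
    and A2: "0 < eps_of \<mu>" "eps_of \<mu> < 1"
    and quenched: "\<And>\<omega>. (\<forall>y. \<omega> y \<in> probvecs) \<Longrightarrow> is_quenched_law \<omega> 0 (Pq \<omega>)"
    and drift: "lambda_of \<mu> i1 > 4 * real CARD('d) * (sigma_of \<mu>)\<^sup>2 * (1 + 9 * eps_of \<mu>)"
  shows "kalikow_condition (env_law \<mu>) (axis i1 1)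
       \<and> (AE \<omega> in env_law \<mu>. AE X in Pq \<omega>.
            liminf (\<lambda>n. ereal (real_of_int (X n $ i1) / real n)) > 0)"
proof -
  define \<kappa> where "\<kappa> = (1 - eps_of \<mu> / 2) / (2 * real CARD('d))"
  interpret elliptic_rwre \<mu> \<kappa>
  proof (intro elliptic_rwre.intro rwre.intro rwre_axioms.intro elliptic_rwre_axioms.intro)
    show "0 < \<kappa>" using A2(2) by (simp add: \<kappa>_def)
    show "AE p in \<mu>. p \<in> elliptic_vecs \<kappa>"
      unfolding \<kappa>_def by (rule AE_elliptic_of_eps[OF mu_supp A2(1)])
  qed (rule mu_prob mu_sets mu_supp)+
  have "2 / \<kappa> * (sigma_of \<mu>)\<^sup>2 \<le> 4 * real CARD('d) * (1 + 9 * eps_of \<mu>) * (sigma_of \<mu>)\<^sup>2"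
    unfolding \<kappa>_def by (intro mult_right_mono ellipticity_constant_le A2) simp_all
  also have "\<dots> = 4 * real CARD('d) * (sigma_of \<mu>)\<^sup>2 * (1 + 9 * eps_of \<mu>)" by simp
  finally have "0 < drift_bound i1" using drift by (simp add: drift_bound_def)
  hence "kalikow_condition env (axis i1 1)" by (rule kalikow_condition_of_drift_bound_pos)
  thus ?thesis using kalikow_condition_imp_ballistic[OF _ quenched] by blast
qed

end
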